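(* For every $\omega\in A_n$, $$F^d_\omega(\mathbf x,\mathbf y)=\sum_{T\in E(\omega)}\ \sum_{S\in\mathcal H(\mathrm{sh}(T))} s_{dw(S,1)}(\mathbf x)\,s_{dw(S,2)}(\mathbf y),$$ where $s_\nu$ denotes the Schur function, $E(\omega)$ is the set of Edelman–Greene tableaux for $\omega$, and $\mathcal H(\lambda)$ is the set of primed tableaux $S$ of shape $\lambda$ such that the reading words of $S$ and of $S^+$ are both reverse Yamanouchi words (for these $S$, the vectors $dw(S,1),dw(S,2)$ are partitions).
   Context: Let $W$ be the group generated by $s_{-n},\dots,s_n$ subject to $(s_as_b)^{m_{ab}}=1$, with $m_{ab}=1$ if $|a|=|b|$; $3$ if $a,b\ne0$ and $\bigl||a|-|b|\bigr|=1$; $4$ if one of $a,b$ is $0$ and $\bigl||a|-|b|\bigr|=1$; $2$ if $\bigl||a|-|b|\bigr|>1$. $A_n$ = subgroup generated by $s_1,\dots,s_n$. Reduced word: minimal-length expression in $s_{-n},\dots,s_n$. $RSIF_k(\omega)$: reduced words for $\omega$ divided into $k$ consecutive (possibly empty) blocks, each strictly increasing for $s_{-n}<\dots<s_0<\dots<s_n$; double weight $(dw(v,1),dw(v,2))$: $i$-th entries = number of negative-index, resp. nonnegative-index, generators in block $i$. $F^d_\omega(x,y)=\sum_{v\in RSIF_k(\omega)}x^{dw(v,1)}y^{dw(v,2)}$, and $F^d_\omega(\mathbf x,\mathbf y)$ is the limit $k\to\infty$. Edelman–Greene tableau for $\omega\in A_n$: filling of a Young diagram with $s_1,\dots,s_n$,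 rows and columns strictly increasing, reading word (rows left to right, bottom row to top row) a reduced word for $\omega$. Primed tableau over $\{1'<1<2'<2<\cdots\}$: rows and columns weakly increasing, at most one $i'$ per row and at most one $i$ per column; double weight $(dw(S,1),dw(S,2))$ with $dw(S,1)(i)=\#\{i'\}$, $dw(S,2)(i)=\#\{i\}$. The reading word of $S$ is the word of its unprimed entries read row by row left to right, bottom row to top row. $S^+$ is obtained by transposing $S$ and replacing each entry by the next letter in the chain $1'<1<2'<2<\cdots$. A word is reverse Yamanouchi if, for every $i$ and every final segment of it, the number of letters $i$ is at least the number of letters $i+1$. *)

theory Defs
  imports Main
begin

text \<open>Generators s_a, a in {-n..n}, are encoded by the integer a.
  Coxeter exponent m_ab as in the paper.\<close>

definition m_coef :: "int \<Rightarrow> int \<Rightarrow> nat" where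
  "m_coef a b =
     (if \<bar>a\<bar> = \<bar>b\<bar> then 1
      else if \<bar>\<bar>a\<bar> - \<bar>b\<bar>\<bar> = 1 then (if a = 0 \<or> b = 0 then 4 else 3)
      else 2)"

text \<open>Equality in W of two words: the congruence on words generated by the
  relations (s_a s_b)^(m_ab) = 1.  Since every generator is an involution
  (m_aa = 1), this monoid presentation presents the group W.\<close>

inductive word_eq :: "nat \<Rightarrow> int list \<Rightarrow> int list \<Rightarrow> bool" for n :: nat where
  refl: "word_eq n u u"
| sym: "word_eq n u v \<Longrightarrow> word_eq n v u"
| trans: "word_eq n u v \<Longrightarrow> word_eq n v w \<Longrightarrow> word_eq n u w"
| ctx: "word_eq n u v \<Longrightarrow> word_eq n (p @ u @ q) (p @ v @ q)"
| rel: "a \<in> {- int n..int n} \<Longrightarrow> b \<in> {- int n..int n} \<Longrightarrow>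
        word_eq n (concat (replicate (m_coef a b) [a, b])) []"

definition reduced_word :: "nat \<Rightarrow> int list \<Rightarrow> int list \<Rightarrow> bool" where
  "reduced_word n w u \<longleftrightarrow>
     set w \<subseteq> {- int n..int n} \<and> word_eq n w u \<and>
     (\<forall>w'. set w' \<subseteq> {- int n..int n} \<longrightarrow> word_eq n w' u \<longrightarrow> length w \<le> length w')"

definition RSIF :: "nat \<Rightarrow> int list \<Rightarrow> nat \<Rightarrow> int list list set" where
  "RSIF n u k = {v. length v = k \<and> (\<forall>blk\<in>set v. sorted_wrt (<) blk) \<and>
                    reduced_word n (concat v) u}"

definition dw1 :: "int list list \<Rightarrow> nat \<Rightarrow> nat" where
  "dw1 v i = (if 1 \<le> i \<and> i \<le> length v then length (filter (\<lambda>a. a < 0) (v ! (i - 1))) else 0)"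

definition dw2 :: "int list list \<Rightarrow> nat \<Rightarrow> nat" where
  "dw2 v i = (if 1 \<le> i \<and> i \<le> length v then length (filter (\<lambda>a. 0 \<le> a) (v ! (i - 1))) else 0)"

section \<open>Tableaux as lists of rows (English notation, top row first)\<close>

definition young :: "'a list list \<Rightarrow> bool" where
  "young R \<longleftrightarrow> (\<forall>row\<in>set R. row \<noteq> []) \<and> sorted_wrt (\<ge>) (map length R)"

text \<open>Columns of a tableau of Young shape are the rows of its transpose.\<close>

definition EG :: "nat \<Rightarrow> int list \<Rightarrow> int list list set" where
  "EG n u = {T. young T \<and> set (concat T) \<subseteq> {1..int n} \<and>
               (\<forall>row\<in>set T. sorted_wrt (<) row) \<and>
               (\<forall>col\<in>set (transpose T). sorted_wrt (<) col) \<and>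
               reduced_word n (concat (rev T)) u}"

text \<open>Primed alphabet 1' < 1 < 2' < 2 < ... encoded as 1 < 2 < 3 < 4 < ...:
  i' is 2i-1 and i is 2i.\<close>

definition primed_tableau :: "nat list list \<Rightarrow> bool" where
  "primed_tableau S \<longleftrightarrow> young S \<and> (\<forall>x\<in>set (concat S). 1 \<le> x) \<and>
     (\<forall>row\<in>set S. sorted row) \<and> (\<forall>col\<in>set (transpose S). sorted col) \<and>
     (\<forall>row\<in>set S. \<forall>x. odd x \<longrightarrow> count_list row x \<le> 1) \<and>
     (\<forall>col\<in>set (transpose S). \<forall>x. even x \<longrightarrow> count_list col x \<le> 1)"

definition pdw1 :: "nat list list \<Rightarrow> nat \<Rightarrow> nat" where
  "pdw1 S i = (if i = 0 then 0 else count_list (concat S) (2 * i - 1))"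

definition pdw2 :: "nat list list \<Rightarrow> nat \<Rightarrow> nat" where
  "pdw2 S i = (if i = 0 then 0 else count_list (concat S) (2 * i))"

definition reading_word :: "nat list list \<Rightarrow> nat list" where
  "reading_word S = map (\<lambda>x. x div 2) (filter even (concat (rev S)))"

definition plus_tab :: "nat list list \<Rightarrow> nat list list" where
  "plus_tab S = map (map Suc) (transpose S)"

definition reverse_yamanouchi :: "nat list \<Rightarrow> bool" where
  "reverse_yamanouchi w \<longleftrightarrow>
     (\<forall>i\<ge>1. \<forall>k\<le>length w. count_list (drop k w) (i + 1) \<le> count_list (drop k w) i)"

definition HT :: "nat list \<Rightarrow> nat list list set" where
  "HT lam = {S. primed_tableau S \<and> map length S = lam \<and>
               reverse_yamanouchi (reading_word S) \<and>
               reverse_yamanouchi (reading_word (plus_tab S))}"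

definition has_shape :: "nat list list \<Rightarrow> (nat \<Rightarrow> nat) \<Rightarrow> bool" where
  "has_shape R lam \<longleftrightarrow> (\<forall>i<length R. length (R ! i) = lam (Suc i)) \<and>
                       (\<forall>i\<ge>length R. lam (Suc i) = 0)"

definition ssyt :: "nat list list \<Rightarrow> bool" where
  "ssyt R \<longleftrightarrow> young R \<and> (\<forall>x\<in>set (concat R). 1 \<le> x) \<and>
     (\<forall>row\<in>set R. sorted row) \<and> (\<forall>col\<in>set (transpose R). sorted_wrt (<) col)"

definition schur_coeff :: "(nat \<Rightarrow> nat) \<Rightarrow> (nat \<Rightarrow> nat) \<Rightarrow> nat" where
  "schur_coeff lam a = card {R. ssyt R \<and> has_shape R lam \<and> (\<forall>m. count_list (concat R) m = a m)}"

end

theory Submission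
  imports Defs
begin

text \<open>
  Reduced words of an element of \<open>A_n\<close> do not contain \<open>s_0\<close>, and forgetting the signs turns a signed
  factorization into a reduced word cut into alternately decreasing and increasing blocks.
  Under Edelman--Greene insertion a decreasing block adds a vertical strip and an increasing block
  a horizontal strip, so factorizations correspond to pairs of an Edelman--Greene tableau and a
  chain of partitions of the same shape; such a chain is a primed tableau.

  It remains to expand the number of primed tableaux of shape \<open>\<theta>\<close> in Kostka numbers. A horizontal
  strip followed by a vertical strip can be switched into a vertical strip followed by a horizontal
  one, bijectively: \<open>\<gamma>/\<alpha>\<close> is a union of ribbons, in each of which all boxes but one are
  determined. So a chain along any lattice path from \<open>(0, 0)\<close> to \<open>(k, k)\<close> extends uniquely to a
  growth diagram on the whole grid; primed tableaux are the chains along the staircase path.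
  The Yamanouchi inequalities between consecutive strips are preserved by switches, hence hold on
  every row (column) of the grid as soon as they hold on one. The bottom row is a straight
  tableau, which can be replaced by any other tableau of the same shape without changing the right
  column, in particular by the Yamanouchi one; this splits off the first Kostka number. Doing the
  same with the left column and the top row splits off the second. The diagrams that remain are
  those with Yamanouchi rows and columns, which on the staircase path are the elements of \<open>HT\<close>.
\<close>

text \<open>Before and after a switch the free box of each ribbon has two choices. Matching them so
  that partial sums agree at every row boundary that meets no ribbon preserves the sizes of both
  strips, and it is what carries the Yamanouchi inequalities from one side of a square to the other.
  The matching is also symmetric under conjugation, so each fact about one direction of the grid
  yields the fact about the other.

  On the side of insertion, reducedness is what makes bumps and reverse bumps possible: in the cases
  without an outcome a letter could be commuted until it meets its equal. Only the shapes of the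
  intermediate tableaux are recorded; together with the final tableau they determine the
  factorization.

  Partitions are functions with a zero tail, so that shapes of all sizes live in one type. Rows and
  steps of a chain are numbered from 0, letters and variables from 1.\<close>

section \<open>Partitions, conjugation and strips\<close>

definition part :: "(nat \<Rightarrow> nat) \<Rightarrow> bool" where
  "part f \<longleftrightarrow> antimono f \<and> (\<exists>N. \<forall>r\<ge>N. f r = 0)"

definition hstrip :: "(nat \<Rightarrow> nat) \<Rightarrow> (nat \<Rightarrow> nat) \<Rightarrow> bool" where
  "hstrip \<alpha> \<beta> \<longleftrightarrow> (\<forall>r. \<alpha> r \<le> \<beta> r \<and> \<beta> (Suc r) \<le> \<alpha> r)"

definition vstrip :: "(nat \<Rightarrow> nat) \<Rightarrow> (nat \<Rightarrow> nat) \<Rightarrow> bool" where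
  "vstrip \<alpha> \<beta> \<longleftrightarrow> (\<forall>r. \<alpha> r \<le> \<beta> r \<and> \<beta> r \<le> Suc (\<alpha> r))"

abbreviation psum :: "(nat \<Rightarrow> nat) \<Rightarrow> nat \<Rightarrow> nat" where
  "psum f r \<equiv> sum f {..<r}"

definition psize :: "(nat \<Rightarrow> nat) \<Rightarrow> nat" where
  "psize f = sum f {r. f r \<noteq> 0}"

definition conjugate :: "(nat \<Rightarrow> nat) \<Rightarrow> nat \<Rightarrow> nat" where
  "conjugate f c = card {r. c < f r}"

text \<open>\<open>\<gamma>/\<alpha>\<close> is a disjoint union of ribbons. The equation says that above every row
  boundary that does not meet a ribbon, the strips \<open>\<beta>/\<alpha>\<close> and \<open>\<gamma>/\<beta>'\<close> have equally many boxes;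
  equivalently, the last box of each ribbon is of the same kind in the first filling
  as the first box of that ribbon in the second.\<close>

definition switch ::
    "(nat \<Rightarrow> nat) \<Rightarrow> (nat \<Rightarrow> nat) \<Rightarrow> (nat \<Rightarrow> nat) \<Rightarrow> (nat \<Rightarrow> nat) \<Rightarrow> bool" where
  "switch \<alpha> \<beta> \<beta>' \<gamma> \<longleftrightarrow> part \<alpha> \<and> part \<beta> \<and> part \<beta>' \<and> part \<gamma> \<and>
     hstrip \<alpha> \<beta> \<and> vstrip \<beta> \<gamma> \<and> vstrip \<alpha> \<beta>' \<and> hstrip \<beta>' \<gamma> \<and>
     (\<forall>r. \<gamma> (Suc r) \<le> \<alpha> r \<longrightarrow>
        psum \<beta> (Suc r) + psum \<beta>' (Suc r) = psum \<alpha> (Suc r) + psum \<gamma> (Suc r))"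

lemma partD: "part f \<Longrightarrow> i \<le> j \<Longrightarrow> f j \<le> f i"
  by (auto simp: part_def antimono_def)

lemma part_zero: "part (\<lambda>_. 0)"
  by (auto simp: part_def antimono_def)

lemma part_bound:
  assumes "part f" obtains N where "\<And>r. r \<ge> N \<Longrightarrow> f r = 0"
  using assms by (auto simp: part_def)

lemma part_finite:
  assumes "part f" shows "finite {r. c < f r}"
proof -
  obtain N where "\<And>r. r \<ge> N \<Longrightarrow> f r = 0" using part_bound[OF assms] by blast
  then have "{r. c < f r} \<subseteq> {..<N}" by (force simp: not_less[symmetric])
  then show ?thesis using finite_subset by blast
qed

lemma down_closed_eq:
  fixes A :: "nat set"
  assumes "finite A" "\<And>x y. x \<in> A \<Longrightarrow> y \<le> x \<Longrightarrow> y \<in> A"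
  shows "A = {..<card A}"
proof (cases "A = {}")
  case False
  have "A = {..Max A}"
  proof
    show "A \<subseteq> {..Max A}" using Max_ge[OF assms(1)] by blast
    show "{..Max A} \<subseteq> A" using assms(2)[OF Max_in[OF assms(1) False]] by blast
  qed
  then have "card A = Suc (Max A)"
    by (metis card_atMost)
  then show ?thesis using \<open>A = {..Max A}\<close> lessThan_Suc_atMost by metis
qed simp

text \<open>The rows longer than \<open>c\<close> form an initial segment. In this box form
  conjugation just swaps the two coordinates; together with \<open>nat_eqI\<close> and
  \<open>nat_leI\<close> it replaces most reasoning about cardinalities.\<close>

lemma conjugate_less_iff:
  assumes "part f" shows "r < conjugate f c \<longleftrightarrow> c < f r"
proof -
  have "{r. c < f r} = {..<card {r. c < f r}}"
  proof (rule down_closed_eq[OF part_finite[OF assms]])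
    fix x y assume "x \<in> {r. c < f r}" "y \<le> x"
    then show "y \<in> {r. c < f r}" using partD[OF assms, of y x] by simp
  qed
  then show ?thesis unfolding conjugate_def by blast
qed

lemma nat_eqI: "(\<And>x. x < (a::nat) \<longleftrightarrow> x < b) \<Longrightarrow> a = b"
  by (meson linorder_neqE_nat less_irrefl)

lemma nat_leI: "(\<And>x. x < (a::nat) \<Longrightarrow> x < b) \<Longrightarrow> a \<le> b"
  by (meson leI less_irrefl)

lemma part_conjugate: assumes "part f" shows "part (conjugate f)"
  unfolding part_def
proof
  show "antimono (conjugate f)"
    unfolding antimono_iff_le_Suc
    by (intro allI nat_leI) (use assms in \<open>simp add: conjugate_less_iff\<close>)
  have "conjugate f c = 0" if "c \<ge> f 0" for c
    using conjugate_less_iff[OF assms, of 0 c] that by auto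
  then show "\<exists>N. \<forall>r\<ge>N. conjugate f r = 0" by blast
qed

lemma conjugate_conjugate: "part f \<Longrightarrow> conjugate (conjugate f) = f"
  by (rule ext, rule nat_eqI) (simp add: conjugate_less_iff part_conjugate)

text \<open>A horizontal strip means that the box above a box of the larger shape lies in the
  smaller shape; a vertical strip means the same for the box to the left. Swapping coordinates turns
  one into the other.\<close>

lemma hstrip_conjugate:
  assumes "part \<alpha>" "part \<beta>" shows "hstrip (conjugate \<alpha>) (conjugate \<beta>) \<longleftrightarrow> vstrip \<alpha> \<beta>"
proof
  note t = conjugate_less_iff[OF assms(1)] conjugate_less_iff[OF assms(2)]
  assume h: "hstrip (conjugate \<alpha>) (conjugate \<beta>)"
  show "vstrip \<alpha> \<beta>"
    unfolding vstrip_def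
  proof (intro allI conjI)
    fix r
    show "\<alpha> r \<le> \<beta> r"
    proof (rule nat_leI)
      fix x assume "x < \<alpha> r"
      then have "r < conjugate \<beta> x" using h t(1)[of r x] by (auto simp: hstrip_def intro: less_le_trans)
      then show "x < \<beta> r" using t(2) by simp
    qed
    show "\<beta> r \<le> Suc (\<alpha> r)"
    proof (rule nat_leI)
      fix x assume x: "x < \<beta> r"
      show "x < Suc (\<alpha> r)"
      proof (cases x)
        case (Suc y)
        then have "r < conjugate \<alpha> y" using h t(2)[of r x] x by (auto simp: hstrip_def intro: less_le_trans)
        then show ?thesis using t(1) Suc by simp
      qed simp
    qed
  qed
next
  note t = conjugate_less_iff[OF assms(1)] conjugate_less_iff[OF assms(2)]
  assume v: "vstrip \<alpha> \<beta>"
  show "hstrip (conjugate \<alpha>) (conjugate \<beta>)"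
    unfolding hstrip_def
  proof (intro allI conjI)
    fix r
    show "conjugate \<alpha> r \<le> conjugate \<beta> r"
    proof (rule nat_leI)
      fix x assume "x < conjugate \<alpha> r"
      then have "r < \<beta> x" using v t(1)[of x r] by (auto simp: vstrip_def intro: less_le_trans)
      then show "x < conjugate \<beta> r" using t(2) by simp
    qed
    show "conjugate \<beta> (Suc r) \<le> conjugate \<alpha> r"
    proof (rule nat_leI)
      fix x assume "x < conjugate \<beta> (Suc r)"
      then have "Suc r < \<beta> x" using t(2) by simp
      also have "\<beta> x \<le> Suc (\<alpha> x)" using v by (simp add: vstrip_def)
      finally have "r < \<alpha> x" by simp
      then show "x < conjugate \<alpha> r" using t(1) by simp
    qed
  qed
qed

lemma vstrip_conjugate:
  assumes "part \<alpha>" "part \<beta>" shows "vstrip (conjugate \<alpha>) (conjugate \<beta>) \<longleftrightarrow> hstrip \<alpha> \<beta>"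
  using hstrip_conjugate[OF part_conjugate part_conjugate] assms by (simp add: conjugate_conjugate)

text \<open>Both sides count the boxes in the first \<open>c\<close> columns, once by columns and
  once by rows.\<close>

lemma psum_conjugate:
  assumes "part f" "\<And>r. r \<ge> N \<Longrightarrow> f r = 0"
  shows "psum (conjugate f) c = (\<Sum>s<N. min (f s) c)"
proof (induction c)
  case (Suc c)
  have "conjugate f c = card {s \<in> {..<N}. c < f s}"
  proof -
    have "{r. c < f r} = {s \<in> {..<N}. c < f s}"
      using assms(2) by (auto intro: ccontr simp: not_less)
    then show ?thesis by (simp add: conjugate_def)
  qed
  also have "\<dots> = (\<Sum>s<N. if c < f s then 1 else 0)"
    by (simp only: card_eq_sum sum.inter_filter[OF finite_lessThan])
  finally have "psum (conjugate f) (Suc c) = (\<Sum>s<N. min (f s) c + (if c < f s then 1 else 0))"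
    using Suc by (simp add: sum.distrib)
  also have "\<dots> = (\<Sum>s<N. min (f s) (Suc c))" by (intro sum.cong) auto
  finally show ?case .
qed simp

lemma psize_psum: "(\<And>r. r \<ge> N \<Longrightarrow> f r = 0) \<Longrightarrow> psize f = psum f N"
  unfolding psize_def by (rule sum.mono_neutral_left) (auto intro: ccontr simp: not_less)

lemma psize_conjugate:
  assumes "part f" shows "psize (conjugate f) = psize f"
proof -
  obtain N where N: "\<And>r. r \<ge> N \<Longrightarrow> f r = 0" using part_bound[OF assms] by blast
  have "conjugate f c = 0" if "c \<ge> f 0" for c
    using conjugate_less_iff[OF assms, of 0 c] that by auto
  then have "psize (conjugate f) = psum (conjugate f) (f 0)" by (rule psize_psum)
  also have "\<dots> = (\<Sum>s<N. min (f s) (f 0))" by (rule psum_conjugate[OF assms N])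
  also have "\<dots> = psum f N" by (intro sum.cong) (auto intro!: min_absorb1 partD[OF assms])
  also have "\<dots> = psize f" by (rule psize_psum[OF N, symmetric])
  finally show ?thesis .
qed

lemma psize_mono:
  assumes "part g" "\<And>r. f r \<le> g r" shows "psize f \<le> psize g"
proof -
  obtain N where N: "\<And>r. r \<ge> N \<Longrightarrow> g r = 0" using part_bound[OF assms(1)] by blast
  then have N': "\<And>r. r \<ge> N \<Longrightarrow> f r = 0" using assms(2) by (metis le_zero_eq)
  show ?thesis using psize_psum[OF N] psize_psum[OF N'] assms(2) by (simp add: sum_mono)
qed

text \<open>Past the last row of \<open>\<gamma>\<close> a row boundary meets no ribbon, so the
  defining equation there compares the full sizes.\<close>

lemma switch_psize:
  assumes "switch \<alpha> \<beta> \<beta>' \<gamma>" shows "psize \<beta> + psize \<beta>' = psize \<alpha> + psize \<gamma>"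
proof -
  obtain N where N: "\<And>r. r \<ge> N \<Longrightarrow> \<gamma> r = 0" 
    using assms part_bound unfolding switch_def by blast
  have b: "\<And>r. r \<ge> N \<Longrightarrow> \<beta> r = 0" "\<And>r. r \<ge> N \<Longrightarrow> \<beta>' r = 0" "\<And>r. r \<ge> N \<Longrightarrow> \<alpha> r = 0"
  proof -
    fix r assume "r \<ge> N"
    then have "\<gamma> r = 0" by (rule N)
    moreover have "\<alpha> r \<le> \<beta> r" "\<beta> r \<le> \<gamma> r" "\<beta>' r \<le> \<gamma> r"
      using assms unfolding switch_def hstrip_def vstrip_def by blast+
    ultimately show "\<beta> r = 0" "\<beta>' r = 0" "\<alpha> r = 0" by auto
  qed
  have "psum \<beta> (Suc N) + psum \<beta>' (Suc N) = psum \<alpha> (Suc N) + psum \<gamma> (Suc N)"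
    using assms N unfolding switch_def by auto
  then show ?thesis using N b by (simp add: psize_psum[where N=N])
qed

subsection \<open>Existence and uniqueness of the switch\<close>

text \<open>Going down the rows: where a ribbon crosses the lower boundary of row \<open>r\<close>,
  the strip inequalities squeeze the entry to \<open>Suc (\<alpha> r)\<close>; at every other
  boundary the equation fixes the partial sum and hence the entry.\<close>

lemma switch_unique_right:
  assumes "switch \<alpha> \<beta> \<beta>' \<gamma>" "switch \<alpha> \<beta> \<delta> \<gamma>" shows "\<beta>' = \<delta>"
proof -
  have "\<beta>' r = \<delta> r" for r
  proof (induction r rule: less_induct)
    case (less r)
    show ?case
    proof (cases "\<gamma> (Suc r) \<le> \<alpha> r")
      case True
      then have "psum \<beta>' (Suc r) = psum \<delta> (Suc r)"
        using assms unfolding switch_def by (metis add_left_cancel)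
      moreover have "psum \<beta>' r = psum \<delta> r" using less by (intro sum.cong) auto
      ultimately show ?thesis by simp
    next
      case False
      have "\<gamma> (Suc r) \<le> \<beta>' r" "\<beta>' r \<le> Suc (\<alpha> r)" "\<gamma> (Suc r) \<le> \<delta> r" "\<delta> r \<le> Suc (\<alpha> r)"
        using assms unfolding switch_def hstrip_def vstrip_def by auto
      then show ?thesis using False by simp
    qed
  qed
  then show ?thesis by auto
qed

text \<open>The number of boxes by which the new horizontal strip lags behind the old one above row \<open>r\<close>;
  it is 0 or 1.\<close>

primrec defect :: "(nat \<Rightarrow> nat) \<Rightarrow> (nat \<Rightarrow> nat) \<Rightarrow> (nat \<Rightarrow> nat) \<Rightarrow> nat \<Rightarrow> nat" where
  "defect \<alpha> \<beta> \<gamma> 0 = 0"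
| "defect \<alpha> \<beta> \<gamma> (Suc r) =
     (if \<gamma> (Suc r) \<le> \<alpha> r then 0 else defect \<alpha> \<beta> \<gamma> r + 1 - (\<gamma> r - \<beta> r))"

text \<open>The candidate is forced at crossed boundaries, and in every other row it takes the value
  that restores the equation of partial sums. The bound of the \<open>defect\<close> by
  \<open>\<gamma> r - \<beta> r\<close> is the point: it keeps this value between
  \<open>\<alpha> r\<close> and \<open>Suc (\<alpha> r)\<close>.\<close>

lemma switch_exists_right:
  assumes p: "part \<alpha>" "part \<beta>" "part \<gamma>" and h: "hstrip \<alpha> \<beta>" and v: "vstrip \<beta> \<gamma>"
  shows "\<exists>\<beta>'. switch \<alpha> \<beta> \<beta>' \<gamma>"
proof -
  let ?F = "defect \<alpha> \<beta> \<gamma>"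
  define \<delta> where "\<delta> r = (if \<gamma> (Suc r) \<le> \<alpha> r then \<alpha> r + (\<gamma> r - \<beta> r) - ?F r else Suc (\<alpha> r))" for r
  have ab: "\<alpha> r \<le> \<beta> r" "\<beta> (Suc r) \<le> \<alpha> r" "\<beta> r \<le> \<gamma> r" "\<gamma> r \<le> Suc (\<beta> r)" "\<gamma> (Suc r) \<le> \<gamma> r" for r
    using h v p unfolding hstrip_def vstrip_def by (auto intro: partD)
  have F: "?F r \<le> \<gamma> r - \<beta> r \<and> ?F r \<le> 1" for r
  proof (induction r)
    case (Suc r)
    have "\<gamma> (Suc r) - \<beta> (Suc r) = 1" if "\<not> \<gamma> (Suc r) \<le> \<alpha> r"
      using that ab(2)[of r] ab(4)[of "Suc r"] by auto
    then show ?case using Suc by auto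
  qed auto
  have d: "\<alpha> r \<le> \<delta> r" "\<delta> r \<le> Suc (\<alpha> r)" "\<delta> r \<le> \<gamma> r" "\<gamma> (Suc r) \<le> \<delta> r" for r
    using ab[of r] ab[of "Suc r"] F[of r] unfolding \<delta>_def by auto
  have hs: "hstrip \<delta> \<gamma>" and vs: "vstrip \<alpha> \<delta>" using d by (auto simp: hstrip_def vstrip_def)
  have pd: "part \<delta>"
  proof -
    obtain N where "\<And>r. r \<ge> N \<Longrightarrow> \<gamma> r = 0" using part_bound[OF p(3)] by blast
    then have z: "\<And>r. r \<ge> N \<Longrightarrow> \<delta> r = 0" using d(3) by (metis le_zero_eq)
    have "\<delta> (Suc r) \<le> \<delta> r" for r using d(3)[of "Suc r"] d(4)[of r] by simp
    then show ?thesis using z by (auto simp: part_def antimono_iff_le_Suc)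
  qed
  \<comment> \<open>The defect is exactly the amount by which the equation fails after
    \<open>r\<close> rows.\<close>
  have s: "psum \<beta> r + psum \<delta> r = psum \<alpha> r + psum \<gamma> r + ?F r" for r
  proof (induction r)
    case (Suc r)
    have "\<beta> r + \<delta> r + ?F r = \<alpha> r + \<gamma> r + ?F (Suc r)"
      using ab[of r] F[of r] ab(2,3,4)[of "Suc r"] F[of "Suc r"] unfolding \<delta>_def by auto
    then show ?case using Suc by simp
  qed simp
  have "psum \<beta> (Suc r) + psum \<delta> (Suc r) = psum \<alpha> (Suc r) + psum \<gamma> (Suc r)"
    if "\<gamma> (Suc r) \<le> \<alpha> r" for r
    using s[of "Suc r"] that by simp
  then have "switch \<alpha> \<beta> \<delta> \<gamma>"
    unfolding switch_def using p h v hs vs pd by blast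
  then show ?thesis by blast
qed

lemma sum_split: "(r::nat) \<le> N \<Longrightarrow> (\<Sum>s<N. f s) = (\<Sum>s<r. f s) + (\<Sum>s=r..<N. (f s :: nat))"
  by (simp add: lessThan_atLeast0 sum.atLeastLessThan_concat)

text \<open>A column boundary that meets no ribbon comes with a row boundary that meets none, namely
  the one above row \<open>conjugate \<alpha> c\<close>. For each of the four shapes the first
  \<open>Suc c\<close> columns then consist of a full rectangle and of all boxes from that row on,
  so the column equation is the equality of total sizes minus the row equation.\<close>

lemma switch_conjugate:
  assumes "switch \<alpha> \<beta> \<beta>' \<gamma>" shows "switch (conjugate \<alpha>) (conjugate \<beta>') (conjugate \<beta>) (conjugate \<gamma>)"
proof -
  note d = assms[unfolded switch_def]
  have p: "part \<alpha>" "part \<beta>" "part \<beta>'" "part \<gamma>" using d by auto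
  have le: "\<alpha> r \<le> \<beta> r" "\<beta> r \<le> \<gamma> r" "\<alpha> r \<le> \<beta>' r" "\<beta>' r \<le> \<gamma> r" for r
    using d by (auto simp: hstrip_def vstrip_def)
  have "psum (conjugate \<beta>') (Suc c) + psum (conjugate \<beta>) (Suc c) = psum (conjugate \<alpha>) (Suc c) + psum (conjugate \<gamma>) (Suc c)"
    if c: "conjugate \<gamma> (Suc c) \<le> conjugate \<alpha> c" for c
  proof -
    define r where "r = conjugate \<alpha> c"
    obtain N0 where N0: "\<And>r. r \<ge> N0 \<Longrightarrow> \<gamma> r = 0" using part_bound[OF p(4)] by blast
    define N where "N = N0 + Suc r"
    have N: "\<And>r. r \<ge> N \<Longrightarrow> \<gamma> r = 0" using N0 unfolding N_def by auto
    have z: "\<And>r. r \<ge> N \<Longrightarrow> \<alpha> r = 0" "\<And>r. r \<ge> N \<Longrightarrow> \<beta> r = 0" "\<And>r. r \<ge> N \<Longrightarrow> \<beta>' r = 0"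
      using N le by (metis le_zero_eq)+
    have rN: "r \<le> N" by (simp add: N_def)
    have up: "Suc c \<le> \<alpha> s" if "s < r" for s
      using conjugate_less_iff[OF p(1), of s c] that by (auto simp: r_def)
    have dn: "\<gamma> s \<le> Suc c" if "s \<ge> r" for s
      using conjugate_less_iff[OF p(4), of s "Suc c"] that c by (auto simp: r_def not_less[symmetric])
    have form: "psum (conjugate f) (Suc c) = r * Suc c + (\<Sum>s=r..<N. f s)"
      if f: "part f" "\<And>s. \<alpha> s \<le> f s" "\<And>s. f s \<le> \<gamma> s" for f
    proof -
      have "\<And>s. s \<ge> N \<Longrightarrow> f s = 0" using N f(3) by (metis le_zero_eq)
      then have "psum (conjugate f) (Suc c) = (\<Sum>s<N. min (f s) (Suc c))" by (rule psum_conjugate[OF f(1)])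
      also have "\<dots> = (\<Sum>s<r. min (f s) (Suc c)) + (\<Sum>s=r..<N. min (f s) (Suc c))"
        by (rule sum_split[OF rN])
      also have "(\<Sum>s<r. min (f s) (Suc c)) = (\<Sum>s<r. Suc c)"
        using up f(2) by (intro sum.cong) (auto simp: min_def intro: antisym le_trans)
      also have "(\<Sum>s=r..<N. min (f s) (Suc c)) = (\<Sum>s=r..<N. f s)"
        using dn f(3) by (intro sum.cong) (auto simp: min_def intro: antisym le_trans)
      finally show ?thesis by simp
    qed
    have tot: "psum \<beta> N + psum \<beta>' N = psum \<alpha> N + psum \<gamma> N"
      using switch_psize[OF assms] psize_psum[OF N] psize_psum[OF z(1)] psize_psum[OF z(2)] psize_psum[OF z(3)]
      by simp
    have cut: "psum \<beta> r + psum \<beta>' r = psum \<alpha> r + psum \<gamma> r"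
    proof (cases r)
      case (Suc r')
      have "\<gamma> r \<le> \<alpha> r'" using up[of r'] dn[of r] Suc by auto
      then show ?thesis using d Suc by auto
    qed simp
    have "(\<Sum>s=r..<N. \<beta> s) + (\<Sum>s=r..<N. \<beta>' s) = (\<Sum>s=r..<N. \<alpha> s) + (\<Sum>s=r..<N. \<gamma> s)"
      using tot cut sum_split[OF rN, of \<alpha>] sum_split[OF rN, of \<beta>] sum_split[OF rN, of \<beta>']
        sum_split[OF rN, of \<gamma>] by linarith
    then show ?thesis
      using form[OF p(1) le_refl le_trans[OF le(1,2)]] form[OF p(2) le(1,2)]
        form[OF p(3) le(3,4)] form[OF p(4) le_trans[OF le(1,2)] le_refl] by linarith
  qed
  then show ?thesis
    unfolding switch_def using d by (simp add: part_conjugate hstrip_conjugate vstrip_conjugate)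
qed

lemma switch_unique_left:
  assumes "switch \<alpha> \<beta> \<beta>' \<gamma>" "switch \<alpha> \<delta> \<beta>' \<gamma>" shows "\<beta> = \<delta>"
proof -
  have "conjugate \<beta> = conjugate \<delta>" by (rule switch_unique_right[OF switch_conjugate[OF assms(1)] switch_conjugate[OF assms(2)]])
  then have "conjugate (conjugate \<beta>) = conjugate (conjugate \<delta>)" by simp
  then show ?thesis using assms by (simp add: switch_def conjugate_conjugate)
qed

lemma switch_exists_left:
  assumes "part \<alpha>" "part \<beta>'" "part \<gamma>" "vstrip \<alpha> \<beta>'" "hstrip \<beta>' \<gamma>"
  shows "\<exists>\<beta>. switch \<alpha> \<beta> \<beta>' \<gamma>"
proof -
  obtain \<delta> where "switch (conjugate \<alpha>) (conjugate \<beta>') \<delta> (conjugate \<gamma>)"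
    using switch_exists_right[of "conjugate \<alpha>" "conjugate \<beta>'" "conjugate \<gamma>"] assms by (auto simp: part_conjugate hstrip_conjugate vstrip_conjugate)
  from switch_conjugate[OF this] show ?thesis using assms by (auto simp: conjugate_conjugate)
qed

subsection \<open>The Yamanouchi condition for two horizontal strips\<close>

text \<open>For \<open>\<beta>/\<alpha>\<close> the strip of the letter \<open>i\<close> and \<open>\<delta>/\<gamma>\<close> that of \<open>i + 1\<close>: the first \<open>r + 1\<close> rows
  contain at most as many letters \<open>i + 1\<close> as the first \<open>r\<close> rows contain letters \<open>i\<close>.
  Both sides are moved so that no subtraction occurs.\<close>

definition ucond ::
    "(nat \<Rightarrow> nat) \<Rightarrow> (nat \<Rightarrow> nat) \<Rightarrow> (nat \<Rightarrow> nat) \<Rightarrow> (nat \<Rightarrow> nat) \<Rightarrow> bool" where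
  "ucond \<alpha> \<beta> \<gamma> \<delta> \<longleftrightarrow> (\<forall>r. psum \<delta> (Suc r) + psum \<alpha> r \<le> psum \<gamma> (Suc r) + psum \<beta> r)"

lemma switch_forced:
  assumes "switch \<alpha> \<beta> \<beta>' \<gamma>" "\<not> \<gamma> (Suc r) \<le> \<alpha> r"
  shows "\<beta>' r = Suc (\<alpha> r)" "\<gamma> (Suc r) = Suc (\<alpha> r)" "\<beta> (Suc r) = \<alpha> r"
proof -
  have "\<beta> (Suc r) \<le> \<alpha> r" "\<gamma> (Suc r) \<le> Suc (\<beta> (Suc r))" "\<gamma> (Suc r) \<le> \<beta>' r" "\<beta>' r \<le> Suc (\<alpha> r)"
    using assms by (auto simp: switch_def hstrip_def vstrip_def)
  then show "\<beta>' r = Suc (\<alpha> r)" "\<gamma> (Suc r) = Suc (\<alpha> r)" "\<beta> (Suc r) = \<alpha> r"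
    using assms(2) by auto
qed

text \<open>A row whose lower boundary is crossed by a ribbon has a box of the vertical strip after
  the switch and at most one before it, so the inequality can only widen there; at the other
  boundaries it is reset to an equality.\<close>

lemma switch_psum_le:
  assumes "switch \<alpha> \<beta> \<beta>' \<gamma>"
  shows "psum \<alpha> r + psum \<gamma> r \<le> psum \<beta> r + psum \<beta>' r"
proof (induction r)
  case (Suc r)
  show ?case
  proof (cases "\<gamma> (Suc r) \<le> \<alpha> r")
    case True
    then show ?thesis using assms by (auto simp: switch_def)
  next
    case False
    have "\<gamma> r \<le> Suc (\<beta> r)" using assms by (auto simp: switch_def vstrip_def)
    then show ?thesis using Suc switch_forced[OF assms False] by simp
  qed
qed simp

text \<open>At boundaries free of ribbons the two conditions coincide. At a crossed boundary the
  condition after the switch is inherited from the row above, since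
  \<open>\<delta> (Suc r) \<le> \<gamma> r\<close> and \<open>\<beta>' r = \<gamma> (Suc r)\<close>;
  hence the induction downwards. The converse is the inequality of partial sums.\<close>

lemma ucond_switch_first:
  assumes s: "switch \<alpha> \<beta> \<beta>' \<gamma>" and h: "hstrip \<gamma> \<delta>"
  shows "ucond \<alpha> \<beta> \<gamma> \<delta> \<longleftrightarrow> ucond \<beta>' \<gamma> \<gamma> \<delta>"
proof
  assume u: "ucond \<beta>' \<gamma> \<gamma> \<delta>"
  show "ucond \<alpha> \<beta> \<gamma> \<delta>"
    unfolding ucond_def
  proof
    fix r
    show "psum \<delta> (Suc r) + psum \<alpha> r \<le> psum \<gamma> (Suc r) + psum \<beta> r"
      using u[unfolded ucond_def, rule_format, of r] switch_psum_le[OF s, of r] by simp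
  qed
next
  assume u: "ucond \<alpha> \<beta> \<gamma> \<delta>"
  have "psum \<delta> (Suc r) + psum \<beta>' r \<le> psum \<gamma> (Suc r) + psum \<gamma> r" for r
  proof (induction r)
    case 0
    then show ?case using u[unfolded ucond_def, rule_format, of 0] by simp
  next
    case (Suc r)
    show ?case
    proof (cases "\<gamma> (Suc r) \<le> \<alpha> r")
      case True
      then have "psum \<beta> (Suc r) + psum \<beta>' (Suc r) = psum \<alpha> (Suc r) + psum \<gamma> (Suc r)"
        using s by (auto simp: switch_def)
      then show ?thesis using u[unfolded ucond_def, rule_format, of "Suc r"] by linarith
    next
      case False
      have "\<delta> (Suc r) \<le> \<gamma> r" using h by (auto simp: hstrip_def)
      then show ?thesis using Suc switch_forced[OF s False] by simp
    qed
  qed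
  then show "ucond \<beta>' \<gamma> \<gamma> \<delta>" by (auto simp: ucond_def)
qed

text \<open>As for the first strip, except that at a crossed boundary the condition before the
  switch is inherited from the row below. The induction therefore runs upwards, starting where
  \<open>\<gamma>\<close> has no more rows.\<close>

lemma ucond_switch_second:
  assumes h: "hstrip \<rho> \<alpha>" and s: "switch \<alpha> \<beta> \<beta>' \<gamma>"
  shows "ucond \<rho> \<alpha> \<alpha> \<beta> \<longleftrightarrow> ucond \<rho> \<alpha> \<beta>' \<gamma>"
proof
  assume u: "ucond \<rho> \<alpha> \<alpha> \<beta>"
  show "ucond \<rho> \<alpha> \<beta>' \<gamma>"
    unfolding ucond_def
  proof
    fix r
    show "psum \<gamma> (Suc r) + psum \<rho> r \<le> psum \<beta>' (Suc r) + psum \<alpha> r"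
      using u[unfolded ucond_def, rule_format, of r] switch_psum_le[OF s, of "Suc r"] by linarith
  qed
next
  assume u: "ucond \<rho> \<alpha> \<beta>' \<gamma>"
  obtain N where N: "\<And>r. r \<ge> N \<Longrightarrow> \<gamma> r = 0" using part_bound s unfolding switch_def by blast
  have "psum \<beta> (Suc r) + psum \<rho> r \<le> psum \<alpha> (Suc r) + psum \<alpha> r" if "r \<le> N" for r
    using that
  proof (induction r rule: inc_induct)
    case base
    have "psum \<beta> (Suc N) + psum \<beta>' (Suc N) = psum \<alpha> (Suc N) + psum \<gamma> (Suc N)"
      using s N by (auto simp: switch_def)
    then show ?case using u[unfolded ucond_def, rule_format, of N] by linarith
  next
    case (step r)
    show ?case
    proof (cases "\<gamma> (Suc r) \<le> \<alpha> r")
      case True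
      then have "psum \<beta> (Suc r) + psum \<beta>' (Suc r) = psum \<alpha> (Suc r) + psum \<gamma> (Suc r)"
        using s by (auto simp: switch_def)
      then show ?thesis using u[unfolded ucond_def, rule_format, of r] by linarith
    next
      case False
      have "\<alpha> (Suc r) \<le> \<rho> r" using h by (auto simp: hstrip_def)
      then show ?thesis using step.IH switch_forced[OF s False] by simp
    qed
  qed
  moreover have "psum \<beta> (Suc r) + psum \<rho> r \<le> psum \<alpha> (Suc r) + psum \<alpha> r" if "r \<ge> N" for r
  proof -
    have "psum \<beta> (Suc r) + psum \<beta>' (Suc r) = psum \<alpha> (Suc r) + psum \<gamma> (Suc r)"
      using s N that by (auto simp: switch_def)
    then show ?thesis using u[unfolded ucond_def, rule_format, of r] by linarith
  qed
  ultimately have "psum \<beta> (Suc r) + psum \<rho> r \<le> psum \<alpha> (Suc r) + psum \<alpha> r" for r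
    by (cases "r \<le> N") auto
  then show "ucond \<rho> \<alpha> \<alpha> \<beta>" unfolding ucond_def by blast
qed

subsection \<open>Growth diagrams\<close>

definition strip :: "bool \<Rightarrow> (nat \<Rightarrow> nat) \<Rightarrow> (nat \<Rightarrow> nat) \<Rightarrow> bool" where
  "strip v \<alpha> \<beta> \<longleftrightarrow> (if v then vstrip \<alpha> \<beta> else hstrip \<alpha> \<beta>)"

definition chain :: "(nat \<Rightarrow> bool) \<Rightarrow> nat \<Rightarrow> (nat \<Rightarrow> nat \<Rightarrow> nat) \<Rightarrow> bool" where
  "chain t L X \<longleftrightarrow> (\<forall>i\<le>L. part (X i)) \<and> (\<forall>i<L. strip (t i) (X i) (X (Suc i)))"

text \<open>A growth diagram in the sense of Fomin, with \<open>switch\<close> as the local rule on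
  unit squares: the first coordinate counts vertical strips, the second one horizontal
  strips.\<close>

definition growth :: "nat \<Rightarrow> nat \<Rightarrow> (nat \<Rightarrow> nat \<Rightarrow> nat \<Rightarrow> nat) \<Rightarrow> bool" where
  "growth K M G \<longleftrightarrow>
     (\<forall>p\<le>K. \<forall>q\<le>M. part (G p q)) \<and>
     (\<forall>p<K. \<forall>q\<le>M. vstrip (G p q) (G (Suc p) q)) \<and>
     (\<forall>p\<le>K. \<forall>q<M. hstrip (G p q) (G p (Suc q))) \<and>
     (\<forall>p<K. \<forall>q<M. switch (G p q) (G p (Suc q)) (G (Suc p) q) (G (Suc p) (Suc q)))"

lemma strip_le: "strip v \<alpha> \<beta> \<Longrightarrow> \<alpha> r \<le> \<beta> r"
  by (auto simp: strip_def hstrip_def vstrip_def split: if_splits)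

text \<open>The new column of squares is filled starting from its prescribed end \<open>C\<close>:
  in each square three corners are known by then, and a switch supplies the fourth.\<close>

lemma column_exists:
  assumes "\<forall>q\<le>M. part (A q)" "\<forall>q<M. hstrip (A q) (A (Suc q))" "part C" "vstrip (A M) C"
  shows "\<exists>B. B M = C \<and> (\<forall>q\<le>M. part (B q) \<and> vstrip (A q) (B q)) \<and>
           (\<forall>q<M. hstrip (B q) (B (Suc q)) \<and> switch (A q) (A (Suc q)) (B q) (B (Suc q)))"
  using assms
proof (induction M arbitrary: C)
  case 0
  then show ?case by (intro exI[of _ "\<lambda>_. C"]) auto
next
  case (Suc M)
  obtain D where D: "switch (A M) (A (Suc M)) D C"
    using switch_exists_right[of "A M" "A (Suc M)" C] Suc.prems by auto
  obtain B where B: "B M = D" "\<forall>q\<le>M. part (B q) \<and> vstrip (A q) (B q)"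
    "\<forall>q<M. hstrip (B q) (B (Suc q)) \<and> switch (A q) (A (Suc q)) (B q) (B (Suc q))"
    using Suc.IH[of D] Suc.prems D by (auto simp: switch_def)
  show ?case
    using B D Suc.prems
    by (intro exI[of _ "B(Suc M := C)"]) (auto simp: le_Suc_eq less_Suc_eq switch_def)
qed

lemma row_exists:
  assumes "\<forall>p\<le>K. part (A p)" "\<forall>p<K. vstrip (A p) (A (Suc p))" "part C" "hstrip (A K) C"
  shows "\<exists>B. B K = C \<and> (\<forall>p\<le>K. part (B p) \<and> hstrip (A p) (B p)) \<and>
           (\<forall>p<K. vstrip (B p) (B (Suc p)) \<and> switch (A p) (B p) (A (Suc p)) (B (Suc p)))"
  using assms
proof (induction K arbitrary: C)
  case 0
  then show ?case by (intro exI[of _ "\<lambda>_. C"]) auto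
next
  case (Suc K)
  obtain D where D: "switch (A K) D (A (Suc K)) C"
    using switch_exists_left[of "A K" "A (Suc K)" C] Suc.prems by auto
  obtain B where B: "B K = D" "\<forall>p\<le>K. part (B p) \<and> hstrip (A p) (B p)"
    "\<forall>p<K. vstrip (B p) (B (Suc p)) \<and> switch (A p) (B p) (A (Suc p)) (B (Suc p))"
    using Suc.IH[of D] Suc.prems D by (auto simp: switch_def)
  show ?case
    using B D Suc.prems
    by (intro exI[of _ "B(Suc K := C)"]) (auto simp: le_Suc_eq less_Suc_eq switch_def)
qed

text \<open>Together with \<open>hpos\<close> this gives the coordinates after \<open>i\<close>
  steps of the lattice path described by \<open>t\<close>; a chain is placed on the grid along that
  path.\<close>

primrec vpos :: "(nat \<Rightarrow> bool) \<Rightarrow> nat \<Rightarrow> nat" where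
  "vpos t 0 = 0"
| "vpos t (Suc i) = vpos t i + (if t i then 1 else 0)"

primrec hpos :: "(nat \<Rightarrow> bool) \<Rightarrow> nat \<Rightarrow> nat" where
  "hpos t 0 = 0"
| "hpos t (Suc i) = hpos t i + (if t i then 0 else 1)"

lemma vpos_mono: "i \<le> j \<Longrightarrow> vpos t i \<le> vpos t j"
  by (rule lift_Suc_mono_le) auto

lemma hpos_mono: "i \<le> j \<Longrightarrow> hpos t i \<le> hpos t j"
  by (rule lift_Suc_mono_le) auto

text \<open>The last step of the path enlarges the grid by one line of squares, which is filled
  backwards from the end of the path.\<close>

lemma growth_exists:
  assumes "chain t L X"
  shows "\<exists>G. growth (vpos t L) (hpos t L) G \<and> (\<forall>i\<le>L. G (vpos t i) (hpos t i) = X i)"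
  using assms
proof (induction L)
  case 0
  then show ?case by (intro exI[of _ "\<lambda>_ _. X 0"]) (auto simp: growth_def chain_def)
next
  case (Suc L)
  let ?K = "vpos t L" and ?M = "hpos t L"
  have "chain t L X" using Suc.prems by (auto simp: chain_def)
  then obtain G where G: "growth ?K ?M G" and GX: "\<And>i. i \<le> L \<Longrightarrow> G (vpos t i) (hpos t i) = X i"
    using Suc.IH by blast
  have X: "part (X (Suc L))" "strip (t L) (G ?K ?M) (X (Suc L))"
    using Suc.prems GX[of L] by (auto simp: chain_def)
  have le: "vpos t i \<le> ?K" "hpos t i \<le> ?M" if "i \<le> L" for i
    using that vpos_mono hpos_mono by auto
  show ?case
  proof (cases "t L")
    case True
    obtain B where B: "B ?M = X (Suc L)" "\<forall>q\<le>?M. part (B q) \<and> vstrip (G ?K q) (B q)"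
      "\<forall>q<?M. hstrip (B q) (B (Suc q)) \<and> switch (G ?K q) (G ?K (Suc q)) (B q) (B (Suc q))"
      using column_exists[of ?M "G ?K" "X (Suc L)"] G X True by (auto simp: growth_def strip_def)
    define G' where "G' p = (if p = Suc ?K then B else G p)" for p
    have "growth (Suc ?K) ?M G'"
      using G B unfolding growth_def G'_def by (auto simp: le_Suc_eq less_Suc_eq)
    moreover have "G' (vpos t i) (hpos t i) = X i" if "i \<le> L" for i
      using GX[OF that] le(1)[OF that] by (auto simp: G'_def)
    moreover have "G' (Suc ?K) ?M = X (Suc L)" using B(1) by (simp add: G'_def)
    ultimately show ?thesis using True by (intro exI[of _ G']) (auto simp: le_Suc_eq)
  next
    case False
    obtain B where B: "B ?K = X (Suc L)" "\<forall>p\<le>?K. part (B p) \<and> hstrip (G p ?M) (B p)"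
      "\<forall>p<?K. vstrip (B p) (B (Suc p)) \<and> switch (G p ?M) (B p) (G (Suc p) ?M) (B (Suc p))"
      using row_exists[of ?K "\<lambda>p. G p ?M" "X (Suc L)"] G X False by (auto simp: growth_def strip_def)
    define G' where "G' p q = (if q = Suc ?M then B p else G p q)" for p q
    have "growth ?K (Suc ?M) G'"
      using G B unfolding growth_def G'_def by (auto simp: le_Suc_eq less_Suc_eq)
    moreover have "G' (vpos t i) (hpos t i) = X i" if "i \<le> L" for i
      using GX[OF that] le(2)[OF that] by (auto simp: G'_def)
    moreover have "G' ?K (Suc ?M) = X (Suc L)" using B(1) by (simp add: G'_def)
    ultimately show ?thesis using False by (intro exI[of _ G']) (auto simp: le_Suc_eq)
  qed
qed

lemma growth_mono: "growth K M G \<Longrightarrow> K' \<le> K \<Longrightarrow> M' \<le> M \<Longrightarrow> growth K' M' G"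
  by (auto simp: growth_def)

lemma growth_unique:
  assumes "growth (vpos t L) (hpos t L) G" "growth (vpos t L) (hpos t L) G'"
    and "\<And>i. i \<le> L \<Longrightarrow> G (vpos t i) (hpos t i) = G' (vpos t i) (hpos t i)"
    and "p \<le> vpos t L" "q \<le> hpos t L"
  shows "G p q = G' p q"
  using assms
proof (induction L arbitrary: p q)
  case 0
  then show ?case by auto
next
  case (Suc L)
  let ?K = "vpos t L" and ?M = "hpos t L"
  have IH: "G p q = G' p q" if "p \<le> ?K" "q \<le> ?M" for p q
    using Suc.IH[OF growth_mono[OF Suc.prems(1)] growth_mono[OF Suc.prems(2)] Suc.prems(3)] that
    by simp
  show ?case
  proof (cases "t L")
    case True
    have "G (Suc ?K) q = G' (Suc ?K) q" if "q \<le> ?M" for q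
      using that
    proof (induction q rule: inc_induct)
      case base
      show ?case using Suc.prems(3)[of "Suc L"] True by simp
    next
      case (step q)
      have "switch (G ?K q) (G ?K (Suc q)) (G (Suc ?K) q) (G (Suc ?K) (Suc q))"
        "switch (G' ?K q) (G' ?K (Suc q)) (G' (Suc ?K) q) (G' (Suc ?K) (Suc q))"
        using Suc.prems(1,2) True step.hyps by (auto simp: growth_def)
      then show ?case using step.hyps step.IH IH[of ?K] switch_unique_right by simp
    qed
    then show ?thesis using Suc.prems(4,5) IH True by (auto simp: le_Suc_eq)
  next
    case False
    have "G p (Suc ?M) = G' p (Suc ?M)" if "p \<le> ?K" for p
      using that
    proof (induction p rule: inc_induct)
      case base
      show ?case using Suc.prems(3)[of "Suc L"] False by simp
    next
      case (step p)
      have "switch (G p ?M) (G p (Suc ?M)) (G (Suc p) ?M) (G (Suc p) (Suc ?M))"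
        "switch (G' p ?M) (G' p (Suc ?M)) (G' (Suc p) ?M) (G' (Suc p) (Suc ?M))"
        using Suc.prems(1,2) False step.hyps by (auto simp: growth_def)
      then show ?case using step.hyps step.IH IH[of _ ?M] switch_unique_left by simp
    qed
    then show ?thesis using Suc.prems(4,5) IH False by (auto simp: le_Suc_eq)
  qed
qed

lemma growth_chain:
  assumes "growth (vpos t L) (hpos t L) G" shows "chain t L (\<lambda>i. G (vpos t i) (hpos t i))"
proof -
  have le: "vpos t i \<le> vpos t L" "hpos t i \<le> hpos t L" if "i \<le> L" for i
    using that vpos_mono hpos_mono by auto
  have "strip (t i) (G (vpos t i) (hpos t i)) (G (vpos t (Suc i)) (hpos t (Suc i)))" if "i < L" for i
    using le[of i] le[of "Suc i"] that assms by (auto simp: growth_def strip_def split: if_splits)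
  then show ?thesis using assms le by (auto simp: chain_def growth_def)
qed

lemma growth_conjugate:
  assumes "growth K M G" shows "growth M K (\<lambda>p q. conjugate (G q p))"
  using assms unfolding growth_def by (auto simp: part_conjugate hstrip_conjugate vstrip_conjugate intro: switch_conjugate)

text \<open>Opposite sides of a square carry strips of equal size, so the horizontal weight can be
  read off at any \<open>p\<close>.\<close>

lemma growth_psize:
  assumes "growth K M G" "p \<le> K" "q < M"
  shows "psize (G p (Suc q)) + psize (G 0 q) = psize (G p q) + psize (G 0 (Suc q))"
  using assms(2)
proof (induction p)
  case (Suc p)
  have "switch (G p q) (G p (Suc q)) (G (Suc p) q) (G (Suc p) (Suc q))"
    using assms Suc.prems by (auto simp: growth_def)
  from switch_psize[OF this] show ?case using Suc by simp
qed simp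

text \<open>Two consecutive horizontal strips are moved from \<open>p\<close> to
  \<open>Suc p\<close> one at a time, the second strip first. The mixed condition in between
  compares strips at different values of the first coordinate, which is how consecutive horizontal
  strips meet on a staircase path.\<close>

lemma growth_ucond:
  assumes G: "growth K M G" and "p < K" "Suc q < M"
  shows "ucond (G p q) (G p (Suc q)) (G p (Suc q)) (G p (Suc (Suc q))) \<longleftrightarrow>
         ucond (G p q) (G p (Suc q)) (G (Suc p) (Suc q)) (G (Suc p) (Suc (Suc q)))"
    and "ucond (G p q) (G p (Suc q)) (G (Suc p) (Suc q)) (G (Suc p) (Suc (Suc q))) \<longleftrightarrow>
         ucond (G (Suc p) q) (G (Suc p) (Suc q)) (G (Suc p) (Suc q)) (G (Suc p) (Suc (Suc q)))"
  using assms by (auto simp: growth_def intro!: ucond_switch_second ucond_switch_first)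

lemma growth_ucond_column:
  assumes G: "growth K M G" and "p \<le> K" "Suc q < M"
  shows "ucond (G p q) (G p (Suc q)) (G p (Suc q)) (G p (Suc (Suc q))) \<longleftrightarrow>
         ucond (G 0 q) (G 0 (Suc q)) (G 0 (Suc q)) (G 0 (Suc (Suc q)))"
  using assms(2)
proof (induction p)
  case (Suc p)
  then show ?case using growth_ucond[OF G, of p q] assms(3) by simp
qed simp

lemma growth_ucond_stair:
  assumes G: "growth K M G" and "p < K" "Suc q < M"
  shows "ucond (G p q) (G p (Suc q)) (G (Suc p) (Suc q)) (G (Suc p) (Suc (Suc q))) \<longleftrightarrow>
         ucond (G 0 q) (G 0 (Suc q)) (G 0 (Suc q)) (G 0 (Suc (Suc q)))"
  using growth_ucond(1)[OF assms] growth_ucond_column[OF G, of p q] assms by simp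

subsection \<open>Counting growth diagrams\<close>

abbreviation empty_part :: "nat \<Rightarrow> nat" where
  "empty_part \<equiv> \<lambda>_. 0"

text \<open>Fixing the values from \<open>L\<close> on makes a chain a single function, so that sets
  of chains are finite and can be counted.\<close>

definition chain_set :: "(nat \<Rightarrow> bool) \<Rightarrow> nat \<Rightarrow> (nat \<Rightarrow> nat) \<Rightarrow> (nat \<Rightarrow> nat) \<Rightarrow> (nat \<Rightarrow> nat \<Rightarrow> nat) set" where
  "chain_set t L \<mu> \<theta> = {X. chain t L X \<and> X 0 = \<mu> \<and> (\<forall>i\<ge>L. X i = \<theta>)}"

definition has_weight :: "nat \<Rightarrow> (nat \<Rightarrow> nat \<Rightarrow> nat) \<Rightarrow> (nat \<Rightarrow> nat) \<Rightarrow> bool" where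
  "has_weight L X c \<longleftrightarrow> (\<forall>i<L. psize (X (Suc i)) = psize (X i) + c i)"

definition growth_set :: "nat \<Rightarrow> (nat \<Rightarrow> nat) \<Rightarrow> (nat \<Rightarrow> nat \<Rightarrow> nat \<Rightarrow> nat) set" where
  "growth_set k \<theta> = {G. growth k k G \<and> G 0 0 = empty_part \<and> G k k = \<theta> \<and> (\<forall>p q. G p q = G (min p k) (min q k))}"

definition yam_chain :: "nat \<Rightarrow> (nat \<Rightarrow> nat \<Rightarrow> nat) \<Rightarrow> bool" where
  "yam_chain k x \<longleftrightarrow> (\<forall>q. Suc q < k \<longrightarrow> ucond (x q) (x (Suc q)) (x (Suc q)) (x (Suc (Suc q))))"

definition step_sizes :: "nat \<Rightarrow> (nat \<Rightarrow> nat \<Rightarrow> nat) \<Rightarrow> nat \<Rightarrow> nat" where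
  "step_sizes k X r = (if r < k then psize (X (Suc r)) - psize (X r) else 0)"

text \<open>The Kostka number: a chain of horizontal strips from the empty shape is a semistandard
  tableau, with \<open>c i\<close> the multiplicity of the letter \<open>i + 1\<close>.\<close>

definition kostka :: "nat \<Rightarrow> (nat \<Rightarrow> nat) \<Rightarrow> (nat \<Rightarrow> nat) \<Rightarrow> nat" where
  "kostka k \<nu> c = card {X \<in> chain_set (\<lambda>_. False) k empty_part \<nu>. has_weight k X c}"

lemma chain_le:
  assumes "chain t L X" "i \<le> j" "j \<le> L" shows "X i r \<le> X j r"
  using assms(2,3)
proof (induction j rule: dec_induct)
  case (step n)
  then show ?case using assms(1) strip_le[of "t n" "X n" "X (Suc n)" r] by (auto simp: chain_def)
qed simp

lemma finite_below: assumes "part \<theta>" shows "finite {f. \<forall>r. f r \<le> \<theta> r}"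
proof -
  obtain N where N: "\<And>r. r \<ge> N \<Longrightarrow> \<theta> r = 0" using part_bound[OF assms] by blast
  have "finite {f. \<forall>r. (r \<in> {..<N} \<longrightarrow> f r \<in> {..\<theta> 0}) \<and> (r \<notin> {..<N} \<longrightarrow> f r = 0)}"
    by (rule finite_set_of_finite_funs) auto
  then show ?thesis
  proof (rule rev_finite_subset, intro subsetI CollectI allI conjI impI)
    fix f r assume f: "f \<in> {f. \<forall>r. f r \<le> \<theta> r}"
    have "f r \<le> \<theta> r" "\<theta> r \<le> \<theta> 0" using f partD[OF assms, of 0] by auto
    then show "f r \<in> {..\<theta> 0}" by simp
    assume "r \<notin> {..<N}"
    then show "f r = 0" using N[of r] \<open>f r \<le> \<theta> r\<close> by simp
  qed
qed

lemma finite_chains: "finite {X. chain t L X \<and> (\<forall>i\<ge>L. X i = \<theta>)}"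
proof (cases "part \<theta>")
  case True
  have "finite {X. \<forall>i. (i \<in> {..L} \<longrightarrow> X i \<in> {f. \<forall>r. f r \<le> \<theta> r}) \<and> (i \<notin> {..L} \<longrightarrow> X i = \<theta>)}"
    by (rule finite_set_of_finite_funs) (auto intro: finite_below[OF True])
  then show ?thesis
    by (rule rev_finite_subset) (use chain_le[of t L _ _ L] in force)
next
  case False
  then have "{X. chain t L X \<and> (\<forall>i\<ge>L. X i = \<theta>)} = {}" by (metis (mono_tags, lifting) Collect_empty_eq chain_def order_refl)
  then show ?thesis by (simp only: finite.emptyI)
qed

lemma finite_chain_set: "finite (chain_set t L \<mu> \<theta>)"
  by (rule finite_subset[OF _ finite_chains[of t L \<theta>]]) (auto simp: chain_set_def)

lemma growth_set_exists:
  assumes "chain t (2 * k) X" "vpos t (2 * k) = k" "hpos t (2 * k) = k" "X 0 = empty_part" "X (2 * k) = \<theta>"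
  shows "\<exists>G\<in>growth_set k \<theta>. \<forall>i\<le>2 * k. G (vpos t i) (hpos t i) = X i"
proof -
  obtain G where G: "growth k k G" "\<And>i. i \<le> 2 * k \<Longrightarrow> G (vpos t i) (hpos t i) = X i"
    using growth_exists[OF assms(1)] assms(2,3) by auto
  let ?G = "\<lambda>p q. G (min p k) (min q k)"
  have "growth k k ?G" using G(1) by (auto simp: growth_def min_def)
  moreover have "?G (vpos t i) (hpos t i) = X i" if "i \<le> 2 * k" for i
    using G(2)[OF that] vpos_mono[OF that, of t] hpos_mono[OF that, of t] assms(2,3) by simp
  moreover have "?G 0 0 = empty_part" using G(2)[of 0] assms by simp
  moreover have "?G k k = \<theta>" using G(2)[of "2 * k"] assms by simp
  ultimately show ?thesis by (intro bexI[of _ ?G]) (auto simp: growth_set_def)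
qed

lemma growth_set_min: "G \<in> growth_set k \<theta> \<Longrightarrow> G p q = G (min p k) (min q k)"
  unfolding growth_set_def by blast

lemma growth_set_unique:
  assumes "G \<in> growth_set k \<theta>" "G' \<in> growth_set k \<theta>" "vpos t (2 * k) = k" "hpos t (2 * k) = k"
    and "\<And>i. i \<le> 2 * k \<Longrightarrow> G (vpos t i) (hpos t i) = G' (vpos t i) (hpos t i)"
  shows "G = G'"
proof (intro ext)
  fix p q r
  have g: "growth (vpos t (2 * k)) (hpos t (2 * k)) G" "growth (vpos t (2 * k)) (hpos t (2 * k)) G'"
    using assms by (auto simp: growth_set_def)
  have "G (min p k) (min q k) = G' (min p k) (min q k)"
    by (rule growth_unique[OF g assms(5)]) (use assms in auto)
  then show "G p q r = G' p q r"
    using growth_set_min[OF assms(1), of p q] growth_set_min[OF assms(2), of p q] by (simp only:)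
qed

lemma pos_hook: "vpos (\<lambda>i. i < k) i = min i k" "hpos (\<lambda>i. i < k) i = i - k"
  by (induction i) auto

text \<open>The path that takes all its vertical steps before the horizontal ones runs along the
  bottom row and up the right column. Hence a growth diagram amounts to two chains that share the
  corner \<open>G k 0\<close> and are otherwise independent; this independence is what allows one of
  them to be replaced.\<close>

lemma growth_set_corner_bij:
  "bij_betw (\<lambda>G. (\<lambda>q. G k (min q k), \<lambda>p. G (min p k) 0)) (growth_set k \<theta>)
     (SIGMA y:{y. chain (\<lambda>_. False) k y \<and> (\<forall>i\<ge>k. y i = \<theta>)}. chain_set (\<lambda>_. True) k empty_part (y 0))"
  (is "bij_betw ?h _ (Sigma ?Y ?X)")
  unfolding bij_betw_def
proof (intro conjI)
  let ?t = "\<lambda>i. i < k"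
  show "inj_on ?h (growth_set k \<theta>)"
  proof (rule inj_onI)
    fix G G' assume G: "G \<in> growth_set k \<theta>" "G' \<in> growth_set k \<theta>" "?h G = ?h G'"
    have eq: "G k (min q k) = G' k (min q k)" "G (min p k) 0 = G' (min p k) 0" for p q
      using G(3) by (auto dest: fun_cong)
    show "G = G'"
    proof (rule growth_set_unique[OF G(1,2), of ?t])
      fix i assume "i \<le> 2 * k"
      then have "min (i - k) k = i - k" by simp
      then show "G (vpos ?t i) (hpos ?t i) = G' (vpos ?t i) (hpos ?t i)"
        using eq(1)[of "i - k"] eq(2)[of i] by (cases "i \<le> k") (auto simp: pos_hook)
    qed (auto simp: pos_hook)
  qed
  show "?h ` growth_set k \<theta> = Sigma ?Y ?X"
  proof (intro equalityI subsetI)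
    fix z assume "z \<in> ?h ` growth_set k \<theta>"
    then obtain G where "G \<in> growth_set k \<theta>" "z = ?h G" by blast
    then show "z \<in> Sigma ?Y ?X"
      by (auto simp: growth_set_def chain_set_def chain_def growth_def strip_def min_def)
  next
    fix z assume "z \<in> Sigma ?Y ?X"
    then obtain y x where z: "z = (y, x)" and y: "chain (\<lambda>_. False) k y" "\<And>i. i \<ge> k \<Longrightarrow> y i = \<theta>"
      and x: "chain (\<lambda>_. True) k x" "x 0 = empty_part" "\<And>i. i \<ge> k \<Longrightarrow> x i = y 0"
      by (auto simp: chain_set_def)
    define Z where "Z i = (if i \<le> k then x i else y (i - k))" for i
    have Zy: "Z i = y (i - k)" if "i \<ge> k" for i
      using that x(3)[of k] by (cases "i = k") (auto simp: Z_def)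
    have "chain ?t (2 * k) Z"
      unfolding chain_def
    proof (intro conjI allI impI)
      fix i assume "i \<le> 2 * k"
      then show "part (Z i)" using x(1) y(1) by (auto simp: Z_def chain_def)
    next
      fix i assume i: "i < 2 * k"
      show "strip (i < k) (Z i) (Z (Suc i))"
      proof (cases "i < k")
        case True
        then show ?thesis using x(1) by (auto simp: Z_def chain_def)
      next
        case False
        then have "strip False (y (i - k)) (y (Suc (i - k)))" using y(1) i by (auto simp: chain_def)
        then show ?thesis using Zy[of i] Zy[of "Suc i"] False by (simp add: Suc_diff_le)
      qed
    qed
    then obtain G where G: "G \<in> growth_set k \<theta>" "\<And>i. i \<le> 2 * k \<Longrightarrow> G (vpos ?t i) (hpos ?t i) = Z i"
      using growth_set_exists[of ?t k Z \<theta>] x(2) y(2)[of k] Zy[of "2 * k"] by (auto simp: pos_hook Z_def)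
    have "G k (min q k) = y q" for q
      using G(2)[of "k + min q k"] Zy[of "k + min q k"] y(2)[of q] y(2)[of k]
      by (auto simp: pos_hook min_def split: if_splits)
    moreover have "G (min p k) 0 = x p" for p
      using G(2)[of "min p k"] x(3)[of p] x(3)[of k]
      by (auto simp: pos_hook min_def Z_def split: if_splits)
    ultimately have "?h G = z" by (simp add: z)
    then show "z \<in> ?h ` growth_set k \<theta>" using G(1) by blast
  qed
qed

lemma finite_growth_set: "finite (growth_set k \<theta>)"
  using bij_betw_finite[OF growth_set_corner_bij[of k \<theta>]]
  by (auto intro!: finite_SigmaI finite_chain_set finite_chains)

subsection \<open>Yamanouchi chains of straight shape\<close>

text \<open>Each horizontal strip reaches at most one row further down than the shape before
  it.\<close>

lemma hchain_rows:
  assumes "X \<in> chain_set (\<lambda>_. False) k empty_part \<nu>" "m \<le> k" "m \<le> r" shows "X m r = 0"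
  using assms(2,3)
proof (induction m arbitrary: r)
  case 0
  then show ?case using assms(1) by (simp add: chain_set_def)
next
  case (Suc m)
  obtain r' where r': "r = Suc r'" "m \<le> r'" using Suc.prems by (cases r) auto
  have "X (Suc m) (Suc r') \<le> X m r'"
    using assms(1) Suc.prems by (auto simp: chain_set_def chain_def strip_def hstrip_def)
  then show ?case using Suc.IH[of r'] Suc.prems r' by simp
qed

text \<open>The only Yamanouchi tableau of straight shape has row \<open>r\<close> filled with the
  letter \<open>r + 1\<close>. If the letter \<open>q + 1\<close> avoids the first \<open>q\<close>
  rows, the inequality \<open>ucond\<close> at \<open>r = q\<close> keeps the letter
  \<open>q + 2\<close> out of the first \<open>q + 1\<close> rows.\<close>

lemma yam_chain_eq:
  assumes X: "X \<in> chain_set (\<lambda>_. False) k empty_part \<nu>" and y: "yam_chain k X"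
  shows "X = (\<lambda>m r. if r < m then \<nu> r else 0)"
proof -
  have c: "chain (\<lambda>_. False) k X" and \<nu>: "\<And>i. i \<ge> k \<Longrightarrow> X i = \<nu>" using X by (auto simp: chain_set_def)
  have P: "X (Suc m) r = X m r" if "r < m" "Suc m \<le> k" for m r
    using that
  proof (induction m arbitrary: r)
    case (Suc q)
    have "psum (X (Suc (Suc q))) (Suc q) + psum (X q) q \<le> psum (X (Suc q)) (Suc q) + psum (X (Suc q)) q"
      using y Suc.prems unfolding yam_chain_def ucond_def by auto
    moreover have "psum (X (Suc q)) q = psum (X q) q" using Suc by (intro sum.cong) auto
    ultimately have "psum (X (Suc (Suc q))) (Suc q) \<le> psum (X (Suc q)) (Suc q)" by simp
    moreover have le: "X (Suc q) s \<le> X (Suc (Suc q)) s" for s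
      using chain_le[OF c, of "Suc q" "Suc (Suc q)"] Suc.prems by auto
    ultimately have "psum (X (Suc q)) (Suc q) = psum (X (Suc (Suc q))) (Suc q)"
      by (meson antisym sum_mono)
    from sum_mono_inv[OF this le] show ?case using Suc.prems by auto
  qed simp
  have "X m r = X k r" if "r < m" "m \<le> k" for m r
    using that(2,1)
  proof (induction m rule: inc_induct)
    case (step n)
    then show ?case using P[of r n] by auto
  qed simp
  moreover have "X m r = \<nu> r" if "m \<ge> k" for m r using \<nu>[OF that] by simp
  moreover have "\<nu> r = 0" if "r \<ge> k" for r
    using hchain_rows[OF X le_refl that] \<nu>[of k] by simp
  ultimately show ?thesis
    using hchain_rows[OF X] by (intro ext) (metis le_cases le_trans not_less order_refl)
qed

lemma yam_chain_exists:
  assumes p: "part \<nu>" and z: "\<And>r. r \<ge> k \<Longrightarrow> \<nu> r = 0"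
  defines "Y \<equiv> \<lambda>m r. if r < m then \<nu> r else 0"
  shows "Y \<in> chain_set (\<lambda>_. False) k empty_part \<nu>" "yam_chain k Y"
proof -
  have d: "\<nu> (Suc r) \<le> \<nu> r" for r using partD[OF p] by simp
  have "part (Y i)" for i
    using d unfolding part_def antimono_iff_le_Suc Y_def by (auto intro!: exI[of _ i])
  then show "Y \<in> chain_set (\<lambda>_. False) k empty_part \<nu>"
    using z d by (auto simp: chain_set_def chain_def strip_def hstrip_def Y_def)
  have s: "psum (Y m) r = psum \<nu> (min r m)" for m r
  proof -
    have "psum (Y m) r = sum (Y m) {..<min r m}"
      by (rule sum.mono_neutral_right) (auto simp: Y_def)
    also have "\<dots> = psum \<nu> (min r m)" by (intro sum.cong) (auto simp: Y_def)
    finally show ?thesis .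
  qed
  show "yam_chain k Y"
    unfolding yam_chain_def ucond_def s
  proof (intro allI impI)
    fix q r
    show "psum \<nu> (min (Suc r) (Suc (Suc q))) + psum \<nu> (min r q) \<le>
          psum \<nu> (min (Suc r) (Suc q)) + psum \<nu> (min r (Suc q))"
    proof -
      consider "r \<le> q" | "r = Suc q" | "r > Suc q" by linarith
      then show ?thesis using d[of q] by cases (auto simp: min_def)
    qed
  qed
qed

lemma yam_chain_step_sizes:
  assumes X: "X \<in> chain_set (\<lambda>_. False) k empty_part \<nu>" and y: "yam_chain k X"
  shows "step_sizes k X = \<nu>"
proof
  fix r
  have z: "\<nu> r = 0" if "r \<ge> k" for r
    using hchain_rows[OF X le_refl that] X by (simp add: chain_set_def)
  have "psize (X m) = psum \<nu> m" for m
  proof -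
    have "psize (X m) = psum (X m) m" by (rule psize_psum) (simp add: yam_chain_eq[OF assms])
    also have "\<dots> = psum \<nu> m" by (intro sum.cong) (auto simp: yam_chain_eq[OF assms])
    finally show ?thesis .
  qed
  then show "step_sizes k X r = \<nu> r" using z by (simp add: step_sizes_def)
qed

lemma card_yam_chain:
  assumes "X \<in> chain_set (\<lambda>_. False) k empty_part \<nu>"
  shows "card {X \<in> chain_set (\<lambda>_. False) k empty_part \<nu>. yam_chain k X} = 1"
proof -
  have "part \<nu>" using assms by (auto simp: chain_set_def chain_def)
  moreover have "\<nu> r = 0" if "r \<ge> k" for r
    using hchain_rows[OF assms le_refl that] assms by (simp add: chain_set_def)
  ultimately have "{X \<in> chain_set (\<lambda>_. False) k empty_part \<nu>. yam_chain k X} = {\<lambda>m r. if r < m then \<nu> r else 0}"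
    using yam_chain_exists[of \<nu> k] yam_chain_eq[of _ k \<nu>] by blast
  then show ?thesis by simp
qed

lemma chain_set_conjugate:
  assumes "X \<in> chain_set t L \<mu> \<theta>" shows "(\<lambda>i. conjugate (X i)) \<in> chain_set (\<lambda>i. \<not> t i) L (conjugate \<mu>) (conjugate \<theta>)"
  using assms by (auto simp: chain_set_def chain_def strip_def part_conjugate hstrip_conjugate vstrip_conjugate)

lemma chain_set_part: "X \<in> chain_set t L \<mu> \<theta> \<Longrightarrow> part (X i)"
  unfolding chain_set_def chain_def by (cases "i \<le> L") auto

lemma conjugate_empty [simp]: "conjugate empty_part = empty_part"
  by (auto simp: conjugate_def)

lemma chain_set_conjugate_bij:
  assumes "part \<theta>" "part \<mu>"
  shows "bij_betw (\<lambda>X i. conjugate (X i)) (chain_set t L \<mu> \<theta>) (chain_set (\<lambda>i. \<not> t i) L (conjugate \<mu>) (conjugate \<theta>))"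
proof (rule bij_betw_byWitness[where f' = "\<lambda>X i. conjugate (X i)"])
  show "\<forall>X\<in>chain_set t L \<mu> \<theta>. (\<lambda>i. conjugate (conjugate (X i))) = X"
    using chain_set_part by (auto simp: conjugate_conjugate fun_eq_iff)
  show "\<forall>X\<in>chain_set (\<lambda>i. \<not> t i) L (conjugate \<mu>) (conjugate \<theta>). (\<lambda>i. conjugate (conjugate (X i))) = X"
    using chain_set_part by (auto simp: conjugate_conjugate fun_eq_iff)
  show "(\<lambda>X i. conjugate (X i)) ` chain_set t L \<mu> \<theta> \<subseteq> chain_set (\<lambda>i. \<not> t i) L (conjugate \<mu>) (conjugate \<theta>)"
    using chain_set_conjugate by blast
  show "(\<lambda>X i. conjugate (X i)) ` chain_set (\<lambda>i. \<not> t i) L (conjugate \<mu>) (conjugate \<theta>) \<subseteq> chain_set t L \<mu> \<theta>"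
    using chain_set_conjugate[where t = "\<lambda>i. \<not> t i" and \<mu> = "conjugate \<mu>" and \<theta> = "conjugate \<theta>"] assms by (auto simp: conjugate_conjugate)
qed

lemma card_filter_bij:
  assumes "bij_betw f A B" "\<And>x. x \<in> A \<Longrightarrow> P x \<longleftrightarrow> Q (f x)"
  shows "card {x \<in> A. P x} = card {y \<in> B. Q y}"
proof -
  have "bij_betw f {x \<in> A. P x} {y \<in> B. Q y}"
    using assms unfolding bij_betw_def inj_on_def by auto
  then show ?thesis by (rule bij_betw_same_card)
qed

lemma has_weight_conjugate:
  assumes "\<And>i. i \<le> L \<Longrightarrow> part (X i)" shows "has_weight L (\<lambda>i. conjugate (X i)) c \<longleftrightarrow> has_weight L X c"
  using assms by (auto simp: has_weight_def psize_conjugate)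

lemma card_vchains:
  assumes "part \<mu>"
  shows "card {X \<in> chain_set (\<lambda>_. True) k empty_part \<mu>. has_weight k X c} = kostka k (conjugate \<mu>) c"
  unfolding kostka_def
  by (rule card_filter_bij[where f = "\<lambda>X i. conjugate (X i)"])
     (use chain_set_conjugate_bij[OF assms part_zero, of "\<lambda>_. True" k] chain_set_part in \<open>auto simp: has_weight_conjugate\<close>)

lemma card_vyam:
  assumes "part \<mu>" "X \<in> chain_set (\<lambda>_. True) k empty_part \<mu>"
  shows "card {X \<in> chain_set (\<lambda>_. True) k empty_part \<mu>. yam_chain k (\<lambda>p. conjugate (X p))} = 1"
proof -
  have "card {X \<in> chain_set (\<lambda>_. True) k empty_part \<mu>. yam_chain k (\<lambda>p. conjugate (X p))} =
        card {X \<in> chain_set (\<lambda>_. False) k empty_part (conjugate \<mu>). yam_chain k X}"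
    by (rule card_filter_bij[where f = "\<lambda>X i. conjugate (X i)"])
       (use chain_set_conjugate_bij[OF assms(1) part_zero, of "\<lambda>_. True" k] in auto)
  also have "\<dots> = 1" using card_yam_chain chain_set_conjugate[OF assms(2)] by simp
  finally show ?thesis .
qed

subsection \<open>Separating the two families of variables\<close>

text \<open>For a fixed right column \<open>y\<close>, the bottom rows of weight \<open>a\<close>
  are counted by a Kostka number that depends only on \<open>y 0\<close>. The same total arises when
  this number is attached to the single Yamanouchi bottom row and 0 to all the others.\<close>

lemma sum_bottom_kostka:
  fixes f :: "(nat \<Rightarrow> nat \<Rightarrow> nat) \<Rightarrow> nat"
  shows "(\<Sum>G\<in>growth_set k \<theta>. f (\<lambda>q. G k (min q k)) * of_bool (has_weight k (\<lambda>p. G (min p k) 0) a)) =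
         (\<Sum>G\<in>growth_set k \<theta>. f (\<lambda>q. G k (min q k)) * kostka k (conjugate (G k 0)) a *
            of_bool (yam_chain k (\<lambda>p. conjugate (G (min p k) 0))))"
proof -
  let ?Y = "{y. chain (\<lambda>_. False) k y \<and> (\<forall>i\<ge>k. y i = \<theta>)}"
  let ?X = "\<lambda>y. chain_set (\<lambda>_. True) k empty_part (y 0)"
  have reindex: "(\<Sum>G\<in>growth_set k \<theta>. g (\<lambda>q. G k (min q k)) (\<lambda>p. G (min p k) 0)) = (\<Sum>y\<in>?Y. \<Sum>x\<in>?X y. g y x)"
    for g :: "_ \<Rightarrow> _ \<Rightarrow> nat"
  proof -
    have "(\<Sum>G\<in>growth_set k \<theta>. g (\<lambda>q. G k (min q k)) (\<lambda>p. G (min p k) 0)) = (\<Sum>(y, x)\<in>Sigma ?Y ?X. g y x)"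
      using sum.reindex_bij_betw[OF growth_set_corner_bij[of k \<theta>], of "\<lambda>(y, x). g y x"] by simp
    also have "\<dots> = (\<Sum>y\<in>?Y. \<Sum>x\<in>?X y. g y x)"
      by (rule sum.Sigma[symmetric]) (auto intro: finite_chain_set finite_chains)
    finally show ?thesis .
  qed
  have "(\<Sum>G\<in>growth_set k \<theta>. f (\<lambda>q. G k (min q k)) * of_bool (has_weight k (\<lambda>p. G (min p k) 0) a)) =
        (\<Sum>y\<in>?Y. \<Sum>x\<in>?X y. f y * of_bool (has_weight k x a))"
    by (rule reindex)
  also have "\<dots> = (\<Sum>y\<in>?Y. \<Sum>x\<in>?X y. f y * kostka k (conjugate (y 0)) a * of_bool (yam_chain k (\<lambda>p. conjugate (x p))))"
  proof (rule sum.cong[OF HOL.refl])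
    fix y assume "y \<in> ?Y"
    then have p: "part (y 0)" by (auto simp: chain_def)
    have "(\<Sum>x\<in>?X y. f y * of_bool (has_weight k x a)) = f y * kostka k (conjugate (y 0)) a"
      using card_vchains[OF p, of k a]
      by (simp add: sum_distrib_left[symmetric] sum_of_bool_eq finite_chain_set Int_def)
    \<comment> \<open>The new factor is 1 as soon as there is a chain at all; if there is none, the
      Kostka number vanishes too.\<close>
    also have "\<dots> = f y * kostka k (conjugate (y 0)) a * card {x \<in> ?X y. yam_chain k (\<lambda>p. conjugate (x p))}"
    proof (cases "?X y = {}")
      case True
      then show ?thesis using card_vchains[OF p, of k a] by simp
    next
      case False
      then show ?thesis using card_vyam[OF p] by auto
    qed
    also have "\<dots> = (\<Sum>x\<in>?X y. f y * kostka k (conjugate (y 0)) a * of_bool (yam_chain k (\<lambda>p. conjugate (x p))))"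
      by (simp add: sum_distrib_left[symmetric] sum_of_bool_eq finite_chain_set Int_def)
    finally show "(\<Sum>x\<in>?X y. f y * of_bool (has_weight k x a)) = \<dots>" .
  qed
  also have "\<dots> = (\<Sum>G\<in>growth_set k \<theta>. f (\<lambda>q. G k (min q k)) * kostka k (conjugate (G k 0)) a *
            of_bool (yam_chain k (\<lambda>p. conjugate (G (min p k) 0))))"
    using reindex[of "\<lambda>y x. f y * kostka k (conjugate (y 0)) a * of_bool (yam_chain k (\<lambda>p. conjugate (x p)))"] by simp
  finally show ?thesis .
qed

lemma growth_set_conjugate:
  assumes "G \<in> growth_set k \<theta>" shows "(\<lambda>p q. conjugate (G q p)) \<in> growth_set k (conjugate \<theta>)"
proof -
  have "conjugate (G q p) = conjugate (G (min q k) (min p k))" for p q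
    using growth_set_min[OF assms, of q p] by (simp only:)
  then show ?thesis using assms growth_conjugate[of k k G] unfolding growth_set_def by auto
qed

lemma growth_set_part: "G \<in> growth_set k \<theta> \<Longrightarrow> part (G p q)"
proof -
  assume G: "G \<in> growth_set k \<theta>"
  then have "growth k k G" unfolding growth_set_def by blast
  then have "part (G (min p k) (min q k))" by (simp add: growth_def)
  then show ?thesis using growth_set_min[OF G, of p q] by (simp only:)
qed

lemma growth_set_conjugate_bij:
  assumes "part \<theta>" shows "bij_betw (\<lambda>G p q. conjugate (G q p)) (growth_set k \<theta>) (growth_set k (conjugate \<theta>))"
proof (rule bij_betw_byWitness[where f' = "\<lambda>G p q. conjugate (G q p)"])
  show "\<forall>G\<in>growth_set k \<theta>. (\<lambda>p q. conjugate (conjugate (G p q))) = G" using growth_set_part by (auto simp: conjugate_conjugate fun_eq_iff)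
  show "\<forall>G\<in>growth_set k (conjugate \<theta>). (\<lambda>p q. conjugate (conjugate (G p q))) = G" using growth_set_part by (auto simp: conjugate_conjugate fun_eq_iff)
  show "(\<lambda>G p q. conjugate (G q p)) ` growth_set k \<theta> \<subseteq> growth_set k (conjugate \<theta>)" using growth_set_conjugate by blast
  show "(\<lambda>G p q. conjugate (G q p)) ` growth_set k (conjugate \<theta>) \<subseteq> growth_set k \<theta>" using growth_set_conjugate[of _ k "conjugate \<theta>"] assms by (auto simp: conjugate_conjugate)
qed

text \<open>Reflecting the grid and conjugating all shapes gives a growth diagram again. This
  exchanges the left column with the bottom row and the top row with the right column, so
  \<open>sum_bottom_kostka\<close> applies.\<close>

lemma sum_left_kostka:
  fixes f :: "(nat \<Rightarrow> nat \<Rightarrow> nat) \<Rightarrow> nat"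
  assumes "part \<theta>"
  shows "(\<Sum>G\<in>growth_set k \<theta>. f (\<lambda>p. G (min p k) k) * of_bool (has_weight k (\<lambda>q. G 0 (min q k)) b)) =
         (\<Sum>G\<in>growth_set k \<theta>. f (\<lambda>p. G (min p k) k) * kostka k (G 0 k) b * of_bool (yam_chain k (\<lambda>q. G 0 (min q k))))"
proof -
  let ?f = "\<lambda>z. f (\<lambda>p. conjugate (z p))"
  have t: "\<And>p q. conjugate (conjugate (G p q)) = G p q" if "G \<in> growth_set k \<theta>" for G using growth_set_part[OF that] conjugate_conjugate by blast
  have "(\<Sum>G\<in>growth_set k \<theta>. f (\<lambda>p. G (min p k) k) * of_bool (has_weight k (\<lambda>q. G 0 (min q k)) b)) =
    (\<Sum>G\<in>growth_set k \<theta>. ?f (\<lambda>q. conjugate (G (min q k) k)) * of_bool (has_weight k (\<lambda>p. conjugate (G 0 (min p k))) b))"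
  proof (intro sum.cong HOL.refl)
    fix G assume G: "G \<in> growth_set k \<theta>"
    have "has_weight k (\<lambda>p. conjugate (G 0 (min p k))) b = has_weight k (\<lambda>q. G 0 (min q k)) b"
      by (rule has_weight_conjugate) (rule growth_set_part[OF G])
    then show "f (\<lambda>p. G (min p k) k) * of_bool (has_weight k (\<lambda>q. G 0 (min q k)) b) =
        ?f (\<lambda>q. conjugate (G (min q k) k)) * of_bool (has_weight k (\<lambda>p. conjugate (G 0 (min p k))) b)"
      by (simp add: t[OF G])
  qed
  also have "\<dots> = (\<Sum>G\<in>growth_set k (conjugate \<theta>). ?f (\<lambda>q. G k (min q k)) * of_bool (has_weight k (\<lambda>p. G (min p k) 0) b))"
    using sum.reindex_bij_betw[OF growth_set_conjugate_bij[OF assms, of k],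
        of "\<lambda>G. ?f (\<lambda>q. G k (min q k)) * of_bool (has_weight k (\<lambda>p. G (min p k) 0) b)"] by simp
  also have "\<dots> = (\<Sum>G\<in>growth_set k (conjugate \<theta>). ?f (\<lambda>q. G k (min q k)) * kostka k (conjugate (G k 0)) b *
            of_bool (yam_chain k (\<lambda>p. conjugate (G (min p k) 0))))"
    by (rule sum_bottom_kostka)
  also have "\<dots> = (\<Sum>G\<in>growth_set k \<theta>. ?f (\<lambda>q. conjugate (G (min q k) k)) * kostka k (conjugate (conjugate (G 0 k))) b *
            of_bool (yam_chain k (\<lambda>p. conjugate (conjugate (G 0 (min p k))))))"
    using sum.reindex_bij_betw[OF growth_set_conjugate_bij[OF assms, of k],
        of "\<lambda>G. ?f (\<lambda>q. G k (min q k)) * kostka k (conjugate (G k 0)) b *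
            of_bool (yam_chain k (\<lambda>p. conjugate (G (min p k) 0)))"] by simp
  also have "\<dots> = (\<Sum>G\<in>growth_set k \<theta>. f (\<lambda>p. G (min p k) k) * kostka k (G 0 k) b *
            of_bool (yam_chain k (\<lambda>q. G 0 (min q k))))"
  proof (intro sum.cong HOL.refl)
    fix G assume G: "G \<in> growth_set k \<theta>"
    show "?f (\<lambda>q. conjugate (G (min q k) k)) * kostka k (conjugate (conjugate (G 0 k))) b *
            of_bool (yam_chain k (\<lambda>p. conjugate (conjugate (G 0 (min p k))))) =
          f (\<lambda>p. G (min p k) k) * kostka k (G 0 k) b * of_bool (yam_chain k (\<lambda>q. G 0 (min q k)))"
      by (simp add: t[OF G])
  qed
  finally show ?thesis .
qed

lemma yam_chain_min: "yam_chain k (\<lambda>q. g (min q k)) \<longleftrightarrow> yam_chain k g"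
  by (auto simp: yam_chain_def min_def)

lemma has_weight_min: "has_weight k (\<lambda>q. g (min q k)) c \<longleftrightarrow> has_weight k g c"
  by (auto simp: has_weight_def min_def)

lemma step_sizes_min: "step_sizes k (\<lambda>q. g (min q k)) = step_sizes k g"
  by (auto simp: step_sizes_def min_def)

lemma growth_set_psize_col:
  assumes "G \<in> growth_set k \<theta>" "p \<le> k" "q < k"
  shows "psize (G p (Suc q)) + psize (G 0 q) = psize (G p q) + psize (G 0 (Suc q))"
  using assms growth_psize by (auto simp: growth_set_def)

lemma growth_set_psize_row:
  assumes G: "G \<in> growth_set k \<theta>" "q \<le> k" "p < k"
  shows "psize (G (Suc p) q) + psize (G p 0) = psize (G p q) + psize (G (Suc p) 0)"
  using growth_psize[OF growth_conjugate[of k k G], of q p] G growth_set_part[OF G(1)]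
  by (auto simp: growth_set_def psize_conjugate)

text \<open>Before a side of the grid is replaced, what must survive is moved to a side that the
  replacement keeps: the horizontal weight to the right column, later the Yamanouchi condition and
  the weight of the bottom row to the top row. The shapes at the corners are expressed by step
  sizes, which can be read off along other paths as well.\<close>

lemma growth_count:
  assumes "part \<theta>"
  shows "card {G \<in> growth_set k \<theta>. has_weight k (\<lambda>p. G p 0) a \<and> has_weight k (G 0) b} =
         (\<Sum>G\<in>{G \<in> growth_set k \<theta>. yam_chain k (\<lambda>p. conjugate (G p 0)) \<and> yam_chain k (G 0)}.
            kostka k (step_sizes k (\<lambda>p. G p 0)) a * kostka k (step_sizes k (G 0)) b)"
proof -
  have right: "has_weight k (G k) c \<longleftrightarrow> has_weight k (G 0) c" if "G \<in> growth_set k \<theta>" for G c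
  proof -
    have "psize (G k (Suc q)) = psize (G k q) + c q \<longleftrightarrow> psize (G 0 (Suc q)) = psize (G 0 q) + c q"
      if "q < k" for q
      using growth_set_psize_col[OF \<open>G \<in> growth_set k \<theta>\<close> le_refl that] by linarith
    then show ?thesis by (simp add: has_weight_def)
  qed
  have top_wt: "step_sizes k (\<lambda>p. G p k) = step_sizes k (\<lambda>p. G p 0)" if "G \<in> growth_set k \<theta>" for G
  proof
    fix r
    show "step_sizes k (\<lambda>p. G p k) r = step_sizes k (\<lambda>p. G p 0) r"
      using growth_set_psize_row[OF that, of k r] by (auto simp: step_sizes_def)
  qed
  have top_yam: "yam_chain k (\<lambda>p. conjugate (G p k)) \<longleftrightarrow> yam_chain k (\<lambda>p. conjugate (G p 0))" if "G \<in> growth_set k \<theta>" for G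
    using growth_ucond_column[OF growth_conjugate[of k k G], of k] that by (auto simp: yam_chain_def growth_set_def)
  have bot: "conjugate (G k 0) = step_sizes k (\<lambda>p. G p 0)" if "G \<in> growth_set k \<theta>" "yam_chain k (\<lambda>p. conjugate (G p 0))" for G
  proof -
    have "(\<lambda>p. conjugate (G (min p k) 0)) \<in> chain_set (\<lambda>_. False) k empty_part (conjugate (G k 0))"
      using that(1) by (auto simp: growth_set_def chain_set_def chain_def growth_def strip_def hstrip_conjugate part_conjugate min_def)
    from yam_chain_step_sizes[OF this] have "step_sizes k (\<lambda>p. conjugate (G p 0)) = conjugate (G k 0)"
      using that(2) yam_chain_min[of k "\<lambda>p. conjugate (G p 0)"] step_sizes_min[of k "\<lambda>p. conjugate (G p 0)"] by simp
    moreover have "step_sizes k (\<lambda>p. conjugate (G p 0)) = step_sizes k (\<lambda>p. G p 0)"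
      by (rule ext) (simp add: step_sizes_def psize_conjugate[OF growth_set_part[OF that(1)]])
    ultimately show ?thesis by simp
  qed
  have left: "G 0 k = step_sizes k (G 0)" if "G \<in> growth_set k \<theta>" "yam_chain k (G 0)" for G
  proof -
    have "(\<lambda>q. G 0 (min q k)) \<in> chain_set (\<lambda>_. False) k empty_part (G 0 k)"
      using that(1) by (auto simp: growth_set_def chain_set_def chain_def growth_def strip_def min_def)
    from yam_chain_step_sizes[OF this] show ?thesis
      using that(2) yam_chain_min[of k "G 0"] step_sizes_min[of k "G 0"] by simp
  qed
  \<comment> \<open>\<open>f\<close> is all that the top row has to remember of the first
    replacement; the Kostka number is recovered from its step sizes.\<close>
  define f where "f z = of_bool (yam_chain k (\<lambda>p. conjugate (z p))) * kostka k (step_sizes k z) a" for z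
  have "card {G \<in> growth_set k \<theta>. has_weight k (\<lambda>p. G p 0) a \<and> has_weight k (G 0) b} =
        (\<Sum>G\<in>growth_set k \<theta>. of_bool (has_weight k (\<lambda>p. G p 0) a \<and> has_weight k (G 0) b))"
    by (simp add: sum_of_bool_eq finite_growth_set Int_def)
  also have "\<dots> = (\<Sum>G\<in>growth_set k \<theta>. of_bool (has_weight k (\<lambda>q. G k (min q k)) b) *
        of_bool (has_weight k (\<lambda>p. G (min p k) 0) a))"
  proof (intro sum.cong HOL.refl)
    fix G assume G: "G \<in> growth_set k \<theta>"
    show "(of_bool (has_weight k (\<lambda>p. G p 0) a \<and> has_weight k (G 0) b) :: nat) =
      of_bool (has_weight k (\<lambda>q. G k (min q k)) b) * of_bool (has_weight k (\<lambda>p. G (min p k) 0) a)"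
      using right[OF G] has_weight_min[of k "G k" b] has_weight_min[of k "\<lambda>p. G p 0" a] by auto
  qed
  also have "\<dots> = (\<Sum>G\<in>growth_set k \<theta>. of_bool (has_weight k (\<lambda>q. G k (min q k)) b) * kostka k (conjugate (G k 0)) a *
            of_bool (yam_chain k (\<lambda>p. conjugate (G (min p k) 0))))"
    by (rule sum_bottom_kostka)
  also have "\<dots> = (\<Sum>G\<in>growth_set k \<theta>. f (\<lambda>p. G (min p k) k) * of_bool (has_weight k (\<lambda>q. G 0 (min q k)) b))"
  proof (intro sum.cong HOL.refl)
    fix G assume G: "G \<in> growth_set k \<theta>"
    show "of_bool (has_weight k (\<lambda>q. G k (min q k)) b) * kostka k (conjugate (G k 0)) a *
            of_bool (yam_chain k (\<lambda>p. conjugate (G (min p k) 0))) =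
          f (\<lambda>p. G (min p k) k) * of_bool (has_weight k (\<lambda>q. G 0 (min q k)) b)"
      using right[OF G] top_yam[OF G] top_wt[OF G] bot[OF G]
        yam_chain_min[of k "\<lambda>p. conjugate (G p 0)"] yam_chain_min[of k "\<lambda>p. conjugate (G p k)"] step_sizes_min[of k "\<lambda>p. G p k"]
      by (simp add: f_def has_weight_min)
  qed
  also have "\<dots> = (\<Sum>G\<in>growth_set k \<theta>. f (\<lambda>p. G (min p k) k) * kostka k (G 0 k) b *
            of_bool (yam_chain k (\<lambda>q. G 0 (min q k))))"
    by (rule sum_left_kostka[OF assms])
  also have "\<dots> = (\<Sum>G\<in>growth_set k \<theta>. if yam_chain k (\<lambda>p. conjugate (G p 0)) \<and> yam_chain k (G 0)
      then kostka k (step_sizes k (\<lambda>p. G p 0)) a * kostka k (step_sizes k (G 0)) b else 0)"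
  proof (intro sum.cong HOL.refl)
    fix G assume G: "G \<in> growth_set k \<theta>"
    show "f (\<lambda>p. G (min p k) k) * kostka k (G 0 k) b * of_bool (yam_chain k (\<lambda>q. G 0 (min q k))) =
      (if yam_chain k (\<lambda>p. conjugate (G p 0)) \<and> yam_chain k (G 0)
      then kostka k (step_sizes k (\<lambda>p. G p 0)) a * kostka k (step_sizes k (G 0)) b else 0)"
      using top_yam[OF G] top_wt[OF G] left[OF G] yam_chain_min[of k "G 0"]
        yam_chain_min[of k "\<lambda>p. conjugate (G p k)"] step_sizes_min[of k "\<lambda>p. G p k"]
      by (simp add: f_def)
  qed
  also have "\<dots> = (\<Sum>G\<in>{G \<in> growth_set k \<theta>. yam_chain k (\<lambda>p. conjugate (G p 0)) \<and> yam_chain k (G 0)}.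
            kostka k (step_sizes k (\<lambda>p. G p 0)) a * kostka k (step_sizes k (G 0)) b)"
    by (rule sum.inter_filter[symmetric, OF finite_growth_set])
  finally show ?thesis .
qed

section \<open>Transfer to the staircase path\<close>

lemma pos_stair:
  "vpos even (2 * i) = i" "hpos even (2 * i) = i" "vpos even (Suc (2 * i)) = Suc i" "hpos even (Suc (2 * i)) = i"
proof -
  have "vpos even (2 * i) = i \<and> hpos even (2 * i) = i" by (induction i) auto
  then show "vpos even (2 * i) = i" "hpos even (2 * i) = i" "vpos even (Suc (2 * i)) = Suc i" "hpos even (Suc (2 * i)) = i"
    by auto
qed

text \<open>On the staircase path, step \<open>2 i\<close> adds the letters \<open>(i + 1)'\<close> and step \<open>2 i + 1\<close> the letters \<open>i + 1\<close>.\<close>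

definition stair_yam :: "nat \<Rightarrow> (nat \<Rightarrow> nat \<Rightarrow> nat) \<Rightarrow> bool" where
  "stair_yam k X \<longleftrightarrow> (\<forall>i. Suc i < k \<longrightarrow>
     ucond (X (2 * i + 1)) (X (2 * i + 2)) (X (2 * i + 3)) (X (2 * i + 4)) \<and>
     ucond (conjugate (X (2 * i))) (conjugate (X (2 * i + 1))) (conjugate (X (2 * i + 2))) (conjugate (X (2 * i + 3))))"

definition stair_weight :: "nat \<Rightarrow> (nat \<Rightarrow> nat \<Rightarrow> nat) \<Rightarrow> (nat \<Rightarrow> nat) \<Rightarrow> (nat \<Rightarrow> nat) \<Rightarrow> bool" where
  "stair_weight k X a b \<longleftrightarrow> (\<forall>i<k. psize (X (2 * i + 1)) = psize (X (2 * i)) + a i \<and>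
     psize (X (2 * i + 2)) = psize (X (2 * i + 1)) + b i)"

definition stair_a :: "nat \<Rightarrow> (nat \<Rightarrow> nat \<Rightarrow> nat) \<Rightarrow> nat \<Rightarrow> nat" where
  "stair_a k X r = (if r < k then psize (X (2 * r + 1)) - psize (X (2 * r)) else 0)"

definition stair_b :: "nat \<Rightarrow> (nat \<Rightarrow> nat \<Rightarrow> nat) \<Rightarrow> nat \<Rightarrow> nat" where
  "stair_b k X r = (if r < k then psize (X (2 * r + 2)) - psize (X (2 * r + 1)) else 0)"

lemma growth_set_stair_bij:
  "bij_betw (\<lambda>G i. G (vpos even (min i (2 * k))) (hpos even (min i (2 * k)))) (growth_set k \<theta>)
     (chain_set even (2 * k) empty_part \<theta>)" (is "bij_betw ?h _ _")
  unfolding bij_betw_def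
proof (intro conjI)
  show "inj_on ?h (growth_set k \<theta>)"
  proof (rule inj_onI)
    fix G G' assume G: "G \<in> growth_set k \<theta>" "G' \<in> growth_set k \<theta>" "?h G = ?h G'"
    show "G = G'"
    proof (rule growth_set_unique[OF G(1,2), of even])
      fix i assume "i \<le> 2 * k"
      then show "G (vpos even i) (hpos even i) = G' (vpos even i) (hpos even i)"
        using fun_cong[OF G(3), of i] by (simp add: min_absorb1)
    qed (auto simp: pos_stair)
  qed
  show "?h ` growth_set k \<theta> = chain_set even (2 * k) empty_part \<theta>"
  proof (intro equalityI subsetI)
    fix X assume "X \<in> ?h ` growth_set k \<theta>"
    then obtain G where G: "G \<in> growth_set k \<theta>" "X = ?h G" by blast
    have g: "growth (vpos even (2 * k)) (hpos even (2 * k)) G" and G0: "G 0 0 = empty_part" "G k k = \<theta>"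
      using G(1) by (auto simp: growth_set_def pos_stair)
    show "X \<in> chain_set even (2 * k) empty_part \<theta>"
      using growth_chain[OF g] G0 by (auto simp: chain_set_def chain_def G(2) pos_stair min_def le_Suc_eq)
  next
    fix X assume "X \<in> chain_set even (2 * k) empty_part \<theta>"
    then have X: "chain even (2 * k) X" "X 0 = empty_part" "\<And>i. i \<ge> 2 * k \<Longrightarrow> X i = \<theta>"
      by (auto simp: chain_set_def)
    obtain G where G: "G \<in> growth_set k \<theta>" "\<And>i. i \<le> 2 * k \<Longrightarrow> G (vpos even i) (hpos even i) = X i"
      using growth_set_exists[OF X(1) _ _ X(2) X(3)[OF order_refl]] by (auto simp: pos_stair)
    have "?h G i = X i" for i
      using G(2)[of "min i (2 * k)"] X(3)[of i] X(3)[of "2 * k"] by (cases "i \<le> 2 * k") (auto simp: min_def)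
    then have "?h G = X" by blast
    then show "X \<in> ?h ` growth_set k \<theta>" using G(1) by blast
  qed
qed

text \<open>The steps \<open>2 * i\<close> and \<open>2 * i + 1\<close> of the staircase are
  parallel to the boundary steps with index \<open>i\<close>, so the weights and Yamanouchi
  conditions on the boundary are equivalent to those on the staircase.\<close>

lemma stair_count:
  assumes "part \<theta>"
  shows "card {X \<in> chain_set even (2 * k) empty_part \<theta>. stair_weight k X a b} =
    (\<Sum>X\<in>{X \<in> chain_set even (2 * k) empty_part \<theta>. stair_yam k X}.
       kostka k (stair_a k X) a * kostka k (stair_b k X) b)"
proof -
  define h where "h = (\<lambda>(G :: nat \<Rightarrow> nat \<Rightarrow> nat \<Rightarrow> nat) i. G (vpos even (min i (2 * k))) (hpos even (min i (2 * k))))"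
  have bij: "bij_betw h (growth_set k \<theta>) (chain_set even (2 * k) empty_part \<theta>)"
    unfolding h_def by (rule growth_set_stair_bij)
  have h: "h G (2 * i) = G i i" if "i \<le> k" for G i
    using that by (simp add: h_def min_def pos_stair)
  have h': "h G (Suc (2 * i)) = G (Suc i) i" if "i < k" for G i
    using that by (simp add: h_def min_def pos_stair)
  have hs: "h G (2 * i) = G i i" "h G (2 * i + 1) = G (Suc i) i" "h G (2 * i + 2) = G (Suc i) (Suc i)"
    if "i < k" for G i
    using h[of i G] h'[of i G] h[of "Suc i" G] that by auto
  have hs2: "h G (2 * i + 3) = G (Suc (Suc i)) (Suc i)" "h G (2 * i + 4) = G (Suc (Suc i)) (Suc (Suc i))"
    if "Suc i < k" for G i
    using h'[of "Suc i" G] h[of "Suc (Suc i)" G] that by (auto simp: numeral_eq_Suc)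
  have wt: "stair_weight k (h G) a b \<longleftrightarrow> has_weight k (\<lambda>p. G p 0) a \<and> has_weight k (G 0) b" if G: "G \<in> growth_set k \<theta>" for G
  proof -
    have "psize (h G (2 * i + 1)) = psize (h G (2 * i)) + a i \<longleftrightarrow> psize (G (Suc i) 0) = psize (G i 0) + a i"
      "psize (h G (2 * i + 2)) = psize (h G (2 * i + 1)) + b i \<longleftrightarrow> psize (G 0 (Suc i)) = psize (G 0 i) + b i"
      if "i < k" for i
      unfolding hs[OF that] using growth_set_psize_row[OF G, of i i] growth_set_psize_col[OF G, of "Suc i" i] that by auto
    then show ?thesis unfolding stair_weight_def has_weight_def by blast
  qed
  have yam: "stair_yam k (h G) \<longleftrightarrow> yam_chain k (\<lambda>p. conjugate (G p 0)) \<and> yam_chain k (G 0)" if G: "G \<in> growth_set k \<theta>" for G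
  proof -
    have g: "growth k k G" using G unfolding growth_set_def by blast
    have "ucond (h G (2 * i + 1)) (h G (2 * i + 2)) (h G (2 * i + 3)) (h G (2 * i + 4)) \<longleftrightarrow>
      ucond (G 0 i) (G 0 (Suc i)) (G 0 (Suc i)) (G 0 (Suc (Suc i)))" if "Suc i < k" for i
      using growth_ucond_stair[OF g, of "Suc i" i] that hs(2,3)[of i G] hs2[OF that, of G] by simp
    moreover have "ucond (conjugate (h G (2 * i))) (conjugate (h G (2 * i + 1))) (conjugate (h G (2 * i + 2))) (conjugate (h G (2 * i + 3))) \<longleftrightarrow>
      ucond (conjugate (G i 0)) (conjugate (G (Suc i) 0)) (conjugate (G (Suc i) 0)) (conjugate (G (Suc (Suc i)) 0))" if "Suc i < k" for i
      using growth_ucond_stair[OF growth_conjugate[OF g], of i i] that hs[of i G] hs2[OF that, of G] by simp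
    ultimately show ?thesis unfolding stair_yam_def yam_chain_def by blast
  qed
  have sa: "stair_a k (h G) = step_sizes k (\<lambda>p. G p 0)" if G: "G \<in> growth_set k \<theta>" for G
  proof
    fix r show "stair_a k (h G) r = step_sizes k (\<lambda>p. G p 0) r"
      using growth_set_psize_row[OF G, of r r] hs(1,2)[of r G] by (auto simp: stair_a_def step_sizes_def)
  qed
  have sb: "stair_b k (h G) = step_sizes k (G 0)" if G: "G \<in> growth_set k \<theta>" for G
  proof
    fix r show "stair_b k (h G) r = step_sizes k (G 0) r"
      using growth_set_psize_col[OF G, of "Suc r" r] hs(2,3)[of r G] by (auto simp: stair_b_def step_sizes_def)
  qed
  have "card {X \<in> chain_set even (2 * k) empty_part \<theta>. stair_weight k X a b} =
        card {G \<in> growth_set k \<theta>. has_weight k (\<lambda>p. G p 0) a \<and> has_weight k (G 0) b}"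
    by (rule card_filter_bij[OF bij, symmetric]) (simp add: wt)
  also have "\<dots> = (\<Sum>G\<in>{G \<in> growth_set k \<theta>. yam_chain k (\<lambda>p. conjugate (G p 0)) \<and> yam_chain k (G 0)}.
            kostka k (step_sizes k (\<lambda>p. G p 0)) a * kostka k (step_sizes k (G 0)) b)"
    by (rule growth_count[OF assms])
  also have "\<dots> = (\<Sum>G\<in>{G \<in> growth_set k \<theta>. stair_yam k (h G)}.
            kostka k (stair_a k (h G)) a * kostka k (stair_b k (h G)) b)"
    by (rule sum.cong) (auto simp: sa sb yam)
  also have "\<dots> = (\<Sum>X\<in>{X \<in> chain_set even (2 * k) empty_part \<theta>. stair_yam k X}.
       kostka k (stair_a k X) a * kostka k (stair_b k X) b)"
  proof (rule sum.reindex_bij_betw)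
    show "bij_betw h {G \<in> growth_set k \<theta>. stair_yam k (h G)} {X \<in> chain_set even (2 * k) empty_part \<theta>. stair_yam k X}"
      using bij unfolding bij_betw_def inj_on_def by auto
  qed
  finally show ?thesis .
qed

subsection \<open>Tableaux as chains of partitions\<close>

definition shape :: "'a list list \<Rightarrow> nat \<Rightarrow> nat" where
  "shape R r = (if r < length R then length (R ! r) else 0)"

text \<open>For sorted rows this is the subshape formed by the entries at most \<open>m\<close>.
  Counting entries row by row gives it a meaning for every list of rows, in particular for
  \<open>plus_tab S\<close>.\<close>

definition chain_of :: "nat list list \<Rightarrow> nat \<Rightarrow> nat \<Rightarrow> nat" where
  "chain_of R m r = (if r < length R then length (filter (\<lambda>x. x \<le> m) (R ! r)) else 0)"

text \<open>The letter \<open>m + 1\<close> occupies a vertical strip if \<open>t m\<close>, and a horizontal strip otherwise.\<close>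

definition tab :: "(nat \<Rightarrow> bool) \<Rightarrow> nat \<Rightarrow> nat list list \<Rightarrow> bool" where
  "tab t M R \<longleftrightarrow> young R \<and> (\<forall>x\<in>set (concat R). 1 \<le> x \<and> x \<le> M) \<and>
     (\<forall>row\<in>set R. sorted_wrt (\<lambda>x y. x \<le> y \<and> (x = y \<longrightarrow> \<not> t (x - 1))) row) \<and>
     (\<forall>col\<in>set (transpose R). sorted_wrt (\<lambda>x y. x \<le> y \<and> (x = y \<longrightarrow> t (x - 1))) col)"

lemma young_sorted: "young R \<Longrightarrow> sorted (rev (map length R))"
  by (simp add: young_def sorted_wrt_rev)

lemma young_shape_mono: "young R \<Longrightarrow> r \<le> s \<Longrightarrow> shape R s \<le> shape R r"
  unfolding young_def shape_def sorted_wrt_iff_nth_less by (cases "r = s") auto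

lemma young_row: "young R \<Longrightarrow> r < length R \<Longrightarrow> 0 < length (R ! r)"
  by (auto simp: young_def)

lemma part_shape: "young R \<Longrightarrow> part (shape R)"
proof -
  assume "young R"
  then have "antimono (shape R)" unfolding antimono_def using young_shape_mono by blast
  then show ?thesis by (auto simp: part_def shape_def intro!: exI[of _ "length R"])
qed

lemma conjugate_shape_le: "young R \<Longrightarrow> conjugate (shape R) c \<le> length R"
  by (rule nat_leI) (auto simp: conjugate_less_iff part_shape shape_def split: if_splits)

text \<open>Replaces the recursive \<open>transpose\<close> by cell coordinates: in a Young shape,
  column \<open>c\<close> has \<open>conjugate (shape R) c\<close> cells.\<close>

lemma transpose_young:
  assumes "young R"
  shows "transpose R = map (\<lambda>c. map (\<lambda>r. R ! r ! c) [0..<conjugate (shape R) c]) [0..<shape R 0]"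
proof (rule nth_equalityI)
  have len: "length (transpose R) = shape R 0"
    using length_transpose_sorted[OF young_sorted[OF assms]] by (auto simp: shape_def)
  then show "length (transpose R) =
      length (map (\<lambda>c. map (\<lambda>r. R ! r ! c) [0..<conjugate (shape R) c]) [0..<shape R 0])" by simp
  fix c assume c: "c < length (transpose R)"
  have "filter (\<lambda>ys. c < length ys) R = take (conjugate (shape R) c) R"
  proof -
    have "filter (\<lambda>ys. c < length ys) R = takeWhile (\<lambda>ys. c < length ys) R"
      by (rule filter_equals_takeWhile_sorted_rev[OF young_sorted[OF assms]])
    also have "\<dots> = take (conjugate (shape R) c) R"
    proof (rule takeWhile_eq_take_P_nth)
      fix i assume "i < conjugate (shape R) c"
      then show "c < length (R ! i)" by (auto simp: conjugate_less_iff part_shape assms shape_def split: if_splits)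
    next
      assume "conjugate (shape R) c < length R"
      moreover have "\<not> c < shape R (conjugate (shape R) c)"
        using conjugate_less_iff[OF part_shape[OF assms], of "conjugate (shape R) c" c] by simp
      ultimately show "\<not> c < length (R ! conjugate (shape R) c)" by (simp add: shape_def)
    qed
    finally show ?thesis .
  qed
  then have "transpose R ! c = map (\<lambda>ys. ys ! c) (take (conjugate (shape R) c) R)"
    using nth_transpose[OF c] by simp
  also have "\<dots> = map (\<lambda>r. R ! r ! c) [0..<conjugate (shape R) c]"
    using conjugate_shape_le[OF assms, of c] by (intro nth_equalityI) auto
  finally show "transpose R ! c =
      map (\<lambda>c. map (\<lambda>r. R ! r ! c) [0..<conjugate (shape R) c]) [0..<shape R 0] ! c"
    using c len by simp
qed

lemma col_sorted_iff:
  assumes "young R"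
  shows "(\<forall>col\<in>set (transpose R). sorted_wrt P col) \<longleftrightarrow>
         (\<forall>r s c. r < s \<longrightarrow> s < length R \<longrightarrow> c < length (R ! s) \<longrightarrow> P (R ! r ! c) (R ! s ! c))"
proof -
  have "(\<forall>col\<in>set (transpose R). sorted_wrt P col) \<longleftrightarrow>
        (\<forall>c<shape R 0. \<forall>r s. r < s \<longrightarrow> s < conjugate (shape R) c \<longrightarrow> P (R ! r ! c) (R ! s ! c))"
    unfolding transpose_young[OF assms] by (auto simp: sorted_wrt_iff_nth_less)
  also have "\<dots> \<longleftrightarrow> (\<forall>r s c. r < s \<longrightarrow> c < shape R s \<longrightarrow> P (R ! r ! c) (R ! s ! c))"
  proof -
    have "c < shape R 0" if "c < shape R s" for c s
      using that young_shape_mono[OF assms, of 0 s] by simp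
    then show ?thesis by (auto simp: conjugate_less_iff part_shape assms)
  qed
  also have "\<dots> \<longleftrightarrow> (\<forall>r s c. r < s \<longrightarrow> s < length R \<longrightarrow> c < length (R ! s) \<longrightarrow> P (R ! r ! c) (R ! s ! c))"
    by (auto simp: shape_def)
  finally show ?thesis .
qed

lemma row_sorted_iff:
  "(\<forall>row\<in>set R. sorted_wrt P row) \<longleftrightarrow>
   (\<forall>r<length R. \<forall>c d. c < d \<longrightarrow> d < length (R ! r) \<longrightarrow> P (R ! r ! c) (R ! r ! d))"
  unfolding all_set_conv_all_nth sorted_wrt_iff_nth_less by blast

lemma sorted_filter_le:
  fixes xs :: "nat list"
  assumes "sorted xs" shows "c < length (filter (\<lambda>x. x \<le> m) xs) \<longleftrightarrow> c < length xs \<and> xs ! c \<le> m"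
  using assms
proof (induction xs arbitrary: c)
  case (Cons x xs)
  show ?case
  proof (cases "x \<le> m")
    case True
    then show ?thesis using Cons by (cases c) auto
  next
    case False
    then have "filter (\<lambda>x. x \<le> m) (x # xs) = []" using Cons.prems by (auto simp: filter_empty_conv)
    moreover have "m < (x # xs) ! c" if "c < length (x # xs)"
      using False Cons.prems that nth_mem[of c "x # xs"] by fastforce
    ultimately show ?thesis by (auto simp: not_le)
  qed
qed simp

lemma tab_rows_sorted: "tab t M R \<Longrightarrow> row \<in> set R \<Longrightarrow> sorted row"
  unfolding tab_def by (auto intro: sorted_wrt_mono_rel[rotated])

lemma tab_cols_sorted: "tab t M R \<Longrightarrow> col \<in> set (transpose R) \<Longrightarrow> sorted col"
  unfolding tab_def by (auto intro: sorted_wrt_mono_rel[rotated])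

lemma chain_of_less:
  assumes "tab t M R"
  shows "c < chain_of R m r \<longleftrightarrow> c < shape R r \<and> R ! r ! c \<le> m"
  using sorted_filter_le tab_rows_sorted[OF assms] by (auto simp: chain_of_def shape_def)

lemma tab_row:
  assumes "tab t M R" "c < d" "d < shape R r"
  shows "R ! r ! c \<le> R ! r ! d" "R ! r ! c = R ! r ! d \<Longrightarrow> \<not> t (R ! r ! c - 1)"
proof -
  have r: "r < length R" "d < length (R ! r)" using assms(3) by (auto simp: shape_def split: if_splits)
  then have "sorted_wrt (\<lambda>x y. x \<le> y \<and> (x = y \<longrightarrow> \<not> t (x - 1))) (R ! r)"
    using assms(1) nth_mem unfolding tab_def by blast
  from sorted_wrt_nth_less[OF this assms(2) r(2)]
  show "R ! r ! c \<le> R ! r ! d" "R ! r ! c = R ! r ! d \<Longrightarrow> \<not> t (R ! r ! c - 1)" by auto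
qed

lemma tab_col:
  assumes "tab t M R" "r < s" "c < shape R s"
  shows "R ! r ! c \<le> R ! s ! c" "R ! r ! c = R ! s ! c \<Longrightarrow> t (R ! r ! c - 1)"
proof -
  have s: "s < length R" "c < length (R ! s)" using assms(3) by (auto simp: shape_def split: if_splits)
  have "young R" "\<forall>col\<in>set (transpose R). sorted_wrt (\<lambda>x y. x \<le> y \<and> (x = y \<longrightarrow> t (x - 1))) col"
    using assms(1) by (auto simp: tab_def)
  then have "R ! r ! c \<le> R ! s ! c \<and> (R ! r ! c = R ! s ! c \<longrightarrow> t (R ! r ! c - 1))"
    unfolding col_sorted_iff[OF \<open>young R\<close>] using assms(2) s by blast
  then show "R ! r ! c \<le> R ! s ! c" "R ! r ! c = R ! s ! c \<Longrightarrow> t (R ! r ! c - 1)" by auto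
qed

lemma tab_entry:
  assumes "tab t M R" "c < shape R r" shows "1 \<le> R ! r ! c \<and> R ! r ! c \<le> M"
proof -
  have "r < length R" "c < length (R ! r)" using assms(2) by (auto simp: shape_def split: if_splits)
  then have "R ! r ! c \<in> set (concat R)" unfolding set_concat by (meson UN_I nth_mem)
  then show ?thesis using assms(1) unfolding tab_def by blast
qed

text \<open>A step can fail to be a vertical strip only through two entries \<open>m + 1\<close> in
  one row, and to be a horizontal strip only through two in one column; \<open>t m\<close> decides
  which of the two is excluded.\<close>

lemma chain_of_in_chain_set:
  assumes R: "tab t M R" shows "chain_of R \<in> chain_set t M empty_part (shape R)"
proof -
  have y: "young R" using R by (simp add: tab_def)
  note less = chain_of_less[OF R]
  have mono: "shape R (Suc r) \<le> shape R r" for r by (rule young_shape_mono[OF y]) simp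
  have "part (chain_of R m)" for m
  proof -
    have "chain_of R m (Suc r) \<le> chain_of R m r" for r
      by (rule nat_leI) (use tab_col(1)[OF R, of r "Suc r"] mono[of r] in \<open>force simp: less\<close>)
    then show ?thesis
      by (auto simp: part_def antimono_iff_le_Suc chain_of_def intro!: exI[of _ "length R"])
  qed
  moreover have "strip (t m) (chain_of R m) (chain_of R (Suc m))" for m
  proof -
    have le: "chain_of R m r \<le> chain_of R (Suc m) r" for r by (rule nat_leI) (auto simp: less)
    show ?thesis
    proof (cases "t m")
      case True
      have "chain_of R (Suc m) r \<le> Suc (chain_of R m r)" for r
      proof (rule nat_leI)
        fix c assume c: "c < chain_of R (Suc m) r"
        show "c < Suc (chain_of R m r)"
        proof (cases c)
          case (Suc d)
          then have d: "d < shape R r" "R ! r ! d \<le> R ! r ! c" "R ! r ! c \<le> Suc m"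
            using c tab_row(1)[OF R, of d c r] by (auto simp: less)
          moreover have "R ! r ! d \<noteq> Suc m"
          proof
            assume eq: "R ! r ! d = Suc m"
            then have "R ! r ! d = R ! r ! c" using d by simp
            then have "\<not> t (R ! r ! d - 1)" using tab_row(2)[OF R, of d c r] c Suc by (auto simp: less)
            then show False using True eq by (metis diff_Suc_1)
          qed
          ultimately have "R ! r ! d \<le> m" by simp
          then show ?thesis using Suc less d(1) by simp
        qed simp
      qed
      then show ?thesis using le True by (simp add: strip_def vstrip_def)
    next
      case False
      have "chain_of R (Suc m) (Suc r) \<le> chain_of R m r" for r
      proof (rule nat_leI)
        fix c assume c: "c < chain_of R (Suc m) (Suc r)"
        then have d: "c < shape R (Suc r)" "c < shape R r" "R ! r ! c \<le> R ! Suc r ! c" "R ! Suc r ! c \<le> Suc m"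
          using tab_col(1)[OF R, of r "Suc r" c] mono[of r] by (auto simp: less)
        moreover have "R ! r ! c \<noteq> Suc m"
        proof
          assume eq: "R ! r ! c = Suc m"
          then have "R ! r ! c = R ! Suc r ! c" using d by simp
          then have "t (R ! r ! c - 1)" using tab_col(2)[OF R _ d(1), of r] by simp
          then show False using False eq by (metis diff_Suc_1)
        qed
        ultimately show "c < chain_of R m r" using less by simp
      qed
      then show ?thesis using le False by (simp add: strip_def hstrip_def)
    qed
  qed
  moreover have "chain_of R 0 = empty_part"
    by (rule ext, rule nat_eqI) (use tab_entry[OF R] in \<open>force simp: less\<close>)
  moreover have "chain_of R i = shape R" if "i \<ge> M" for i
    by (rule ext, rule nat_eqI) (use tab_entry[OF R] that in \<open>force simp: less\<close>)
  ultimately show ?thesis by (auto simp: chain_set_def chain_def)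
qed

lemma chain_of_inj:
  assumes "tab t M R" "tab t M R'" "chain_of R = chain_of R'" shows "R = R'"
proof -
  have sh: "shape R = shape R'"
    using chain_of_in_chain_set[OF assms(1)] chain_of_in_chain_set[OF assms(2)] assms(3) by (auto simp: chain_set_def)
  have y: "young R" "young R'" using assms by (auto simp: tab_def)
  have pos: "r < length S \<longleftrightarrow> 0 < shape S r" if "young S" for S :: "nat list list" and r
    using young_row[OF that] by (auto simp: shape_def)
  have len: "length R = length R'"
    by (rule nat_eqI) (use pos[OF y(1)] pos[OF y(2)] sh in simp)
  show ?thesis
  proof (rule nth_equalityI[OF len])
    fix r assume r: "r < length R"
    show "R ! r = R' ! r"
    proof (rule nth_equalityI)
      show "length (R ! r) = length (R' ! r)" using fun_cong[OF sh, of r] r len by (simp add: shape_def)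
      fix c assume c: "c < length (R ! r)"
      have "c < shape R r" "c < shape R' r" using c r sh[symmetric] by (auto simp: shape_def)
      then have "R ! r ! c \<le> m \<longleftrightarrow> R' ! r ! c \<le> m" for m
        using chain_of_less[OF assms(1), of c m r] chain_of_less[OF assms(2), of c m r] assms(3) by metis
      then show "R ! r ! c = R' ! r ! c" by (meson antisym order_refl)
    qed
  qed
qed

lemma chain_of_surj:
  assumes X: "X \<in> chain_set t M empty_part \<theta>" shows "\<exists>R. tab t M R \<and> shape R = \<theta> \<and> chain_of R = X"
proof -
  have c: "chain t M X" and X0: "X 0 = empty_part" and XM: "\<And>i. i \<ge> M \<Longrightarrow> X i = \<theta>"
    using X by (auto simp: chain_set_def)
  have p: "part \<theta>" using chain_set_part[OF X, of M] XM by simp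
  have mono: "X i r \<le> X j r" if "i \<le> j" for i j r
    using chain_le[OF c, of i j] chain_le[OF c, of i M] XM that by (metis le_cases le_trans)
  \<comment> \<open>The entry of a cell is the step at which the cell appears in the chain.\<close>
  define e where "e r c = (LEAST m. c < X m r)" for r c
  have e: "e r c \<le> m \<longleftrightarrow> c < X m r" if "c < \<theta> r" for r c m
  proof
    have "c < X M r" using that XM by simp
    then have "c < X (e r c) r" unfolding e_def by (rule LeastI)
    then show "e r c \<le> m \<Longrightarrow> c < X m r" using mono less_le_trans by blast
  qed (simp add: e_def Least_le)
  have e1: "1 \<le> e r c \<and> e r c \<le> M" if "c < \<theta> r" for r c
    using e[OF that, of 0] e[OF that, of M] that XM X0 by simp
  \<comment> \<open>\<open>conjugate \<theta> 0\<close> is the number of nonempty rows.\<close>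
  define R where "R = map (\<lambda>r. map (e r) [0..<\<theta> r]) [0..<conjugate \<theta> 0]"
  have lR: "r < length R \<longleftrightarrow> 0 < \<theta> r" for r using conjugate_less_iff[OF p] by (simp add: R_def)
  have row: "R ! r = map (e r) [0..<\<theta> r]" if "r < length R" for r using that by (simp add: R_def)
  have sh: "shape R = \<theta>"
    by (rule ext) (use row lR in \<open>auto simp: shape_def\<close>)
  have y: "young R"
    unfolding young_def
  proof
    show "\<forall>row\<in>set R. row \<noteq> []" using lR row by (auto simp: in_set_conv_nth)
    show "sorted_wrt (\<ge>) (map length R)"
      unfolding sorted_wrt_iff_nth_less
    proof (intro allI impI)
      fix i j assume "i < j" "j < length (map length R)"
      then show "map length R ! j \<le> map length R ! i" using row[of i] row[of j] partD[OF p, of i j] by simp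
    qed
  qed
  have rows: "e r c \<le> e r d \<and> (e r c = e r d \<longrightarrow> \<not> t (e r c - 1))" if cd: "c < d" "d < \<theta> r" for r c d
  proof
    have "d < X (e r d) r" using e[OF cd(2)] by blast
    then show "e r c \<le> e r d" using e[of c r "e r d"] cd by simp
    show "e r c = e r d \<longrightarrow> \<not> t (e r c - 1)"
    proof (intro impI notI)
      assume eq: "e r c = e r d" and v: "t (e r c - 1)"
      obtain m where m: "e r d = Suc m" using e1[OF cd(2)] by (cases "e r d") auto
      then have "m < M" using e1[OF cd(2)] by simp
      then have "X (Suc m) r \<le> Suc (X m r)" using c v m eq by (auto simp: chain_def strip_def vstrip_def)
      moreover have "d < X (Suc m) r" using e[OF cd(2), of "Suc m"] m by simp
      ultimately have "e r c \<le> m" using e[of c r m] cd by simp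
      then show False using m eq by simp
    qed
  qed
  have cols: "e r c \<le> e s c \<and> (e r c = e s c \<longrightarrow> t (e r c - 1))" if cd: "r < s" "c < \<theta> s" for r s c
  proof
    have cr: "c < \<theta> r" using cd partD[OF p, of r s] by simp
    have "c < X (e s c) s" using e[OF cd(2)] by blast
    also have "X (e s c) s \<le> X (e s c) r" using partD[OF chain_set_part[OF X], of r s] cd by simp
    finally show "e r c \<le> e s c" using e[OF cr] by simp
    show "e r c = e s c \<longrightarrow> t (e r c - 1)"
    proof (rule impI, rule ccontr)
      assume eq: "e r c = e s c" and v: "\<not> t (e r c - 1)"
      obtain m where m: "e s c = Suc m" using e1[OF cd(2)] by (cases "e s c") auto
      then have "m < M" using e1[OF cd(2)] by simp
      then have h: "X (Suc m) (Suc r) \<le> X m r" using c v m eq by (auto simp: chain_def strip_def hstrip_def)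
      have "c < X (Suc m) s" using e[OF cd(2), of "Suc m"] m by simp
      also have "X (Suc m) s \<le> X (Suc m) (Suc r)" using partD[OF chain_set_part[OF X], of "Suc r" s] cd by simp
      finally have "c < X m r" using h by simp
      then show False using e[OF cr, of m] m eq by simp
    qed
  qed
  have "\<forall>row\<in>set R. sorted_wrt (\<lambda>x y. x \<le> y \<and> (x = y \<longrightarrow> \<not> t (x - 1))) row"
    unfolding row_sorted_iff using rows row by force
  moreover have "\<forall>col\<in>set (transpose R). sorted_wrt (\<lambda>x y. x \<le> y \<and> (x = y \<longrightarrow> t (x - 1))) col"
    unfolding col_sorted_iff[OF y]
  proof (intro allI impI)
    fix r s c assume a: "r < s" "s < length R" "c < length (R ! s)"
    have "\<theta> s \<le> \<theta> r" using partD[OF p] a by simp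
    then show "R ! r ! c \<le> R ! s ! c \<and> (R ! r ! c = R ! s ! c \<longrightarrow> t (R ! r ! c - 1))"
      using cols[of r s c] row[of r] row[of s] a by auto
  qed
  moreover have "1 \<le> x \<and> x \<le> M" if x: "x \<in> set (concat R)" for x
  proof -
    obtain r c where "0 < \<theta> r" "c < \<theta> r" "x = e r c"
      using x row lR by (auto simp: in_set_conv_nth)
    then show ?thesis using e1 by auto
  qed
  ultimately have "tab t M R" using y unfolding tab_def by blast
  moreover have "chain_of R m r = X m r" for m r
  proof (rule nat_eqI)
    fix d
    have "d < X m r \<Longrightarrow> d < \<theta> r" using mono[of m "max m M" r] XM[of "max m M"] by simp
    then show "d < chain_of R m r \<longleftrightarrow> d < X m r"
      using chain_of_less[OF \<open>tab t M R\<close>, of d m r] e[of d r m] row[of r] lR[of r] sh by auto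
  qed
  ultimately show ?thesis using sh by blast
qed

lemma chain_of_bij: "bij_betw chain_of {R. tab t M R \<and> shape R = \<theta>} (chain_set t M empty_part \<theta>)"
  unfolding bij_betw_def inj_on_def using chain_of_inj chain_of_in_chain_set chain_of_surj by blast

lemma length_filter_Suc: "length (filter (\<lambda>x. x \<le> Suc m) xs) = length (filter (\<lambda>x. x \<le> m) xs) + count_list xs (Suc m)"
  by (induction xs) (auto simp: le_Suc_eq)

lemma chain_of_Suc:
  "chain_of R (Suc m) r = chain_of R m r + (if r < length R then count_list (R ! r) (Suc m) else 0)"
  by (simp add: chain_of_def length_filter_Suc)

lemma sum_rows: "(\<Sum>r<length R. f (R ! r)) = sum_list (map f R)"
  by (simp add: sum_list_sum_nth atLeast0LessThan)

lemma psize_chain_of: "psize (chain_of R m) = length (filter (\<lambda>x. x \<le> m) (concat R))"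
proof -
  have "psize (chain_of R m) = psum (chain_of R m) (length R)"
    by (rule psize_psum) (simp add: chain_of_def)
  also have "\<dots> = (\<Sum>r<length R. length (filter (\<lambda>x. x \<le> m) (R ! r)))"
    by (intro sum.cong) (auto simp: chain_of_def)
  also have "\<dots> = length (filter (\<lambda>x. x \<le> m) (concat R))"
    using sum_rows[of "\<lambda>row. length (filter (\<lambda>x. x \<le> m) row)" R]
    by (simp add: length_concat filter_concat comp_def)
  finally show ?thesis .
qed

lemma psize_chain_of_Suc: "psize (chain_of R (Suc m)) = psize (chain_of R m) + count_list (concat R) (Suc m)"
  by (simp add: psize_chain_of length_filter_Suc)

lemma psize_shape: "psize (shape R) = length (concat R)"
proof -
  have "psize (shape R) = psum (shape R) (length R)" by (rule psize_psum) (simp add: shape_def)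
  also have "\<dots> = (\<Sum>r<length R. length (R ! r))" by (intro sum.cong) (auto simp: shape_def)
  finally show ?thesis by (simp add: sum_rows length_concat)
qed

lemma chain_of_transpose:
  assumes R: "tab t M R" shows "chain_of (transpose R) m = conjugate (chain_of R m)"
proof
  fix c
  have y: "young R" using R by (simp add: tab_def)
  note p = chain_set_part[OF chain_of_in_chain_set[OF R]]
  show "chain_of (transpose R) m c = conjugate (chain_of R m) c"
  proof (cases "c < shape R 0")
    case True
    let ?col = "map (\<lambda>r. R ! r ! c) [0..<conjugate (shape R) c]"
    have col: "transpose R ! c = ?col" "c < length (transpose R)"
      using transpose_young[OF y] True by auto
    then have s: "sorted ?col" using tab_cols_sorted[OF R, of ?col] by (metis nth_mem)
    have "chain_of (transpose R) m c = length (filter (\<lambda>x. x \<le> m) ?col)"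
      using col by (simp add: chain_of_def)
    also have "\<dots> = conjugate (chain_of R m) c"
    proof (rule nat_eqI)
      fix r
      have "r < length (filter (\<lambda>x. x \<le> m) ?col) \<longleftrightarrow> r < conjugate (shape R) c \<and> R ! r ! c \<le> m"
        unfolding sorted_filter_le[OF s] by auto
      then show "r < length (filter (\<lambda>x. x \<le> m) ?col) \<longleftrightarrow> r < conjugate (chain_of R m) c"
        unfolding conjugate_less_iff[OF p] chain_of_less[OF R] conjugate_less_iff[OF part_shape[OF y]] .
    qed
    finally show ?thesis .
  next
    case False
    have "\<not> r < conjugate (chain_of R m) c" for r
      using False young_shape_mono[OF y, of 0 r] by (auto simp: conjugate_less_iff p chain_of_less[OF R])
    then have "conjugate (chain_of R m) c = 0" by blast
    then show ?thesis using False transpose_young[OF y] by (simp add: chain_of_def)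
  qed
qed

subsection \<open>Reverse Yamanouchi reading words\<close>

lemma reverse_yamanouchi_iff:
  "reverse_yamanouchi w \<longleftrightarrow>
     (\<forall>u v i. w = u @ v \<longrightarrow> 1 \<le> i \<longrightarrow> count_list v (i + 1) \<le> count_list v i)"
proof
  assume "reverse_yamanouchi w"
  then show "\<forall>u v i. w = u @ v \<longrightarrow> 1 \<le> i \<longrightarrow> count_list v (i + 1) \<le> count_list v i"
    unfolding reverse_yamanouchi_def
    by (metis append_eq_conv_conj le_add1 length_append)
next
  assume "\<forall>u v i. w = u @ v \<longrightarrow> 1 \<le> i \<longrightarrow> count_list v (i + 1) \<le> count_list v i"
  then show "reverse_yamanouchi w"
    unfolding reverse_yamanouchi_def by (metis append_take_drop_id)
qed

lemma count_list_concat: "count_list (concat xss) x = sum_list (map (\<lambda>xs. count_list xs x) xss)"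
  by (induction xss) auto

text \<open>For the letters \<open>i\<close> and \<open>i + 1\<close> the critical final segments
  start inside a sorted row just before its first entry above \<open>i\<close>: they contain every
  \<open>i + 1\<close> of that row and no \<open>i\<close> of it. The other segments are no worse,
  which leaves one inequality per row.\<close>

lemma reverse_yamanouchi_rows:
  assumes "\<And>row. row \<in> set Y \<Longrightarrow> sorted row"
  shows "reverse_yamanouchi (concat (rev Y)) \<longleftrightarrow>
    (\<forall>i\<ge>1. \<forall>r<length Y. (\<Sum>s<Suc r. count_list (Y ! s) (i + 1)) \<le> (\<Sum>s<r. count_list (Y ! s) i))"
  using assms
proof (induction Y rule: rev_induct)
  case Nil
  then show ?case by (simp add: reverse_yamanouchi_iff)
next
  case (snoc y Y)
  let ?W = "concat (rev Y)"
  have W: "count_list ?W x = (\<Sum>s<length Y. count_list (Y ! s) x)" for x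
    by (simp add: count_list_concat sum_rows[of "\<lambda>xs. count_list xs x"] rev_map[symmetric])
  have nth: "(\<Sum>s<r. count_list ((Y @ [y]) ! s) x) = (\<Sum>s<r. count_list (Y ! s) x)" if "r \<le> length Y" for r x
    using that by (intro sum.cong) (auto simp: nth_append)
  have "reverse_yamanouchi (y @ ?W) \<longleftrightarrow> reverse_yamanouchi ?W \<and>
      (\<forall>i\<ge>1. count_list y (i + 1) + count_list ?W (i + 1) \<le> count_list ?W i)"
  proof
    assume a: "reverse_yamanouchi (y @ ?W)"
    have "reverse_yamanouchi ?W"
      using a unfolding reverse_yamanouchi_iff by (metis append_assoc)
    moreover have "count_list y (i + 1) + count_list ?W (i + 1) \<le> count_list ?W i" if "i \<ge> 1" for i
    proof -
      \<comment> \<open>\<open>?z @ ?W\<close> is the critical segment for \<open>i\<close> that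
        starts in the new bottom row, whose entries come first in the word.\<close>
      let ?z = "dropWhile (\<lambda>x. x \<le> i) y"
      have s: "sorted y" using snoc.prems by simp
      have y: "y = takeWhile (\<lambda>x. x \<le> i) y @ ?z" by simp
      have gt: "\<forall>x\<in>set ?z. i < x"
      proof
        fix x assume x: "x \<in> set ?z"
        have "sorted ?z" using s by (rule sorted_dropWhile)
        moreover have "i < hd ?z"
        proof -
          have "?z \<noteq> []" using x by (metis empty_iff list.set(1))
          then have "\<not> hd ?z \<le> i" by (rule hd_dropWhile)
          then show ?thesis by simp
        qed
        ultimately show "i < x" using x by (cases ?z) auto
      qed
      have "count_list ?z i = 0" using gt by (auto simp: count_list_0_iff)
      moreover have "count_list (takeWhile (\<lambda>x. x \<le> i) y) (i + 1) = 0"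
        by (auto simp: count_list_0_iff dest: set_takeWhileD)
      then have "count_list ?z (i + 1) = count_list y (i + 1)"
        using y by (metis add_0 count_list_append)
      moreover have "count_list (?z @ ?W) (i + 1) \<le> count_list (?z @ ?W) i"
        using a that unfolding reverse_yamanouchi_iff
        by (metis append_assoc takeWhile_dropWhile_id)
      ultimately show ?thesis by simp
    qed
    ultimately show "reverse_yamanouchi ?W \<and>
      (\<forall>i\<ge>1. count_list y (i + 1) + count_list ?W (i + 1) \<le> count_list ?W i)" by blast
  next
    assume a: "reverse_yamanouchi ?W \<and>
      (\<forall>i\<ge>1. count_list y (i + 1) + count_list ?W (i + 1) \<le> count_list ?W i)"
    show "reverse_yamanouchi (y @ ?W)"
      unfolding reverse_yamanouchi_iff
    proof (intro allI impI)
      fix u v i assume uv: "y @ ?W = u @ v" and i: "1 \<le> (i::nat)"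
      then consider z where "y @ z = u" "?W = z @ v" | z where "y = u @ z" "z @ ?W = v"
        by (auto simp: append_eq_append_conv2)
      then show "count_list v (i + 1) \<le> count_list v i"
      proof cases
        case 1
        then show ?thesis using a i unfolding reverse_yamanouchi_iff by blast
      next
        case 2
        have "count_list z (i + 1) \<le> count_list y (i + 1)" using 2 by simp
        moreover have "count_list y (i + 1) + count_list ?W (i + 1) \<le> count_list ?W i" using a i by blast
        ultimately show ?thesis using 2(2)[symmetric] by simp
      qed
    qed
  qed
  also have "\<dots> \<longleftrightarrow> (\<forall>i\<ge>1. \<forall>r<length (Y @ [y]).
      (\<Sum>s<Suc r. count_list ((Y @ [y]) ! s) (i + 1)) \<le> (\<Sum>s<r. count_list ((Y @ [y]) ! s) i))"
  proof -
    have "(\<Sum>s<Suc (length Y). count_list ((Y @ [y]) ! s) x) = count_list y x + count_list ?W x" for x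
      using nth[of "length Y" x] by (simp add: W)
    moreover have "(\<Sum>s<length Y. count_list ((Y @ [y]) ! s) x) = count_list ?W x" for x
      using nth[of "length Y" x] by (simp add: W)
    moreover have "(\<forall>r<length (Y @ [y]). P r) \<longleftrightarrow> (\<forall>r<length Y. P r) \<and> P (length Y)" for P
      by (auto simp: less_Suc_eq)
    moreover have "reverse_yamanouchi ?W \<longleftrightarrow> (\<forall>i\<ge>1. \<forall>r<length Y.
      (\<Sum>s<Suc r. count_list ((Y @ [y]) ! s) (i + 1)) \<le> (\<Sum>s<r. count_list ((Y @ [y]) ! s) i))"
      using snoc.IH snoc.prems nth by (simp del: sum.lessThan_Suc)
    ultimately show ?thesis by (simp del: sum.lessThan_Suc) blast
  qed
  finally show ?case by simp
qed

lemma count_list_half: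
  fixes xs :: "nat list"
  shows "count_list (map (\<lambda>x. x div 2) (filter even xs)) i = count_list xs (2 * i)"
  by (induction xs) auto

text \<open>The letter \<open>i + 1\<close> is encoded as \<open>2 * i + 2\<close>, so its strip
  leads from index \<open>2 * i + 1\<close> to \<open>2 * i + 2\<close> of the chain, and the strip
  of the next letter from \<open>2 * i + 3\<close> to \<open>2 * i + 4\<close>.\<close>

lemma yamanouchi_ucond:
  assumes "\<And>row. row \<in> set Y \<Longrightarrow> sorted row"
  shows "reverse_yamanouchi (map (\<lambda>x. x div 2) (filter even (concat (rev Y)))) \<longleftrightarrow>
    (\<forall>i. ucond (chain_of Y (2 * i + 1)) (chain_of Y (2 * i + 2)) (chain_of Y (2 * i + 3)) (chain_of Y (2 * i + 4)))"
proof -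
  define Z where "Z = map (\<lambda>row. map (\<lambda>x. x div 2) (filter even row)) Y"
  define cnt where "cnt x s = (if s < length Y then count_list (Y ! s) x else 0)" for x s
  have w: "map (\<lambda>x. x div 2) (filter even (concat (rev Y))) = concat (rev Z)"
    by (simp add: Z_def map_concat filter_concat rev_map comp_def)
  have srt: "sorted row" if row: "row \<in> set Z" for row
  proof -
    obtain y where y: "y \<in> set Y" "row = map (\<lambda>x. x div 2) (filter even y)" using row by (auto simp: Z_def)
    have "sorted (filter even y)" using assms[OF y(1)] by (rule sorted_wrt_filter)
    then show ?thesis unfolding y(2) sorted_map by (rule sorted_wrt_mono_rel[rotated]) (simp add: div_le_mono)
  qed
  have Zs: "(\<Sum>s<r. count_list (Z ! s) i) = psum (cnt (2 * i)) r" if "r \<le> length Y" for r i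
    using that by (intro sum.cong) (auto simp: Z_def cnt_def count_list_half)
  have "reverse_yamanouchi (concat (rev Z)) \<longleftrightarrow>
    (\<forall>i\<ge>1. \<forall>r<length Y. psum (cnt (2 * (i + 1))) (Suc r) \<le> psum (cnt (2 * i)) r)"
  proof -
    have "length Z = length Y" by (simp add: Z_def)
    moreover have "reverse_yamanouchi (concat (rev Z)) \<longleftrightarrow>
      (\<forall>i\<ge>1. \<forall>r<length Z. (\<Sum>s<Suc r. count_list (Z ! s) (i + 1)) \<le> (\<Sum>s<r. count_list (Z ! s) i))"
      by (rule reverse_yamanouchi_rows) (rule srt)
    ultimately show ?thesis using Zs by (simp del: sum.lessThan_Suc)
  qed
  also have "\<dots> \<longleftrightarrow> (\<forall>i. \<forall>r<length Y. psum (cnt (2 * i + 4)) (Suc r) \<le> psum (cnt (2 * i + 2)) r)"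
  proof -
    have "(\<forall>i\<ge>1. P i) \<longleftrightarrow> (\<forall>i. P (Suc i))" for P by (metis One_nat_def Suc_le_D le_add1 plus_1_eq_Suc)
    then show ?thesis by (simp add: numeral_eq_Suc del: sum.lessThan_Suc)
  qed
  \<comment> \<open>Beyond the last row the left side no longer grows and the right side does not
    shrink, so the inequality in the last row implies all later ones.\<close>
  also have "\<dots> \<longleftrightarrow> (\<forall>i r. psum (cnt (2 * i + 4)) (Suc r) \<le> psum (cnt (2 * i + 2)) r)"
  proof (intro iffI allI)
    fix i r
    assume a: "\<forall>i. \<forall>r<length Y. psum (cnt (2 * i + 4)) (Suc r) \<le> psum (cnt (2 * i + 2)) r"
    show "psum (cnt (2 * i + 4)) (Suc r) \<le> psum (cnt (2 * i + 2)) r"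
    proof (cases "r < length Y")
      case False
      have eq: "psum (cnt x) m = psum (cnt x) (length Y)" if "length Y \<le> m" for x m
        by (rule sum.mono_neutral_right) (use that in \<open>auto simp: cnt_def\<close>)
      show ?thesis
      proof (cases "length Y")
        case 0
        then show ?thesis by (simp add: cnt_def)
      next
        case (Suc l)
        have "psum (cnt (2 * i + 4)) (Suc r) = psum (cnt (2 * i + 4)) (Suc l)" using eq[of "Suc r"] False Suc by simp
        also have "\<dots> \<le> psum (cnt (2 * i + 2)) l" using a Suc by (simp only: lessI)
        also have "\<dots> \<le> psum (cnt (2 * i + 2)) r" by (rule sum_mono2) (use False Suc in auto)
        finally show ?thesis .
      qed
    qed (use a in blast)
  qed blast
  also have "\<dots> \<longleftrightarrow> (\<forall>i. ucond (chain_of Y (2 * i + 1)) (chain_of Y (2 * i + 2))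
      (chain_of Y (2 * i + 3)) (chain_of Y (2 * i + 4)))"
  proof -
    have c: "psum (chain_of Y (Suc m)) r = psum (chain_of Y m) r + psum (cnt (Suc m)) r" for m r
      by (simp add: sum.distrib[symmetric] chain_of_Suc cnt_def)
    have "psum (cnt (2 * i + 4)) (Suc r) \<le> psum (cnt (2 * i + 2)) r \<longleftrightarrow>
      psum (chain_of Y (2 * i + 4)) (Suc r) + psum (chain_of Y (2 * i + 1)) r \<le>
      psum (chain_of Y (2 * i + 3)) (Suc r) + psum (chain_of Y (2 * i + 2)) r" for i r
      using c[of "2 * i + 3" "Suc r"] c[of "2 * i + 1" r] by (simp add: numeral_eq_Suc)
    then show ?thesis unfolding ucond_def by blast
  qed
  finally show ?thesis unfolding w .
qed

lemma sorted_count_iff: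
  fixes xs :: "nat list"
  shows "sorted_wrt (\<lambda>x y. x \<le> y \<and> (x = y \<longrightarrow> \<not> P x)) xs \<longleftrightarrow> sorted xs \<and> (\<forall>x. P x \<longrightarrow> count_list xs x \<le> 1)"
proof (induction xs)
  case (Cons a xs)
  have "(\<forall>x. P x \<longrightarrow> count_list (a # xs) x \<le> 1) \<longleftrightarrow>
      (P a \<longrightarrow> a \<notin> set xs) \<and> (\<forall>x. P x \<longrightarrow> count_list xs x \<le> 1)" (is "?l \<longleftrightarrow> ?r")
  proof
    assume l: ?l
    have "P a \<longrightarrow> a \<notin> set xs" using l[rule_format, of a] by (simp add: count_list_0_iff)
    moreover have "count_list xs x \<le> 1" if "P x" for x
      using l[rule_format, OF that] by (simp split: if_splits)
    ultimately show ?r by blast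
  next
    assume r: ?r
    show ?l
    proof (intro allI impI)
      fix x assume "P x"
      then show "count_list (a # xs) x \<le> 1" using r by (cases "a = x") simp_all
    qed
  qed
  moreover have "sorted_wrt (\<lambda>x y. x \<le> y \<and> (x = y \<longrightarrow> \<not> P x)) (a # xs) \<longleftrightarrow>
    (\<forall>y\<in>set xs. a \<le> y) \<and> (P a \<longrightarrow> a \<notin> set xs) \<and> sorted_wrt (\<lambda>x y. x \<le> y \<and> (x = y \<longrightarrow> \<not> P x)) xs"
    unfolding sorted_wrt.simps by blast
  ultimately show ?case unfolding Cons.IH sorted_simps by blast
qed simp

lemma count_le_cong:
  assumes "\<And>x. x \<in> set xs \<Longrightarrow> P x \<longleftrightarrow> Q x"
  shows "(\<forall>x. P x \<longrightarrow> count_list xs x \<le> 1) \<longleftrightarrow> (\<forall>x. Q x \<longrightarrow> count_list xs x \<le> (1::nat))"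
  using assms by (metis count_list_0_iff zero_le)

lemma set_transpose_young:
  assumes "young R" shows "set (concat (transpose R)) = set (concat R)"
proof (intro equalityI subsetI)
  fix x assume "x \<in> set (concat (transpose R))"
  then obtain c r where "r < conjugate (shape R) c" "x = R ! r ! c"
    by (auto simp: transpose_young[OF assms])
  then have "r < length R" "c < length (R ! r)"
    by (auto simp: conjugate_less_iff part_shape assms shape_def split: if_splits)
  then show "x \<in> set (concat R)" using \<open>x = R ! r ! c\<close> unfolding set_concat by (meson UN_I nth_mem)
next
  fix x assume "x \<in> set (concat R)"
  then obtain r c where rc: "r < length R" "c < length (R ! r)" "x = R ! r ! c"
    by (auto simp: in_set_conv_nth)
  then have "c < shape R r" by (simp add: shape_def)
  then have "c < shape R 0" "r < conjugate (shape R) c"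
    using young_shape_mono[OF assms, of 0 r] by (auto simp: conjugate_less_iff part_shape assms)
  then show "x \<in> set (concat (transpose R))"
    using rc(3) by (auto simp: transpose_young[OF assms] intro!: bexI[of _ c])
qed

lemma shape_transpose:
  assumes "young R" shows "shape (transpose R) = conjugate (shape R)"
proof
  fix c
  have "\<not> r < conjugate (shape R) c" if "\<not> c < shape R 0" for r
    using that young_shape_mono[OF assms, of 0 r] by (auto simp: conjugate_less_iff part_shape assms)
  then have "conjugate (shape R) c = 0" if "\<not> c < shape R 0" using that by blast
  then show "shape (transpose R) c = conjugate (shape R) c"
    unfolding shape_def[of "transpose R"] by (auto simp: transpose_young[OF assms])
qed

lemma primed_tab:
  "primed_tableau S \<and> (\<forall>x\<in>set (concat S). x \<le> M) \<longleftrightarrow> tab even M S"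
proof (cases "young S \<and> (\<forall>x\<in>set (concat S). 1 \<le> x)")
  case True
  have R: "(\<forall>row\<in>set S. sorted_wrt (\<lambda>x y. x \<le> y \<and> (x = y \<longrightarrow> \<not> even (x - 1))) row) \<longleftrightarrow>
    (\<forall>row\<in>set S. sorted row \<and> (\<forall>x. odd x \<longrightarrow> count_list row x \<le> 1))"
  proof (rule ball_cong[OF HOL.refl])
    fix row assume "row \<in> set S"
    \<comment> \<open>Positivity of the entries matters here: on natural numbers
      \<open>0 - 1\<close> is 0, which is even, although 0 is not odd.\<close>
    then have "\<And>x. x \<in> set row \<Longrightarrow> even (x - 1) \<longleftrightarrow> odd x" using True by fastforce
    then show "sorted_wrt (\<lambda>x y. x \<le> y \<and> (x = y \<longrightarrow> \<not> even (x - 1))) row \<longleftrightarrow>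
      sorted row \<and> (\<forall>x. odd x \<longrightarrow> count_list row x \<le> 1)"
      unfolding sorted_count_iff[where P = "\<lambda>x. even (x - 1)"]
      using count_le_cong[of row "\<lambda>x. even (x - 1)" odd] by blast
  qed
  have C: "(\<forall>col\<in>set (transpose S). sorted_wrt (\<lambda>x y. x \<le> y \<and> (x = y \<longrightarrow> even (x - 1))) col) \<longleftrightarrow>
    (\<forall>col\<in>set (transpose S). sorted col \<and> (\<forall>x. even x \<longrightarrow> count_list col x \<le> 1))"
  proof (rule ball_cong[OF HOL.refl])
    fix col assume "col \<in> set (transpose S)"
    then have "\<And>x. x \<in> set col \<Longrightarrow> x \<in> set (concat S)" using set_transpose_young[of S] True by (metis UN_I set_concat)
    then have "\<And>x. x \<in> set col \<Longrightarrow> \<not> even (x - 1) \<longleftrightarrow> even x" using True by fastforce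
    then show "sorted_wrt (\<lambda>x y. x \<le> y \<and> (x = y \<longrightarrow> even (x - 1))) col \<longleftrightarrow>
      sorted col \<and> (\<forall>x. even x \<longrightarrow> count_list col x \<le> 1)"
      using sorted_count_iff[where P = "\<lambda>x. \<not> even (x - 1)", of col]
        count_le_cong[of col "\<lambda>x. \<not> even (x - 1)" even] by simp
  qed
  show ?thesis unfolding primed_tableau_def tab_def R C ball_conj_distrib by argo
next
  case False
  then show ?thesis unfolding primed_tableau_def tab_def by blast
qed

section \<open>Schur coefficients and the index set of the expansion\<close>

lemma ssyt_tab: "ssyt R \<and> (\<forall>x\<in>set (concat R). x \<le> k) \<longleftrightarrow> tab (\<lambda>_. False) k R"
proof -
  have "(\<lambda>x y :: nat. x \<le> y \<and> (x = y \<longrightarrow> False)) = (<)" "(\<lambda>x y :: nat. x \<le> y \<and> (x = y \<longrightarrow> \<not> False)) = (\<le>)"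
    by (auto simp: fun_eq_iff)
  then show ?thesis unfolding ssyt_def tab_def by auto
qed

lemma has_shape_iff: "has_shape R lam \<longleftrightarrow> shape R = (\<lambda>r. lam (Suc r))"
  unfolding has_shape_def shape_def fun_eq_iff by (auto simp: not_less)

text \<open>The partition \<open>lam\<close> and the content \<open>a\<close> are indexed from 1,
  their counterparts for chains from 0. The vanishing of \<open>a\<close> outside
  \<open>1..k\<close> confines the letters, so the tableaux become chains with \<open>k\<close>
  steps.\<close>

lemma schur_coeff_kostka:
  assumes "\<And>r. lam (Suc r) = \<nu> r" "\<And>m. m = 0 \<or> m > k \<Longrightarrow> a m = 0"
  shows "schur_coeff lam a = kostka k \<nu> (\<lambda>i. a (Suc i))"
proof -
  have \<nu>: "\<nu> = (\<lambda>r. lam (Suc r))" using assms(1) by auto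
  have cnt: "count_list xs m = 0" if "\<forall>x\<in>set xs. 1 \<le> x \<and> x \<le> k" "m = 0 \<or> m > k" for xs m
    using that by (auto simp: count_list_0_iff)
  have "{R. ssyt R \<and> has_shape R lam \<and> (\<forall>m. count_list (concat R) m = a m)} =
    {R \<in> {R. tab (\<lambda>_. False) k R \<and> shape R = \<nu>}. \<forall>m. count_list (concat R) m = a m}"
  proof -
    have "x \<le> k" if "\<forall>m. count_list (concat R) m = a m" "x \<in> set (concat R)" for R x
      using that assms(2)[of x] by (metis count_list_0_iff not_le)
    then show ?thesis using ssyt_tab[of _ k] unfolding has_shape_iff \<nu> by blast
  qed
  then have "schur_coeff lam a =
    card {R \<in> {R. tab (\<lambda>_. False) k R \<and> shape R = \<nu>}. \<forall>m. count_list (concat R) m = a m}"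
    by (simp only: schur_coeff_def)
  also have "\<dots> = card {X \<in> chain_set (\<lambda>_. False) k empty_part \<nu>. has_weight k X (\<lambda>i. a (Suc i))}"
  proof (rule card_filter_bij[OF chain_of_bij])
    fix R assume "R \<in> {R. tab (\<lambda>_. False) k R \<and> shape R = \<nu>}"
    then have "\<forall>x\<in>set (concat R). 1 \<le> x \<and> x \<le> k" unfolding tab_def by blast
    note c = cnt[OF this]
    show "(\<forall>m. count_list (concat R) m = a m) \<longleftrightarrow> has_weight k (chain_of R) (\<lambda>i. a (Suc i))"
    proof
      assume h: "has_weight k (chain_of R) (\<lambda>i. a (Suc i))"
      show "\<forall>m. count_list (concat R) m = a m"
      proof
        fix m
        show "count_list (concat R) m = a m"
        proof (cases "m = 0 \<or> m > k")
          case False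
          then obtain i where "m = Suc i" "i < k" by (cases m) auto
          then show ?thesis using h by (auto simp: has_weight_def psize_chain_of_Suc)
        qed (use c assms(2) in simp)
      qed
    qed (auto simp: has_weight_def psize_chain_of_Suc)
  qed
  finally show ?thesis by (simp only: kostka_def)
qed

text \<open>Along with \<open>i\<close> all smaller positive letters occur as well, so the word has
  at least \<open>i\<close> letters.\<close>

lemma reverse_yamanouchi_letter_bound:
  assumes w: "reverse_yamanouchi w" and i: "i \<in> set w" shows "i \<le> length w"
proof -
  have "j \<in> set w" if "1 \<le> j" "j \<le> i" for j
    using that(2,1)
  proof (induction j rule: inc_induct)
    case base
    then show ?case using i by simp
  next
    case (step n)
    then have "count_list w (n + 1) \<noteq> 0" by (simp add: count_list_0_iff)
    moreover have "count_list w (n + 1) \<le> count_list w n"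
      using w step.prems unfolding reverse_yamanouchi_iff by (metis append_Nil)
    ultimately show ?case by (metis count_list_0_iff le_zero_eq)
  qed
  then have "card {1..i} \<le> card (set w)" by (intro card_mono) auto
  then show ?thesis using card_length[of w] by simp
qed

lemma ucond_trivial: "(\<And>r. \<alpha> r \<le> \<beta> r) \<Longrightarrow> ucond \<alpha> \<beta> \<gamma> \<gamma>"
  unfolding ucond_def by (simp add: sum_mono)

text \<open>\<open>HT\<close> itself does not bound the entries, but its two Yamanouchi conditions
  do: an unprimed letter occurs in the first reading word, while a primed one becomes unprimed in
  \<open>plus_tab S\<close> and occurs in the second. The inequalities that
  \<open>stair_yam k\<close> omits are trivial, because the chain is constant from index
  \<open>2 * k\<close> on.\<close>

lemma HT_iff:
  assumes T: "young T" and k: "psize (shape T) \<le> k"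
  shows "S \<in> HT (map length T) \<longleftrightarrow>
    (tab even (2 * k) S \<and> shape S = shape T) \<and> stair_yam k (chain_of S)"
proof -
  have lens: "map length S = map length T \<longleftrightarrow> shape S = shape T" if S: "young S"
  proof
    assume "map length S = map length T"
    then have "length S = length T" "\<And>r. r < length T \<Longrightarrow> length (S ! r) = length (T ! r)"
      by (metis length_map, metis length_map nth_map)
    then show "shape S = shape T" by (auto simp: shape_def)
  next
    assume sh: "shape S = shape T"
    have "r < length S \<longleftrightarrow> r < length T" for r
      using young_row[OF S, of r] young_row[OF T, of r] fun_cong[OF sh, of r] by (auto simp: shape_def split: if_splits)
    then have l: "length S = length T" by (rule nat_eqI)
    show "map length S = map length T"
    proof (rule nth_equalityI)
      fix r assume "r < length (map length S)"
      then show "map length S ! r = map length T ! r" using fun_cong[OF sh, of r] l by (simp add: shape_def)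
    qed (simp add: l)
  qed
  have yam: "reverse_yamanouchi (reading_word S) \<and> reverse_yamanouchi (reading_word (plus_tab S)) \<longleftrightarrow>
    stair_yam k (chain_of S)" if S: "tab even (2 * k) S"
  proof -
    let ?X = "chain_of S"
    have le: "?X i r \<le> ?X (Suc i) r" for i r by (simp add: chain_of_Suc)
    have p: "part (?X i)" for i by (rule chain_set_part[OF chain_of_in_chain_set[OF S]])
    have trle: "conjugate (?X i) r \<le> conjugate (?X (Suc i)) r" for i r
      by (rule nat_leI) (use le[of i] in \<open>auto simp: conjugate_less_iff p intro: less_le_trans\<close>)
    have const: "?X i = shape S" if "i \<ge> 2 * k" for i
      using chain_of_in_chain_set[OF S] that by (auto simp: chain_set_def)
    have "reverse_yamanouchi (reading_word S) \<longleftrightarrow>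
      (\<forall>i. ucond (?X (2 * i + 1)) (?X (2 * i + 2)) (?X (2 * i + 3)) (?X (2 * i + 4)))"
      unfolding reading_word_def by (rule yamanouchi_ucond) (rule tab_rows_sorted[OF S])
    also have "\<dots> \<longleftrightarrow> (\<forall>i. Suc i < k \<longrightarrow> ucond (?X (2 * i + 1)) (?X (2 * i + 2)) (?X (2 * i + 3)) (?X (2 * i + 4)))"
    proof -
      have "ucond (?X (2 * i + 1)) (?X (2 * i + 2)) (?X (2 * i + 3)) (?X (2 * i + 4))" if "\<not> Suc i < k" for i
        using that const[of "2 * i + 3"] const[of "2 * i + 4"] le[of "2 * i + 1"] by (simp add: ucond_trivial)
      then show ?thesis by blast
    qed
    finally have 1: "reverse_yamanouchi (reading_word S) \<longleftrightarrow>
      (\<forall>i. Suc i < k \<longrightarrow> ucond (?X (2 * i + 1)) (?X (2 * i + 2)) (?X (2 * i + 3)) (?X (2 * i + 4)))" .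
    \<comment> \<open>Raising the entries shifts the index by one, so the strips of the unprimed
      letters of \<open>plus_tab S\<close> are the conjugated strips of the primed letters of
      \<open>S\<close>.\<close>
    have pt: "chain_of (plus_tab S) (Suc m) = conjugate (?X m)" for m
    proof -
      have "chain_of (plus_tab S) (Suc m) = chain_of (transpose S) m"
        by (rule ext) (simp add: chain_of_def plus_tab_def filter_map comp_def)
      then show ?thesis by (simp add: chain_of_transpose[OF S])
    qed
    have "reverse_yamanouchi (reading_word (plus_tab S)) \<longleftrightarrow>
      (\<forall>i. ucond (chain_of (plus_tab S) (2 * i + 1)) (chain_of (plus_tab S) (2 * i + 2))
        (chain_of (plus_tab S) (2 * i + 3)) (chain_of (plus_tab S) (2 * i + 4)))"
      unfolding reading_word_def
      by (rule yamanouchi_ucond) (use tab_cols_sorted[OF S] in \<open>auto simp: plus_tab_def sorted_map\<close>)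
    also have "\<dots> \<longleftrightarrow> (\<forall>i. ucond (conjugate (?X (2 * i))) (conjugate (?X (2 * i + 1))) (conjugate (?X (2 * i + 2))) (conjugate (?X (2 * i + 3))))"
      by (simp add: pt numeral_eq_Suc)
    also have "\<dots> \<longleftrightarrow> (\<forall>i. Suc i < k \<longrightarrow>
      ucond (conjugate (?X (2 * i))) (conjugate (?X (2 * i + 1))) (conjugate (?X (2 * i + 2))) (conjugate (?X (2 * i + 3))))"
    proof -
      have "ucond (conjugate (?X (2 * i))) (conjugate (?X (2 * i + 1))) (conjugate (?X (2 * i + 2))) (conjugate (?X (2 * i + 3)))"
        if "\<not> Suc i < k" for i
        using that const[of "2 * i + 2"] const[of "2 * i + 3"] trle[of "2 * i"] by (simp add: ucond_trivial)
      then show ?thesis by blast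
    qed
    finally show ?thesis unfolding stair_yam_def using 1 by blast
  qed
  have bound: "x \<le> 2 * k"
    if S: "primed_tableau S" "shape S = shape T" "reverse_yamanouchi (reading_word S)"
      "reverse_yamanouchi (reading_word (plus_tab S))" and x: "x \<in> set (concat S)" for x
  proof -
    have y: "young S" using S(1) by (simp add: primed_tableau_def)
    have len: "length (reading_word R) \<le> length (concat R)" for R
      unfolding reading_word_def length_map
      by (rule le_trans[OF length_filter_le]) (simp add: length_concat rev_map[symmetric])
    have letter: "z div 2 \<in> set (reading_word R)" if "z \<in> set (concat R)" "even z" for z R
      using that by (auto simp: reading_word_def)
    show ?thesis
    proof (cases "even x")
      case True
      then have "x div 2 \<in> set (reading_word S)" using x letter by blast
      then have "x div 2 \<le> length (concat S)"
        using reverse_yamanouchi_letter_bound[OF S(3)] len[of S] le_trans by blast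
      also have "\<dots> \<le> k" using k S(2) psize_shape[of S] by simp
      finally show ?thesis using True by auto
    next
      case False
      have "Suc x \<in> set (concat (plus_tab S))"
        using x set_transpose_young[OF y] by (auto simp: plus_tab_def)
      moreover have "even (Suc x)" using False by simp
      ultimately have "Suc x div 2 \<in> set (reading_word (plus_tab S))" by (rule letter)
      then have "Suc x div 2 \<le> length (concat (plus_tab S))"
        using reverse_yamanouchi_letter_bound[OF S(4)] len[of "plus_tab S"] le_trans by blast
      also have "\<dots> = length (concat (transpose S))" by (simp add: plus_tab_def length_concat comp_def)
      also have "\<dots> = psize (shape S)"
        unfolding psize_shape[symmetric] shape_transpose[OF y] by (rule psize_conjugate[OF part_shape[OF y]])
      also have "\<dots> \<le> k" using k S(2) by simp
      finally show ?thesis using False by presburger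
    qed
  qed
  show ?thesis
  proof
    assume S: "S \<in> HT (map length T)"
    then have S': "primed_tableau S" "map length S = map length T"
      "reverse_yamanouchi (reading_word S)" "reverse_yamanouchi (reading_word (plus_tab S))"
      by (auto simp: HT_def)
    then have sh: "shape S = shape T" using lens by (simp add: primed_tableau_def)
    then have "tab even (2 * k) S" using primed_tab bound S' by blast
    then show "(tab even (2 * k) S \<and> shape S = shape T) \<and> stair_yam k (chain_of S)"
      using sh yam S' by blast
  next
    assume S: "(tab even (2 * k) S \<and> shape S = shape T) \<and> stair_yam k (chain_of S)"
    moreover have "young S" "primed_tableau S" using S primed_tab[of S] by (auto simp: tab_def)
    ultimately show "S \<in> HT (map length T)" using yam lens by (auto simp: HT_def)
  qed
qed

lemma HT_sum:
  assumes T: "young T" and k: "psize (shape T) \<le> k"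
    and a: "\<And>m. m = 0 \<or> m > k \<Longrightarrow> a m = 0" and b: "\<And>m. m = 0 \<or> m > k \<Longrightarrow> b m = 0"
  shows "(\<Sum>S\<in>HT (map length T). schur_coeff (pdw1 S) a * schur_coeff (pdw2 S) b) =
    card {X \<in> chain_set even (2 * k) empty_part (shape T). stair_weight k X (\<lambda>i. a (Suc i)) (\<lambda>i. b (Suc i))}"
proof -
  let ?g = "\<lambda>X. kostka k (stair_a k X) (\<lambda>i. a (Suc i)) * kostka k (stair_b k X) (\<lambda>i. b (Suc i))"
  have HT: "HT (map length T) = {S \<in> {S. tab even (2 * k) S \<and> shape S = shape T}. stair_yam k (chain_of S)}"
    using HT_iff[OF T k] by blast
  have "schur_coeff (pdw1 S) a * schur_coeff (pdw2 S) b = ?g (chain_of S)" if "S \<in> HT (map length T)" for S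
  proof -
    have S: "tab even (2 * k) S" using HT that by blast
    have z: "count_list (concat S) x = 0" if "x > 2 * k" for x
      using S that unfolding tab_def count_list_0_iff by fastforce
    have "pdw1 S (Suc r) = stair_a k (chain_of S) r" "pdw2 S (Suc r) = stair_b k (chain_of S) r" for r
      using psize_chain_of_Suc[of S "2 * r"] psize_chain_of_Suc[of S "2 * r + 1"] z[of "2 * r + 1"] z[of "2 * r + 2"]
      by (auto simp: pdw1_def pdw2_def stair_a_def stair_b_def)
    then show ?thesis
      using schur_coeff_kostka[of "pdw1 S" _ k a] schur_coeff_kostka[of "pdw2 S" _ k b] a b by simp
  qed
  then have "(\<Sum>S\<in>HT (map length T). schur_coeff (pdw1 S) a * schur_coeff (pdw2 S) b) =
      (\<Sum>S\<in>HT (map length T). ?g (chain_of S))" by (rule sum.cong[OF HOL.refl])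
  also have "\<dots> = (\<Sum>X\<in>{X \<in> chain_set even (2 * k) empty_part (shape T). stair_yam k X}. ?g X)"
  proof (rule sum.reindex_bij_betw)
    show "bij_betw chain_of (HT (map length T)) {X \<in> chain_set even (2 * k) empty_part (shape T). stair_yam k X}"
      using chain_of_bij[of even "2 * k" "shape T"] unfolding HT bij_betw_def inj_on_def by auto
  qed
  finally show ?thesis using stair_count[OF part_shape[OF T]] by simp
qed

subsection \<open>Words in the generators\<close>

lemma word_eq_append:
  assumes "word_eq n u v" "word_eq n u' v'" shows "word_eq n (u @ u') (v @ v')"
proof -
  have "word_eq n ([] @ u @ u') ([] @ v @ u')" by (rule word_eq.ctx[OF assms(1)])
  moreover have "word_eq n (v @ u' @ []) (v @ v' @ [])" by (rule word_eq.ctx[OF assms(2)])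
  ultimately show ?thesis using word_eq.trans by fastforce
qed

lemma word_eq_cancel: "a \<in> {- int n..int n} \<Longrightarrow> word_eq n [a, a] []"
  using word_eq.rel[of a n a] by (simp add: m_coef_def)

text \<open>For \<open>a < 0\<close> the exponent of the pair \<open>a\<close>, \<open>- a\<close>
  is 1 and both letters are involutions, so they represent the same group element.\<close>

lemma word_eq_abs_letter:
  assumes "a \<in> {- int n..int n}" shows "word_eq n [a] [\<bar>a\<bar>]"
proof (cases "a < 0")
  case True
  have "word_eq n [a, - a] []" using word_eq.rel[of a n "- a"] assms by (auto simp: m_coef_def)
  then have 1: "word_eq n [a, - a, - a] [- a]" using word_eq.ctx[of n "[a, - a]" "[]" "[]" "[- a]"] by simp
  have "word_eq n [- a, - a] []" using assms by (intro word_eq_cancel) auto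
  then have "word_eq n [a, - a, - a] [a]" using word_eq.ctx[of n "[- a, - a]" "[]" "[a]" "[]"] by simp
  then show ?thesis using 1 True word_eq.sym word_eq.trans by (metis abs_of_neg)
qed (simp add: word_eq.refl)

lemma word_eq_abs: "set w \<subseteq> {- int n..int n} \<Longrightarrow> word_eq n w (map abs w)"
proof (induction w)
  case (Cons a w)
  then show ?case using word_eq_append[OF word_eq_abs_letter[of a n], of w "map abs w"] by simp
qed (simp add: word_eq.refl)

text \<open>Deleting the letter 0 is well defined on \<open>W\<close>: it is the retraction of \<open>W\<close> onto \<open>A_n\<close>.\<close>

lemma word_eq_delete_zero:
  assumes "word_eq n u v" shows "word_eq n (filter (\<lambda>a. a \<noteq> 0) u) (filter (\<lambda>a. a \<noteq> 0) v)"
  using assms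
proof (induction rule: word_eq.induct)
  case (rel a b)
  have dbl: "word_eq n (concat (replicate m [c, c])) []" if "c \<in> {- int n..int n}" for m c
  proof (induction m)
    case (Suc m)
    then show ?case using word_eq_append[OF word_eq_cancel[OF that] Suc] by simp
  qed (simp add: word_eq.refl)
  have f: "filter (\<lambda>a. a \<noteq> 0) (concat (replicate m [a, b])) =
    concat (replicate m (filter (\<lambda>a. a \<noteq> 0) [a, b]))" for m
    by (induction m) auto
  have one: "concat (replicate (2 * m) [c]) = concat (replicate m [c, c])" for m and c :: int
    by (induction m) auto
  consider "a \<noteq> 0" "b \<noteq> 0" | "a = 0" "b = 0" | "a = 0" "b \<noteq> 0" | "a \<noteq> 0" "b = 0" by blast
  then show ?case
  proof cases
    case 1
    then show ?thesis unfolding f using word_eq.rel[OF rel] by simp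
  next
    case 2
    then show ?thesis unfolding f by (simp add: concat_replicate_trivial word_eq.refl)
  next
    case 3
    \<comment> \<open>The exponents of 0 with the other letters are even, so what remains of the
      relation is an even power of one involution.\<close>
    then have "m_coef a b = 4 \<or> m_coef a b = 2" by (auto simp: m_coef_def)
    then obtain m where m: "m_coef a b = 2 * m" by (elim disjE) (rule that[of 2], simp, rule that[of 1], simp)
    have "filter (\<lambda>a. a \<noteq> 0) [a, b] = [b]" using 3 by simp
    then show ?thesis unfolding f m using dbl[of b m] rel by (simp only: one filter.simps(1))
  next
    case 4
    then have "m_coef a b = 4 \<or> m_coef a b = 2" by (auto simp: m_coef_def)
    then obtain m where m: "m_coef a b = 2 * m" by (elim disjE) (rule that[of 2], simp, rule that[of 1], simp)
    have "filter (\<lambda>a. a \<noteq> 0) [a, b] = [a]" using 4 by simp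
    then show ?thesis unfolding f m using dbl[of a m] rel by (simp only: one filter.simps(1))
  qed
qed (auto intro: word_eq.refl word_eq.sym word_eq.trans word_eq.ctx)

lemma word_eq_commute_letters:
  assumes "a \<in> {1..int n}" "b \<in> {1..int n}" "\<bar>a - b\<bar> \<ge> 2"
  shows "word_eq n [a, b] [b, a]"
proof -
  have "m_coef a b = 2" using assms by (auto simp: m_coef_def)
  then have r: "word_eq n [a, b, a, b] []"
    using word_eq.rel[of a n b] assms by (simp add: numeral_eq_Suc)
  have 1: "word_eq n [a, b, a, b, b, a] [b, a]" using word_eq.ctx[OF r, of "[]" "[b, a]"] by simp
  have "word_eq n [b, b] []" "word_eq n [a, a] []" using assms by (auto intro: word_eq_cancel)
  then have "word_eq n [a, b, a, b, b, a] [a, b, a, a]" "word_eq n [a, b, a, a] [a, b]"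
    using word_eq.ctx[of n "[b, b]" "[]" "[a, b, a]" "[a]"] word_eq.ctx[of n "[a, a]" "[]" "[a, b]" "[]"] by auto
  then show ?thesis using 1 word_eq.sym word_eq.trans by blast
qed

lemma word_eq_braid:
  assumes "a \<in> {1..int n}" "a + 1 \<in> {1..int n}"
  shows "word_eq n [a, a + 1, a] [a + 1, a, a + 1]"
proof -
  let ?b = "a + 1"
  have r: "word_eq n [a, ?b, a, ?b, a, ?b] []"
  proof -
    have "m_coef a ?b = 3" using assms by (auto simp: m_coef_def)
    then show ?thesis using word_eq.rel[of a n ?b] assms by (simp add: numeral_eq_Suc)
  qed
  have 1: "word_eq n [a, ?b, a, ?b, a, ?b, ?b, a, ?b] [?b, a, ?b]"
    using word_eq.ctx[OF r, of "[]" "[?b, a, ?b]"] by simp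
  have "word_eq n [?b, ?b] []" "word_eq n [a, a] []" using assms by (auto intro: word_eq_cancel)
  then have "word_eq n [a, ?b, a, ?b, a, ?b, ?b, a, ?b] [a, ?b, a, ?b, a, a, ?b]"
    "word_eq n [a, ?b, a, ?b, a, a, ?b] [a, ?b, a, ?b, ?b]" "word_eq n [a, ?b, a, ?b, ?b] [a, ?b, a]"
    using word_eq.ctx[of n "[?b, ?b]" "[]" "[a, ?b, a, ?b, a]" "[a, ?b]"]
      word_eq.ctx[of n "[a, a]" "[]" "[a, ?b, a, ?b]" "[?b]"]
      word_eq.ctx[of n "[?b, ?b]" "[]" "[a, ?b, a]" "[]"] by auto
  then show ?thesis using 1 word_eq.sym word_eq.trans by blast
qed

lemma word_eq_commute_word:
  assumes "a \<in> {1..int n}" "\<And>b. b \<in> set w \<Longrightarrow> b \<in> {1..int n} \<and> \<bar>a - b\<bar> \<ge> 2"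
  shows "word_eq n (a # w) (w @ [a])"
  using assms(2)
proof (induction w)
  case (Cons b w)
  have "word_eq n ([a, b] @ w) ([b, a] @ w)"
    using word_eq.ctx[OF word_eq_commute_letters[OF assms(1), of b], of "[]" w] Cons.prems[of b] by simp
  moreover have "word_eq n ([b] @ a # w) ([b] @ w @ [a])"
    by (rule word_eq_append[OF word_eq.refl Cons.IH]) (use Cons.prems in auto)
  ultimately show ?case using word_eq.trans by fastforce
qed (simp add: word_eq.refl)

section \<open>Reduced words\<close>

definition is_reduced :: "nat \<Rightarrow> int list \<Rightarrow> bool" where
  "is_reduced n w \<longleftrightarrow> reduced_word n w w"

lemma word_eq_same_class: "word_eq n w u \<Longrightarrow> word_eq n w' u \<longleftrightarrow> word_eq n w' w"
  using word_eq.trans word_eq.sym by metis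

lemma reduced_word_is_reduced: "reduced_word n w u \<longleftrightarrow> word_eq n w u \<and> is_reduced n w"
proof (cases "word_eq n w u")
  case True
  then show ?thesis
    unfolding is_reduced_def reduced_word_def using word_eq_same_class[OF True] word_eq.refl by simp
next
  case False
  then show ?thesis by (simp add: reduced_word_def)
qed

lemma is_reduced_shorter:
  assumes "is_reduced n w" "word_eq n w w'" "set w' \<subseteq> {- int n..int n}" shows "length w \<le> length w'"
  using assms(1) word_eq.sym[OF assms(2)] assms(3) unfolding is_reduced_def reduced_word_def by simp

lemma is_reduced_transfer:
  assumes "is_reduced n w" "word_eq n w w'" "set w' \<subseteq> {- int n..int n}" "length w' = length w"
  shows "is_reduced n w'"
  using assms(1,3,4) word_eq_same_class[OF word_eq.sym[OF assms(2)]] word_eq.refl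
  unfolding is_reduced_def reduced_word_def by simp

lemma is_reduced_factor:
  assumes "is_reduced n (p @ w @ q)" shows "is_reduced n w"
proof -
  have s: "set p \<subseteq> {- int n..int n}" "set w \<subseteq> {- int n..int n}" "set q \<subseteq> {- int n..int n}"
    using assms by (auto simp: is_reduced_def reduced_word_def)
  have "length w \<le> length w'" if "set w' \<subseteq> {- int n..int n}" "word_eq n w' w" for w'
    using is_reduced_shorter[OF assms word_eq.ctx[OF word_eq.sym[OF that(2)], of p q]] that s by simp
  then show ?thesis using s by (simp add: is_reduced_def reduced_word_def word_eq.refl)
qed

lemma is_reduced_no_square: "\<not> is_reduced n (p @ [a, a] @ q)"
proof
  assume r: "is_reduced n (p @ [a, a] @ q)"
  then have "set (p @ [a, a] @ q) \<subseteq> {- int n..int n}" by (simp add: is_reduced_def reduced_word_def)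
  then show False using is_reduced_shorter[OF r word_eq.ctx[OF word_eq_cancel[of a n], of p q]] by auto
qed

subsection \<open>Edelman--Greene insertion\<close>

text \<open>The bumping rule of Edelman and Greene: \<open>x\<close> is inserted into the row
  \<open>R\<close>, \<open>y\<close> is pushed out, \<open>R'\<close> remains. The second disjunct
  is their special rule for a row containing both \<open>x\<close> and \<open>x + 1\<close>. If the
  row contains \<open>x\<close> but not \<open>x + 1\<close> and \<open>x\<close> is inserted, no
  outcome exists; hence a relation.\<close>

definition rowbump :: "int list \<Rightarrow> int \<Rightarrow> int \<Rightarrow> int list \<Rightarrow> bool" where
  "rowbump R x y R' \<longleftrightarrow>
     (\<exists>j<length R. R ! j = y \<and> R' = R[j := x] \<and> x < y \<and> (\<forall>i<j. R ! i < x)) \<or>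
     (\<exists>j. Suc j < length R \<and> R ! j = x \<and> R ! Suc j = y \<and> y = x + 1 \<and> R' = R)"

text \<open>The last argument is the index of the row in which the new cell appears; these indices
  take the place of a recording tableau.\<close>

inductive eg_ins :: "int list list \<Rightarrow> int \<Rightarrow> int list list \<Rightarrow> nat \<Rightarrow> bool" where
  new: "eg_ins [] x [[x]] 0"
| app: "(\<forall>a\<in>set R. a < x) \<Longrightarrow> eg_ins (R # P) x ((R @ [x]) # P) 0"
| bump: "rowbump R x y R' \<Longrightarrow> eg_ins P y P' r \<Longrightarrow> eg_ins (R # P) x (R' # P') (Suc r)"

definition dominates :: "int list \<Rightarrow> int list \<Rightarrow> bool" where
  "dominates R S \<longleftrightarrow> length S \<le> length R \<and> (\<forall>j<length S. R ! j < S ! j)"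

text \<open>The column condition is stated for neighbouring rows only, which suits inductions that
  follow a letter from row to row; \<open>eg_tab_iff\<close> gives the agreement with the
  formulation by transposes.\<close>

fun eg_tab :: "int list list \<Rightarrow> bool" where
  "eg_tab [] = True"
| "eg_tab (R # P) = (R \<noteq> [] \<and> sorted_wrt (<) R \<and> eg_tab P \<and> (P \<noteq> [] \<longrightarrow> dominates R (hd P)))"

abbreviation reading :: "int list list \<Rightarrow> int list" where
  "reading P \<equiv> concat (rev P)"

lemma sorted_nth: "sorted_wrt (<) (R :: int list) \<Longrightarrow> i < j \<Longrightarrow> j < length R \<Longrightarrow> R ! i < R ! j"
  by (rule sorted_wrt_nth_less)

lemma in_set_drop_nth:
  assumes "b \<in> set (drop m R)" obtains i where "m \<le> i" "i < length R" "b = R ! i"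
proof -
  obtain i where i: "i < length (drop m R)" "b = drop m R ! i" using assms by (metis in_set_conv_nth)
  then show thesis by (intro that[of "m + i"]) auto
qed

lemma rowbump_length: "rowbump R x y R' \<Longrightarrow> length R' = length R"
  by (auto simp: rowbump_def)

lemma rowbump_less: "rowbump R x y R' \<Longrightarrow> x < y"
  by (auto simp: rowbump_def)

lemma rowbump_mem: "rowbump R x y R' \<Longrightarrow> y \<in> set R \<and> x \<in> set R'"
  by (auto simp: rowbump_def set_update_memI) (metis nth_mem)

lemma rowbump_set: "rowbump R x y R' \<Longrightarrow> set R' \<subseteq> insert x (set R) \<and> set R \<subseteq> insert y (set R')"
proof (auto simp: rowbump_def dest: set_update_subset_insert[THEN subsetD])
  fix j z assume "R' = R[j := x]" "z \<in> set R" "z \<notin> set (R[j := x])" "j < length R"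
  then obtain i where "i < length R" "z = R ! i" by (auto simp: in_set_conv_nth)
  then show "z = R ! j"
    using \<open>z \<notin> set (R[j := x])\<close> by (metis length_list_update nth_list_update_neq nth_mem)
qed

lemma rowbump_sorted:
  assumes "rowbump R x y R'" "sorted_wrt (<) R" shows "sorted_wrt (<) R'"
  using assms(1) unfolding rowbump_def
proof (elim disjE exE conjE)
  fix j assume j: "j < length R" "R ! j = y" "R' = R[j := x]" "x < y" "\<forall>i<j. R ! i < x"
  show ?thesis
    unfolding sorted_wrt_iff_nth_less
  proof (intro allI impI)
    fix i k assume ik: "i < k" "k < length R'"
    then have "R ! i < R ! k" using sorted_nth[OF assms(2)] j by simp
    then show "R' ! i < R' ! k" using ik j by (auto simp: nth_list_update)
  qed
qed (use assms in simp)

text \<open>A bump is missing only if \<open>x\<close> lies in the row and \<open>x + 1\<close> does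
  not. All entries to the right of \<open>x\<close> then commute with \<open>x\<close>, so the
  inserted letter can be moved next to its equal, against reducedness.\<close>

lemma rowbump_exists:
  assumes s: "sorted_wrt (<) R" and r: "is_reduced n (R @ [x])" and l: "set (R @ [x]) \<subseteq> {1..int n}"
    and nx: "\<not> (\<forall>a\<in>set R. a < x)"
  shows "\<exists>y R'. rowbump R x y R'"
proof -
  define j where "j = (LEAST j. j < length R \<and> \<not> R ! j < x)"
  have "\<exists>j. j < length R \<and> \<not> R ! j < x" using nx by (auto simp: in_set_conv_nth)
  then have j: "j < length R" "\<not> R ! j < x" using LeastI_ex[of "\<lambda>j. j < length R \<and> \<not> R ! j < x"] by (auto simp: j_def)
  have lt: "R ! i < x" if "i < j" for i
    using not_less_Least[of i "\<lambda>j. j < length R \<and> \<not> R ! j < x"] that j unfolding j_def by auto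
  show ?thesis
  proof (cases "R ! j = x")
    case False
    then have "rowbump R x (R ! j) (R[j := x])" unfolding rowbump_def using j lt by auto
    then show ?thesis by blast
  next
    case True
    have "rowbump R x (x + 1) R"
    proof (rule ccontr)
      assume nb: "\<not> rowbump R x (x + 1) R"
      let ?A = "take j R" and ?B = "drop (Suc j) R"
      have R: "R = ?A @ x # ?B" using id_take_nth_drop[OF j(1)] True by simp
      have B: "b \<in> {1..int n} \<and> \<bar>x - b\<bar> \<ge> 2" if bB: "b \<in> set ?B" for b
      proof -
        obtain i where b: "Suc j \<le> i" "i < length R" "b = R ! i" using bB by (rule in_set_drop_nth)
        have "Suc j < length R" using b by simp
        then have "R ! Suc j \<noteq> x + 1" using nb True unfolding rowbump_def by blast
        moreover have "x < R ! Suc j" using sorted_nth[OF s, of j "Suc j"] True \<open>Suc j < length R\<close> by simp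
        moreover have "R ! Suc j \<le> b" using sorted_nth[OF s, of "Suc j" i] b by (cases "i = Suc j") auto
        moreover have "b \<in> set R" using b by simp
        ultimately show ?thesis using l by auto
      qed
      have x: "x \<in> {1..int n}" using l by simp
      have "word_eq n (?B @ [x]) (x # ?B)" by (rule word_eq.sym[OF word_eq_commute_word[OF x B]])
      from word_eq.ctx[OF this, of "?A @ [x]" "[]"]
      have "word_eq n ((?A @ x # ?B) @ [x]) (?A @ [x, x] @ ?B)" by simp
      then have e: "word_eq n (R @ [x]) (?A @ [x, x] @ ?B)" using R by simp
      have "set (?A @ [x, x] @ ?B) \<subseteq> {- int n..int n}"
        using l set_take_subset[of j R] set_drop_subset[of "Suc j" R] by auto
      moreover have "length (?A @ [x, x] @ ?B) = length (R @ [x])" using j by simp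
      ultimately have "is_reduced n (?A @ [x, x] @ ?B)" by (rule is_reduced_transfer[OF r e])
      then show False using is_reduced_no_square by blast
    qed
    then show ?thesis by blast
  qed
qed

text \<open>The letter \<open>x\<close> commutes past the entries to the right of the bumping place,
  and \<open>y\<close> past those to the left of it; for the special rule one braid relation is
  applied in between.\<close>

lemma rowbump_word_eq:
  assumes b: "rowbump R x y R'" and s: "sorted_wrt (<) R" and l: "set (R @ [x]) \<subseteq> {1..int n}"
  shows "word_eq n (R @ [x]) (y # R')"
  using b unfolding rowbump_def
proof (elim disjE exE conjE)
  fix j assume j: "j < length R" "R ! j = y" "R' = R[j := x]" "x < y" "\<forall>i<j. R ! i < x"
  let ?A = "take j R" and ?B = "drop (Suc j) R"
  have R: "R = ?A @ y # ?B" using id_take_nth_drop[OF j(1)] j(2) by simp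
  have R': "R' = ?A @ x # ?B" unfolding j(3) by (rule upd_conv_take_nth_drop[OF j(1)])
  have A: "a < x" "a \<in> {1..int n}" if a: "a \<in> set ?A" for a
  proof -
    obtain i where "i < j" "a = R ! i" using a j(1) by (auto simp: in_set_conv_nth)
    then show "a < x" using j(5) by simp
    show "a \<in> {1..int n}" using a l set_take_subset[of j R] by auto
  qed
  have B: "y < b" "b \<in> {1..int n}" if b: "b \<in> set ?B" for b
  proof -
    obtain i where "Suc j \<le> i" "i < length R" "b = R ! i" using b by (rule in_set_drop_nth)
    then show "y < b" using sorted_nth[OF s, of j i] j by auto
    show "b \<in> {1..int n}" using b l set_drop_subset[of "Suc j" R] by auto
  qed
  have xy: "x \<in> {1..int n}" "y \<in> {1..int n}" using l j nth_mem[OF j(1)] by auto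
  have "word_eq n (?B @ [x]) (x # ?B)"
    by (rule word_eq.sym[OF word_eq_commute_word[OF xy(1)]]) (use B j(4) in force)
  from word_eq.ctx[OF this, of "?A @ [y]" "[]"] have 1: "word_eq n (R @ [x]) (?A @ y # x # ?B)"
    using R by (metis append.assoc append.right_neutral append_Cons append_Nil)
  have "word_eq n (?A @ [y]) (y # ?A)"
    by (rule word_eq.sym[OF word_eq_commute_word[OF xy(2)]]) (use A j(4) in force)
  from word_eq.ctx[OF this, of "[]" "x # ?B"] have "word_eq n (?A @ y # x # ?B) (y # R')"
    by (simp add: R')
  then show ?thesis using 1 word_eq.trans by blast
next
  fix j assume j: "Suc j < length R" "R ! j = x" "R ! Suc j = y" "y = x + 1" "R' = R"
  let ?A = "take j R" and ?B = "drop (Suc (Suc j)) R"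
  have R: "R = ?A @ x # y # ?B"
    using id_take_nth_drop[of j R] Cons_nth_drop_Suc[of "Suc j" R] j by simp
  have A: "a < x" "a \<in> {1..int n}" if a: "a \<in> set ?A" for a
  proof -
    obtain i where "i < j" "a = R ! i" using a j(1) by (auto simp: in_set_conv_nth)
    then show "a < x" using sorted_nth[OF s, of i j] j by simp
    show "a \<in> {1..int n}" using a l set_take_subset[of j R] by auto
  qed
  have B: "y < b" "b \<in> {1..int n}" if b: "b \<in> set ?B" for b
  proof -
    obtain i where "Suc (Suc j) \<le> i" "i < length R" "b = R ! i" using b by (rule in_set_drop_nth)
    then show "y < b" using sorted_nth[OF s, of "Suc j" i] j by auto
    show "b \<in> {1..int n}" using b l set_drop_subset[of "Suc (Suc j)" R] by auto
  qed
  have xy: "x \<in> {1..int n}" "y \<in> {1..int n}" using l j nth_mem[OF j(1)] by auto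
  have "word_eq n (?B @ [x]) (x # ?B)"
    by (rule word_eq.sym[OF word_eq_commute_word[OF xy(1)]]) (use B j(4) in force)
  from word_eq.ctx[OF this, of "?A @ [x, y]" "[]"] have "word_eq n ((?A @ x # y # ?B) @ [x]) (?A @ [x, y, x] @ ?B)"
    by simp
  then have 1: "word_eq n (R @ [x]) (?A @ [x, y, x] @ ?B)" using R by simp
  have 2: "word_eq n (?A @ [x, y, x] @ ?B) (?A @ [y, x, y] @ ?B)"
    using word_eq.ctx[OF word_eq_braid[of x n]] xy j(4) by simp
  have "word_eq n (?A @ [y]) (y # ?A)"
    by (rule word_eq.sym[OF word_eq_commute_word[OF xy(2)]]) (use A j(4) in force)
  from word_eq.ctx[OF this, of "[]" "x # y # ?B"] have "word_eq n (?A @ [y, x, y] @ ?B) (y # ?A @ x # y # ?B)"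
    by simp
  then have "word_eq n (?A @ [y, x, y] @ ?B) (y # R')" using R j(5) by simp
  then show ?thesis using 1 2 word_eq.trans by blast
qed

lemma rowbump_det:
  assumes "rowbump R x y R'" "rowbump R x z R''" "sorted_wrt (<) R" shows "y = z \<and> R' = R''"
proof -
  have no: False if "j < length R" "x < R ! j" "\<forall>i<j. R ! i < x" "k < length R" "R ! k = x" for j k
    using that sorted_nth[OF assms(3), of j k] by (metis less_asym less_irrefl linorder_neqE_nat)
  show ?thesis
    using assms(1,2) unfolding rowbump_def
  proof (elim disjE exE conjE)
    fix j k assume a: "j < length R" "R ! j = y" "R' = R[j := x]" "x < y" "\<forall>i<j. R ! i < x"
      "k < length R" "R ! k = z" "R'' = R[k := x]" "x < z" "\<forall>i<k. R ! i < x"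
    then have "j = k" by (metis less_asym linorder_neqE_nat)
    then show ?thesis using a by simp
  next
    fix j k assume a: "j < length R" "R ! j = y" "R' = R[j := x]" "x < y" "\<forall>i<j. R ! i < x"
      "Suc k < length R" "R ! k = x" "R ! Suc k = z" "z = x + 1" "R'' = R"
    then show ?thesis using no[of j k] by simp
  next
    fix j k assume a: "k < length R" "R ! k = z" "R'' = R[k := x]" "x < z" "\<forall>i<k. R ! i < x"
      "Suc j < length R" "R ! j = x" "R ! Suc j = y" "y = x + 1" "R' = R"
    then show ?thesis using no[of k j] by simp
  next
    fix j k assume "y = x + 1" "R' = R" "z = x + 1" "R'' = R"
    then show ?thesis by simp
  qed
qed

text \<open>Under the ordinary rule \<open>y\<close> leaves the row, under the special rule it
  stays, so \<open>y\<close> and \<open>R'\<close> reveal the rule. Under the ordinary rule the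
  place of the bump is then fixed, because \<open>y\<close> has to fit into a sorted row.\<close>

lemma rowbump_inj:
  assumes "rowbump R x y R'" "rowbump S z y R'" "sorted_wrt (<) R" "sorted_wrt (<) S"
  shows "R = S \<and> x = z"
proof -
  have asym: "j \<le> k" if "rowbump R x y R'" "j < length R" "R ! j = y" "R' = R[j := x]" "x < y" "\<forall>i<j. R ! i < x"
      "k < length S" "S ! k = y" "R' = S[k := z]" "z < y" "sorted_wrt (<) S" for j k R S x z
  proof (rule ccontr)
    assume k: "\<not> j \<le> k"
    have len: "length S = length R" using that by (metis length_list_update)
    have "S ! k < S ! j" using sorted_nth[OF that(11), of k j] k that len by simp
    moreover have "R' ! j = x" using that(2,4) by simp
    moreover have "R' ! j = S ! j" unfolding that(9) using k by simp
    ultimately show False using that by simp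
  qed
  have excl: False if "j < length R" "R ! j = y" "R' = R[j := x]" "x < y" "sorted_wrt (<) R"
    "Suc k < length R'" "R' ! Suc k = y" for j k R x
  proof -
    have "Suc k \<noteq> j" using that by auto
    then have "R ! Suc k = R ! j" using that by simp
    then show False using sorted_nth[OF that(5), of j "Suc k"] sorted_nth[OF that(5), of "Suc k" j] that \<open>Suc k \<noteq> j\<close>
      by (metis length_list_update less_irrefl linorder_neqE_nat)
  qed
  show ?thesis
    using assms(1,2) unfolding rowbump_def
  proof (elim disjE exE conjE)
    fix j k assume a: "j < length R" "R ! j = y" "R' = R[j := x]" "x < y" "\<forall>i<j. R ! i < x"
      "k < length S" "S ! k = y" "R' = S[k := z]" "z < y" "\<forall>i<k. S ! i < z"
    then have jk: "j = k" using asym[where j=j and k=k and R=R and S=S and x=x and z=z] asym[where j=k and k=j and R=S and S=R and x=z and z=x] assms by auto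
    have "x = R' ! j" "z = R' ! j" using a(1,3) a(6,8) jk by (simp, metis nth_list_update_eq)
    moreover have "R = R'[j := y]" "S = R'[j := y]" using a jk by (metis list_update_id list_update_overwrite)+
    ultimately show ?thesis by simp
  next
    fix j k assume "j < length R" "R ! j = y" "R' = R[j := x]" "x < y"
      "Suc k < length S" "S ! k = z" "S ! Suc k = y" "y = z + 1" "R' = S"
    then show ?thesis using excl[where j=j and k=k and R=R and x=x] assms by auto
  next
    fix j k assume "k < length S" "S ! k = y" "R' = S[k := z]" "z < y"
      "Suc j < length R" "R ! j = x" "R ! Suc j = y" "y = x + 1" "R' = R"
    then show ?thesis using excl[where j=k and k=j and R=S and x=z] assms by auto
  next
    fix j k assume "y = x + 1" "R' = R" "y = z + 1" "R' = S"
    then show ?thesis by simp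
  qed
qed

text \<open>The bump must have involved the last entry below \<open>y\<close>. If \<open>y\<close>
  itself is in \<open>R'\<close>, that entry is \<open>y - 1\<close>: otherwise the \<open>y\<close>
  in front would commute past everything to the left of its copy and produce a square.\<close>

lemma rowbump_rev_exists:
  assumes s: "sorted_wrt (<) R'" and r: "is_reduced n (y # R')" and l: "set (y # R') \<subseteq> {1..int n}"
    and ex: "a \<in> set R'" "a < y"
  shows "\<exists>R x. rowbump R x y R' \<and> sorted_wrt (<) R"
proof -
  obtain i0 where i0: "i0 < length R'" "R' ! i0 < y" using ex by (auto simp: in_set_conv_nth)
  define J where "J = {i. i < length R' \<and> R' ! i < y}"
  have J: "finite J" "J \<noteq> {}" using i0 by (auto simp: J_def)
  define j where "j = Max J"
  have j: "j < length R'" "R' ! j < y" using Max_in[OF J] by (auto simp: j_def J_def)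
  have gt: "y \<le> R' ! i" if "j < i" "i < length R'" for i
    using Max_ge[OF J(1), of i] that by (auto simp: j_def J_def not_less[symmetric])
  show ?thesis
  proof (cases "y \<in> set R'")
    case False
    have "rowbump (R'[j := y]) (R' ! j) y R'"
      unfolding rowbump_def using j sorted_nth[OF s] by (intro disjI1 exI[of _ j]) auto
    moreover have "sorted_wrt (<) (R'[j := y])"
      unfolding sorted_wrt_iff_nth_less
    proof (intro allI impI)
      fix i k assume ik: "i < k" "k < length (R'[j := y])"
      then have "R' ! i < R' ! k" using sorted_nth[OF s] by simp
      moreover have "R' ! k \<noteq> y" using False ik by (metis length_list_update nth_mem)
      ultimately show "R'[j := y] ! i < R'[j := y] ! k"
        using ik gt[of k] j by (auto simp: nth_list_update)
    qed
    ultimately show ?thesis by blast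
  next
    case True
    then obtain k where k: "k < length R'" "R' ! k = y" by (auto simp: in_set_conv_nth)
    have jk: "k = Suc j"
    proof -
      have "j < k" using sorted_nth[OF s, of k j] j k by (metis less_asym less_irrefl linorder_neqE_nat)
      moreover have "\<not> Suc j < k" using gt[of "Suc j"] sorted_nth[OF s, of "Suc j" k] k by force
      ultimately show ?thesis by simp
    qed
    have "R' ! j = y - 1"
    proof (rule ccontr)
      assume ne: "R' ! j \<noteq> y - 1"
      let ?A = "take k R'" and ?B = "drop (Suc k) R'"
      have R: "R' = ?A @ y # ?B" using id_take_nth_drop[OF k(1)] k(2) by simp
      have A: "b \<in> {1..int n} \<and> \<bar>y - b\<bar> \<ge> 2" if b: "b \<in> set ?A" for b
      proof -
        obtain i where i: "i < k" "b = R' ! i" using b k(1) by (auto simp: in_set_conv_nth)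
        have "b \<le> R' ! j" using i jk sorted_nth[OF s, of i j] j by (cases "i = j") auto
        then show ?thesis using ne j b l set_take_subset[of k R'] by auto
      qed
      have y: "y \<in> {1..int n}" using l by simp
      have "word_eq n (y # ?A) (?A @ [y])" by (rule word_eq_commute_word[OF y A])
      from word_eq.ctx[OF this, of "[]" "y # ?B"] have "word_eq n (y # ?A @ y # ?B) (?A @ [y, y] @ ?B)" by simp
      then have e: "word_eq n (y # R') (?A @ [y, y] @ ?B)" using R by simp
      have "set (?A @ [y, y] @ ?B) \<subseteq> {- int n..int n}"
        using l set_take_subset[of k R'] set_drop_subset[of "Suc k" R'] by auto
      moreover have "length (?A @ [y, y] @ ?B) = length (y # R')" using k by simp
      ultimately have "is_reduced n (?A @ [y, y] @ ?B)" by (rule is_reduced_transfer[OF r e])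
      then show False using is_reduced_no_square by blast
    qed
    then have "rowbump R' (y - 1) y R'" unfolding rowbump_def using jk k by auto
    then show ?thesis using s by blast
  qed
qed

text \<open>The bumped letter enters the next row weakly to the left of column \<open>j\<close>, and
  all entries of \<open>R'\<close> up to this column are below \<open>y\<close>. Under the special
  rule \<open>j\<close> is the column of \<open>x\<close>, not of \<open>y\<close>: the entry
  underneath exceeds \<open>x\<close> and so is at least \<open>y\<close>.\<close>

lemma dominates_bump:
  assumes d: "dominates R S" and b: "rowbump R x y R'" and s: "sorted_wrt (<) R"
  shows "\<forall>a\<in>set S. a < y \<Longrightarrow> dominates R' (S @ [y])"
    and "rowbump S y z S' \<Longrightarrow> dominates R' S'"
proof -
  have le: "length S \<le> length R" "\<And>i. i < length S \<Longrightarrow> R ! i < S ! i" using d by (auto simp: dominates_def)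
  obtain j where j: "j < length R" "\<And>i. i \<le> j \<Longrightarrow> R' ! i < y" "\<And>i. i < length R \<Longrightarrow> R' ! i \<le> R ! i"
    and jS: "j < length S \<Longrightarrow> y \<le> S ! j"
  proof -
    from b show thesis
      unfolding rowbump_def
    proof (elim disjE exE conjE)
      fix j assume a: "j < length R" "R ! j = y" "R' = R[j := x]" "x < y" "\<forall>i<j. R ! i < x"
      show thesis
      proof (rule that[of j])
        show "R' ! i < y" if "i \<le> j" for i
          using a that less_trans[of "R ! i" x y] by (cases "i = j") auto
        show "R' ! i \<le> R ! i" if "i < length R" for i using a that by (cases "i = j") auto
        show "y \<le> S ! j" if "j < length S" using le(2)[OF that] a by simp
      qed (use a in auto)
    next
      fix j assume a: "Suc j < length R" "R ! j = x" "R ! Suc j = y" "y = x + 1" "R' = R"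
      show thesis
      proof (rule that[of j])
        show "R' ! i < y" if "i \<le> j" for i
          using a that sorted_nth[OF s, of i j] by (cases "i = j") auto
        show "y \<le> S ! j" if "j < length S" using le(2)[OF that] a by simp
      qed (use a in auto)
    qed
  qed
  have len: "length R' = length R" by (rule rowbump_length[OF b])
  {
    assume lt: "\<forall>a\<in>set S. a < y"
    have Sj: "length S \<le> j"
    proof (rule ccontr)
      assume "\<not> length S \<le> j"
      then have "y \<le> S ! j" "S ! j \<in> set S" using jS by auto
      then show False using lt leD by blast
    qed
    have "R' ! i < (S @ [y]) ! i" if "i < length (S @ [y])" for i
    proof (cases "i < length S")
      case True
      then show ?thesis using le(1) le(2)[OF True] j(3)[of i] by (simp add: nth_append)
    next
      case False
      then show ?thesis using that Sj j(2)[of i] by (simp add: nth_append)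
    qed
    then show "dominates R' (S @ [y])" using Sj j(1) len by (simp add: dominates_def)
  }
  {
    assume b2: "rowbump S y z S'"
    then show "dominates R' S'"
      unfolding rowbump_def
    proof (elim disjE exE conjE)
      fix l assume l: "l < length S" "S ! l = z" "S' = S[l := y]" "y < z" "\<forall>i<l. S ! i < y"
      have "l \<le> j"
      proof (rule ccontr)
        assume "\<not> l \<le> j"
        then have "y \<le> S ! j" "S ! j < y" using jS l by auto
        then show False by simp
      qed
      have "R' ! i < S' ! i" if "i < length S" for i
        using j(2)[OF \<open>l \<le> j\<close>] j(3)[of i] le(1) le(2)[OF that] l that by (cases "i = l") auto
      then show ?thesis using le len l by (simp add: dominates_def)
    next
      fix l assume "Suc l < length S" "S' = S"
      moreover have "R' ! i < S ! i" if "i < length S" for i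
        using le(1) le(2)[OF that] j(3)[of i] that by simp
      ultimately show ?thesis using le(1) len by (simp add: dominates_def)
    qed
  }
qed

text \<open>Only column \<open>j\<close>, where \<open>y\<close> returns to the upper row, is in
  danger. If \<open>y\<close> came from the same column of the lower row, the ordinary rule puts a
  larger letter back there. Under the special rule \<open>y + 1\<close> would stand in the next
  column underneath an entry greater than \<open>y\<close>, which the dominance of \<open>R'\<close>
  excludes.\<close>

lemma dominates_unbump:
  assumes d: "dominates R' S'" and b: "rowbump R x y R'" and s: "sorted_wrt (<) R" "sorted_wrt (<) S" "sorted_wrt (<) S'"
  shows "S' = S @ [y] \<Longrightarrow> dominates R S"
    and "rowbump S y z S' \<Longrightarrow> dominates R S"
proof -
  have len: "length R' = length R" by (rule rowbump_length[OF b])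
  have le: "length S' \<le> length R" "\<And>i. i < length S' \<Longrightarrow> R' ! i < S' ! i" using d len by (auto simp: dominates_def)
  have key: "dominates R S" if l: "l < length S'" "S' ! l = y" and lenS: "length S \<le> length S'"
    and same: "\<And>i. i < length S \<Longrightarrow> S' ! i \<le> S ! i"
    and at: "l < length S \<Longrightarrow> y < S ! l \<or> (Suc l < length S' \<and> S' ! Suc l = y + 1)" for l
    using b unfolding rowbump_def
  proof (elim disjE exE conjE)
    fix j assume a: "j < length R" "R ! j = y" "R' = R[j := x]" "x < y" "\<forall>i<j. R ! i < x"
    have lj: "l \<le> j"
    proof (rule ccontr)
      assume "\<not> l \<le> j"
      then have "R' ! l = R ! l" "y < R ! l"
        using a sorted_nth[OF s(1), of j l] l le(1) by auto
      then show False using le(2)[OF l(1)] l(2) by simp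
    qed
    have "R ! i < S ! i" if i: "i < length S" for i
    proof (cases "i = j")
      case False
      then show ?thesis using le(2)[of i] same[OF i] i lenS a by auto
    next
      case True
      show ?thesis
      proof (cases "j = l")
        case False
        then have "y < S' ! j" using sorted_nth[OF s(3), of l j] l lj True i lenS by auto
        then show ?thesis using same[OF i] True a by simp
      next
        case jl: True
        have "y < S ! l"
        proof (rule ccontr)
          assume "\<not> y < S ! l"
          then have c: "Suc l < length S'" "S' ! Suc l = y + 1" using at i True jl by auto
          then have "R' ! Suc l < y + 1" "R' ! Suc l = R ! Suc l" "y < R ! Suc l"
            using le(2)[OF c(1)] a jl sorted_nth[OF s(1), of j "Suc j"] c le(1) by auto
          then show False by simp
        qed
        then show ?thesis using jl True a by simp
      qed
    qed
    then show ?thesis using lenS le(1) by (simp add: dominates_def)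
  next
    fix j assume "R' = R"
    then have "R ! i < S ! i" if "i < length S" for i
      using le(2)[of i] same[OF that] that lenS by simp
    then show ?thesis using lenS le(1) by (simp add: dominates_def)
  qed
  show "S' = S @ [y] \<Longrightarrow> dominates R S"
    by (rule key[of "length S"]) (auto simp: nth_append)
  show "rowbump S y z S' \<Longrightarrow> dominates R S"
    unfolding rowbump_def
  proof (elim disjE exE conjE)
    fix l assume l: "l < length S" "S ! l = z" "S' = S[l := y]" "y < z"
    show ?thesis by (rule key[of l]) (use l in \<open>auto simp: nth_list_update\<close>)
  next
    fix l assume l: "Suc l < length S" "S ! l = y" "S ! Suc l = z" "z = y + 1" "S' = S"
    show ?thesis by (rule key[of l]) (use l in auto)
  qed
qed

section \<open>Insertion of one letter and its inverse\<close>

definition valid :: "nat \<Rightarrow> int list list \<Rightarrow> bool" where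
  "valid n P \<longleftrightarrow> eg_tab P \<and> set (reading P) \<subseteq> {1..int n} \<and> is_reduced n (reading P)"

lemma letters_subset: "set w \<subseteq> {1..int n} \<Longrightarrow> set w \<subseteq> {- int n..int n}"
  by fastforce

text \<open>Lower rows come first in the reading word, so the letter \<open>y\<close> that appears
  in front of \<open>R'\<close> stands right behind the word of the rows below, into which it is
  inserted next.\<close>

lemma eg_ins_word:
  assumes "eg_ins P x P' r" "eg_tab P" "set (reading P @ [x]) \<subseteq> {1..int n}"
  shows "word_eq n (reading P @ [x]) (reading P') \<and> length (reading P') = Suc (length (reading P)) \<and> set (reading P') \<subseteq> {1..int n}"
  using assms
proof (induction rule: eg_ins.induct)
  case (new x)
  then show ?case by (simp add: word_eq.refl)
next
  case (app R x P)
  then show ?case by (simp add: word_eq.refl)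
next
  case (bump R x y R' P P' r)
  have s: "sorted_wrt (<) R" "eg_tab P" using bump.prems by auto
  have l: "set (R @ [x]) \<subseteq> {1..int n}" "set (reading P @ [y]) \<subseteq> {1..int n}"
    using bump.prems rowbump_mem[OF bump.hyps(1)] by auto
  have IH: "word_eq n (reading P @ [y]) (reading P')" "length (reading P') = Suc (length (reading P))" "set (reading P') \<subseteq> {1..int n}"
    using bump.IH[OF s(2) l(2)] by auto
  have "word_eq n (reading P @ (R @ [x])) (reading P @ (y # R'))"
    by (rule word_eq_append[OF word_eq.refl rowbump_word_eq[OF bump.hyps(1) s(1) l(1)]])
  moreover have "word_eq n ((reading P @ [y]) @ R') (reading P' @ R')"
    by (rule word_eq_append[OF IH(1) word_eq.refl])
  ultimately have "word_eq n (reading P @ R @ [x]) (reading P' @ R')" using word_eq.trans by fastforce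
  moreover have "set R' \<subseteq> {1..int n}" using rowbump_set[OF bump.hyps(1)] l by auto
  ultimately show ?case using IH rowbump_length[OF bump.hyps(1)] by simp
qed

lemma eg_ins_nonempty: "eg_ins P x P' r \<Longrightarrow> P' \<noteq> []"
  by (cases rule: eg_ins.cases) auto

lemma eg_ins_preserves_eg_tab:
  assumes "eg_ins P x P' r" "eg_tab P" shows "eg_tab P'"
  using assms
proof (induction rule: eg_ins.induct)
  case (app R x P)
  have "sorted_wrt (<) (R @ [x])" using app by (simp add: sorted_wrt_append)
  moreover have "dominates (R @ [x]) S" if "dominates R S" for S
    using that by (auto simp: dominates_def nth_append)
  ultimately show ?case using app by auto
next
  case (bump R x y R' P P' r)
  have s: "sorted_wrt (<) R" "eg_tab P" "R \<noteq> []" using bump.prems by auto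
  have "dominates R' (hd P')"
    using bump.hyps(2)
  proof (cases rule: eg_ins.cases)
    case new
    have "R' ! 0 < y"
      using bump.hyps(1) s unfolding rowbump_def
    proof (elim disjE exE conjE)
      fix j assume "j < length R" "R ! j = y" "R' = R[j := x]" "x < y" "\<forall>i<j. R ! i < x"
      then show ?thesis by (cases "j = 0") auto
    next
      fix j assume "Suc j < length R" "R ! j = x" "y = x + 1" "R' = R"
      then show ?thesis using sorted_nth[OF s(1), of 0 j] by (cases "j = 0") auto
    qed
    then show ?thesis using new s rowbump_length[OF bump.hyps(1)] by (cases R) (auto simp: dominates_def)
  next
    case (app S Q)
    then show ?thesis using dominates_bump(1)[OF _ bump.hyps(1) s(1), of S] bump.prems by auto
  next
    case (bump S z S' Q Q' r')
    then show ?thesis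
      using dominates_bump(2)[OF _ \<open>rowbump R x y R'\<close> s(1), of S z S'] \<open>eg_tab (R # P)\<close> by auto
  qed
  moreover have "R' \<noteq> []" using s rowbump_length[OF bump.hyps(1)] by auto
  ultimately show ?case using bump.IH s rowbump_sorted[OF bump.hyps(1) s(1)] by simp
qed simp

lemma eg_ins_exists:
  assumes "eg_tab P" "set (reading P @ [x]) \<subseteq> {1..int n}" "is_reduced n (reading P @ [x])"
  shows "\<exists>P' r. eg_ins P x P' r"
  using assms
proof (induction P arbitrary: x)
  case Nil
  then show ?case using eg_ins.new by blast
next
  case (Cons R P)
  show ?case
  proof (cases "\<forall>a\<in>set R. a < x")
    case True
    then show ?thesis using eg_ins.app by blast
  next
    case False
    have s: "sorted_wrt (<) R" "eg_tab P" using Cons.prems by auto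
    have l: "set (R @ [x]) \<subseteq> {1..int n}" using Cons.prems by auto
    have "is_reduced n (R @ [x])" using is_reduced_factor[of n "reading P" "R @ [x]" "[]"] Cons.prems by simp
    then obtain y R' where b: "rowbump R x y R'" using rowbump_exists[OF s(1) _ l False] by blast
    have l': "set (reading P @ [y]) \<subseteq> {1..int n}" using Cons.prems rowbump_mem[OF b] by auto
    have e: "word_eq n (reading P @ (R @ [x])) (reading P @ (y # R'))"
      by (rule word_eq_append[OF word_eq.refl rowbump_word_eq[OF b s(1) l]])
    have r: "is_reduced n (reading P @ (R @ [x]))" using Cons.prems by simp
    have "set (reading P @ (y # R')) \<subseteq> {1..int n}" using rowbump_set[OF b] l l' by auto
    then have "is_reduced n (reading P @ (y # R'))"
      by (rule is_reduced_transfer[OF r e letters_subset]) (simp add: rowbump_length[OF b])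
    then have "is_reduced n (reading P @ [y])" using is_reduced_factor[of n "[]" "reading P @ [y]" R'] by simp
    then show ?thesis using Cons.IH[OF s(2) l'] eg_ins.bump[OF b] by blast
  qed
qed

lemma eg_ins_det:
  assumes "eg_ins P x P' r" "eg_ins P x P'' r'" "eg_tab P" shows "P' = P'' \<and> r = r'"
  using assms
proof (induction arbitrary: P'' r' rule: eg_ins.induct)
  case (new x)
  then show ?case by (auto elim: eg_ins.cases)
next
  case (app R x P)
  from app.prems(1) show ?case
  proof (cases rule: eg_ins.cases)
    case (bump y R' Q r)
    then have "x < y" "y \<in> set R" using rowbump_less rowbump_mem by blast+
    then show ?thesis using app.hyps by force
  qed auto
next
  case (bump R x y R' P P' r)
  from bump.prems(1) show ?case
  proof (cases rule: eg_ins.cases)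
    case app
    then show ?thesis using rowbump_less[OF bump.hyps(1)] rowbump_mem[OF bump.hyps(1)] by force
  next
    case (bump z S Q r2)
    have "y = z \<and> R' = S" using rowbump_det[OF \<open>rowbump R x y R'\<close> bump(3)] \<open>eg_tab (R # P)\<close> by simp
    then show ?thesis using bump bump.IH[of Q r2] \<open>eg_tab (R # P)\<close> by auto
  qed
qed

lemma eg_ins_inj:
  assumes "eg_ins P x T r" "eg_ins Q z T r" "eg_tab P" "eg_tab Q" shows "P = Q \<and> x = z"
  using assms
proof (induction arbitrary: Q z rule: eg_ins.induct)
  case (new x)
  then show ?case by (auto elim: eg_ins.cases)
next
  case (app R x P)
  from app.prems(1) show ?case using app.prems by (cases rule: eg_ins.cases) auto
next
  case (bump R x y R' P P' r)
  from bump.prems(1) show ?case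
  proof (cases rule: eg_ins.cases)
    case (bump S w Q2)
    have "P = Q2 \<and> y = w" using bump bump.IH[of Q2 w] \<open>eg_tab (R # P)\<close> \<open>eg_tab Q\<close> by auto
    then show ?thesis using rowbump_inj[OF \<open>rowbump R x y R'\<close>, of S z] bump \<open>eg_tab (R # P)\<close> \<open>eg_tab Q\<close> by auto
  qed
qed

lemma eg_ins_shape: "eg_ins P x P' r \<Longrightarrow> shape P' = (shape P)(r := Suc (shape P r))"
proof (induction rule: eg_ins.induct)
  case (bump R x y R' P P' r)
  have "shape (S # Q) i = (case i of 0 \<Rightarrow> length S | Suc i \<Rightarrow> shape Q i)" for S :: "int list" and Q i
    by (auto simp: shape_def split: nat.split)
  then show ?case using bump.IH rowbump_length[OF bump.hyps(1)] by (auto simp: fun_eq_iff split: nat.split)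
qed (auto simp: shape_def fun_eq_iff nth_Cons split: nat.split)

lemma eg_ins_hd_mem: "eg_ins P y P' r \<Longrightarrow> y \<in> set (hd P')"
  by (cases rule: eg_ins.cases) (auto dest: rowbump_mem)

text \<open>The last cell of row \<open>r\<close> is a removable corner, and a letter is passed
  upwards from it. Each reverse bump requires that \<open>y\<close> followed by the row is reduced,
  which holds because this is a factor of a word equivalent to the reading word and of the same
  length.\<close>

lemma eg_ins_rev_exists:
  assumes "eg_tab T" "set (reading T) \<subseteq> {1..int n}" "is_reduced n (reading T)" "r < length T" "shape T (Suc r) < shape T r"
  shows "\<exists>P x. eg_ins P x T r \<and> eg_tab P \<and> set (reading P @ [x]) \<subseteq> {1..int n}"
  using assms
proof (induction T arbitrary: r)
  case Nil
  then show ?case by simp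
next
  case (Cons R' T)
  have s: "sorted_wrt (<) R'" "R' \<noteq> []" "eg_tab T" using Cons.prems by auto
  show ?case
  proof (cases r)
    case 0
    define R where "R = butlast R'"
    define x where "x = last R'"
    have R': "R' = R @ [x]" using s by (simp add: R_def x_def)
    have lt: "\<forall>a\<in>set R. a < x" "sorted_wrt (<) R" using s(1) unfolding R' by (auto simp: sorted_wrt_append)
    have sh: "shape (R' # T) (Suc 0) = (if T = [] then 0 else length (hd T))"
      by (cases T) (auto simp: shape_def)
    show ?thesis
    proof (cases "R = []")
      case True
      then have "T = []" using Cons.prems(1,5) 0 sh R' by (cases T) (auto simp: shape_def)
      then have "eg_ins [] x (R' # T) r" using R' True 0 eg_ins.new by simp
      then show ?thesis using Cons.prems R' by (intro exI[of _ "[]"] exI[of _ x]) auto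
    next
      case False
      have "eg_ins (R # T) x (R' # T) r" using eg_ins.app[OF lt(1)] R' 0 by simp
      moreover have "dominates R (hd T)" if "T \<noteq> []"
        using Cons.prems(1,5) sh that R' 0 by (auto simp: dominates_def nth_append shape_def split: if_splits)
      then have "eg_tab (R # T)" using False lt s by simp
      moreover have "set (reading (R # T) @ [x]) \<subseteq> {1..int n}" using Cons.prems R' by auto
      ultimately show ?thesis by blast
    qed
  next
    case (Suc r')
    have l: "set (reading T) \<subseteq> {1..int n}" using Cons.prems by simp
    have rT: "is_reduced n (reading T)" using is_reduced_factor[of n "[]" "reading T" R'] Cons.prems by simp
    have "r' < length T" "shape T (Suc r') < shape T r'" using Cons.prems Suc by (auto simp: shape_def split: if_splits)
    then obtain P y where P: "eg_ins P y T r'" "eg_tab P" "set (reading P @ [y]) \<subseteq> {1..int n}"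
      using Cons.IH[OF s(3) l rT] by blast
    note w = eg_ins_word[OF P]
    have e: "word_eq n (reading T @ R') ((reading P @ [y]) @ R')"
      by (rule word_eq_append[OF word_eq.sym word_eq.refl]) (use w in simp)
    have rTR: "is_reduced n (reading T @ R')" using Cons.prems(3) by simp
    have "set ((reading P @ [y]) @ R') \<subseteq> {- int n..int n}"
      by (rule letters_subset) (use P(3) Cons.prems in auto)
    then have "is_reduced n ((reading P @ [y]) @ R')" by (rule is_reduced_transfer[OF rTR e]) (use w in simp)
    then have r: "is_reduced n (y # R')" using is_reduced_factor[of n "reading P" "y # R'" "[]"] by simp
    have ly: "set (y # R') \<subseteq> {1..int n}" using P(3) Cons.prems by auto
    have T: "T \<noteq> []" by (rule eg_ins_nonempty[OF P(1)])
    then have ab: "dominates R' (hd T)" using Cons.prems(1) by simp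
    \<comment> \<open>The pushed letter \<open>y\<close> lies in the first row of \<open>T\<close>;
      by dominance the cell above it holds a smaller entry, as reverse bumping requires.\<close>
    obtain k where k: "k < length (hd T)" "hd T ! k = y" using eg_ins_hd_mem[OF P(1)] by (auto simp: in_set_conv_nth)
    then have "R' ! k < y" "R' ! k \<in> set R'" using ab by (auto simp: dominates_def)
    then obtain R x where b: "rowbump R x y R'" "sorted_wrt (<) R"
      using rowbump_rev_exists[OF s(1) r ly] by blast
    have "eg_ins (R # P) x (R' # T) r" unfolding Suc by (rule eg_ins.bump[OF b(1) P(1)])
    moreover have "dominates R (hd P)" if "P \<noteq> []"
      using P(1)
    proof (cases rule: eg_ins.cases)
      case new
      then show ?thesis using that by simp
    next
      case (app S Q)
      then show ?thesis
        using dominates_unbump(1)[OF _ b(1), of "S @ [y]" S] ab b(2) P(2) s(3) by auto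
    next
      case (bump S z S' Q Q' r2)
      then show ?thesis
        using dominates_unbump(2)[OF _ b(1), of S' S z] ab b(2) P(2) s(3) by auto
    qed
    moreover have "R \<noteq> []" using rowbump_length[OF b(1)] s by auto
    ultimately have "eg_ins (R # P) x (R' # T) r \<and> eg_tab (R # P)" using P(2) b(2) by simp
    moreover have "set (reading (R # P) @ [x]) \<subseteq> {1..int n}"
      using P(3) rowbump_set[OF b(1)] rowbump_mem[OF b(1)] ly by auto
    ultimately show ?thesis by blast
  qed
qed

section \<open>Comparison of successive insertions\<close>

text \<open>After the first bump \<open>x\<close> stands in column \<open>j\<close> of
  \<open>R'\<close>. For \<open>x < x'\<close> the second bump happens to the right of it, where
  entries exceed \<open>y\<close> unless \<open>y = x + 1\<close> stayed in the row, and then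
  \<open>x < x' < y'\<close> still forces \<open>y < y'\<close>. For \<open>x' < x\<close> it
  happens in column \<open>j\<close> or to the left, so \<open>y' \<le> x < y\<close>.\<close>

lemma rowbump_order:
  assumes b: "rowbump R x y R'" "rowbump R' x' y' R''" and s: "sorted_wrt (<) R"
  shows "x < x' \<Longrightarrow> y < y'" "x' < x \<Longrightarrow> y' < y"
proof -
  have s': "sorted_wrt (<) R'" by (rule rowbump_sorted[OF b(1) s])
  have mono: "i < k" if "R' ! i < R' ! k" "i < length R'" "k < length R'" for i k
    using that sorted_nth[OF s', of k i] by (metis less_asym less_irrefl linorder_neqE_nat)
  have mono_le: "R' ! i \<le> R' ! k" if "i \<le> k" "k < length R'" for i k
    using that sorted_nth[OF s', of i k] by (cases "i = k") auto
  obtain k where k: "k < length R'" "R' ! k = y'" "x' < y'" "\<And>i. i < k \<Longrightarrow> R' ! i \<le> x'"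
    using b(2) unfolding rowbump_def
  proof (elim disjE exE conjE)
    fix k assume "k < length R'" "R' ! k = y'" "x' < y'" "\<forall>i<k. R' ! i < x'"
    then show thesis using that[of k] by (simp add: less_imp_le)
  next
    fix k assume a: "Suc k < length R'" "R' ! k = x'" "R' ! Suc k = y'" "y' = x' + 1"
    then show thesis using that[of "Suc k"] mono_le[of _ k] by auto
  qed
  obtain j where j: "j < length R'" "R' ! j = x" "\<And>i. j < i \<Longrightarrow> i < length R' \<Longrightarrow> x + 1 \<le> R' ! i"
    "\<And>i. j < i \<Longrightarrow> i < length R' \<Longrightarrow> y < R' ! i \<or> (R' ! i = y \<and> y = x + 1)"
    using b(1) unfolding rowbump_def
  proof (elim disjE exE conjE)
    fix j assume a: "j < length R" "R ! j = y" "R' = R[j := x]" "x < y" "\<forall>i<j. R ! i < x"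
    have "y < R' ! i" if "j < i" "i < length R'" for i
      using a sorted_nth[OF s, of j i] that by simp
    then show thesis using that[of j] a by fastforce
  next
    fix j assume a: "Suc j < length R" "R ! j = x" "R ! Suc j = y" "y = x + 1" "R' = R"
    have "y \<le> R' ! i" if "j < i" "i < length R'" for i
      using a mono_le[of "Suc j" i] that by simp
    then show thesis using that[of j] a by fastforce
  qed
  {
    assume "x < x'"
    then have "j < k" using mono[of j k] j k by simp
    then show "y < y'" using j(4)[of k] k \<open>x < x'\<close> by auto
  }
  {
    assume "x' < x"
    then have "\<not> j < k" using k(4)[of j] j by force
    then have "y' \<le> x" using mono_le[of k j] j k by simp
    then show "y' < y" using rowbump_less[OF b(1)] by simp
  }
qed

text \<open>The comparison of the two letters persists from row to row, so the second bumping path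
  stays on one side of the first. This is what turns increasing blocks into horizontal strips and
  decreasing blocks into vertical ones.\<close>

lemma eg_ins_order:
  assumes "eg_ins P x P' r" "eg_ins P' x' P'' r'" "eg_tab P"
  shows "(x < x' \<longrightarrow> r' \<le> r) \<and> (x' < x \<longrightarrow> r < r')"
  using assms
proof (induction arbitrary: x' P'' r' rule: eg_ins.induct)
  case (new x)
  from new.prems(1) show ?case
  proof (cases rule: eg_ins.cases)
    case (bump y R' Q r)
    then have "x' < x" using rowbump_less[OF bump(3)] rowbump_mem[OF bump(3)] by auto
    then show ?thesis using bump by simp
  qed auto
next
  case (app R x P)
  from app.prems(1) show ?case
  proof (cases rule: eg_ins.cases)
    case (bump y R' Q r)
    have "x' < y" "y \<in> set (R @ [x])" using rowbump_less[OF bump(3)] rowbump_mem[OF bump(3)] by auto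
    then have "x' < x" using app.hyps by auto
    then show ?thesis using bump by simp
  qed auto
next
  case (bump R x y R' P P' r)
  from bump.prems(1) show ?case
  proof (cases rule: eg_ins.cases)
    case app
    then have "x < x'" using rowbump_mem[OF bump.hyps(1)] by auto
    then show ?thesis using app by simp
  next
    case (bump y' S Q r2)
    have "(y < y' \<longrightarrow> r2 \<le> r) \<and> (y' < y \<longrightarrow> r < r2)" using bump.IH[OF bump(4)] \<open>eg_tab (R # P)\<close> by simp
    then show ?thesis
      using rowbump_order[OF \<open>rowbump R x y R'\<close> bump(3)] \<open>eg_tab (R # P)\<close> bump by auto
  qed
qed

subsection \<open>Words as paths of shapes\<close>

lemma eg_tab_nth_iff:
  "eg_tab T \<longleftrightarrow> (\<forall>r<length T. T ! r \<noteq> [] \<and> sorted_wrt (<) (T ! r)) \<and>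
     (\<forall>r. Suc r < length T \<longrightarrow> dominates (T ! r) (T ! Suc r))"
proof (induction T)
  case (Cons R T)
  have 1: "(\<forall>r<length (R # T). P ((R # T) ! r)) \<longleftrightarrow> P R \<and> (\<forall>r<length T. P (T ! r))" for P
    by (auto simp: nth_Cons less_Suc_eq_0_disj)
  have 2: "(\<forall>r. Suc r < length (R # T) \<longrightarrow> dominates ((R # T) ! r) ((R # T) ! Suc r)) \<longleftrightarrow>
    (T \<noteq> [] \<longrightarrow> dominates R (hd T)) \<and> (\<forall>r. Suc r < length T \<longrightarrow> dominates (T ! r) (T ! Suc r))"
  proof -
    have "(\<forall>r. Q r) \<longleftrightarrow> Q 0 \<and> (\<forall>r. Q (Suc r))" for Q :: "nat \<Rightarrow> bool" by (metis not0_implies_Suc)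
    from this[of "\<lambda>r. Suc r < length (R # T) \<longrightarrow> dominates ((R # T) ! r) ((R # T) ! Suc r)"]
    show ?thesis by (cases T) auto
  qed
  show ?case
    unfolding 2 1[of "\<lambda>x. x \<noteq> [] \<and> sorted_wrt (<) x"] using Cons.IH by auto
qed simp

lemma eg_tab_iff:
  "eg_tab T \<longleftrightarrow> young T \<and> (\<forall>row\<in>set T. sorted_wrt (<) row) \<and> (\<forall>col\<in>set (transpose T). sorted_wrt (<) col)"
proof
  assume e: "eg_tab T"
  have ab: "dominates (T ! r) (T ! Suc r)" if "Suc r < length T" for r
    using e that eg_tab_nth_iff by blast
  have "sorted_wrt (\<ge>) (map length T)"
    unfolding sorted_wrt_iff_nth_Suc_transp[OF transp_on_ge]
    using ab by (auto simp: dominates_def)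
  then have y: "young T" using e unfolding young_def eg_tab_nth_iff by (auto simp: in_set_conv_nth)
  have "T ! r ! c < T ! s ! c" if "r < s" "s < length T" "c < length (T ! s)" for r s c
    using that
  proof (induction s)
    case (Suc s)
    have a: "c < length (T ! s)" "T ! s ! c < T ! Suc s ! c"
      using ab[of s] Suc.prems by (auto simp: dominates_def)
    then show ?case using Suc.IH Suc.prems by (cases "r = s") auto
  qed simp
  then show "young T \<and> (\<forall>row\<in>set T. sorted_wrt (<) row) \<and> (\<forall>col\<in>set (transpose T). sorted_wrt (<) col)"
    using y e unfolding col_sorted_iff[OF y] by (auto simp: eg_tab_nth_iff in_set_conv_nth)
next
  assume T: "young T \<and> (\<forall>row\<in>set T. sorted_wrt (<) row) \<and> (\<forall>col\<in>set (transpose T). sorted_wrt (<) col)"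
  then have y: "young T" by blast
  have c: "\<forall>r s c. r < s \<longrightarrow> s < length T \<longrightarrow> c < length (T ! s) \<longrightarrow> T ! r ! c < T ! s ! c"
    using T unfolding col_sorted_iff[OF y] by blast
  have "length (T ! Suc r) \<le> length (T ! r)" if "Suc r < length T" for r
    using young_shape_mono[OF y, of r "Suc r"] that by (simp add: shape_def)
  then show "eg_tab T"
    unfolding eg_tab_nth_iff using T c young_row[OF y] by (auto simp: dominates_def)
qed

lemma eg_tab_young: "eg_tab T \<Longrightarrow> young T"
  by (simp add: eg_tab_iff)

section \<open>Filling a strip box by box\<close>

text \<open>The list encodes a standard filling of the skew shape from \<open>\<mu>\<close> to
  \<open>\<theta>\<close>: its members are the rows that receive the successive boxes.\<close>

fun addrows :: "(nat \<Rightarrow> nat) \<Rightarrow> nat list \<Rightarrow> (nat \<Rightarrow> nat) \<Rightarrow> bool" where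
  "addrows \<mu> [] \<theta> = (\<mu> = \<theta>)"
| "addrows \<mu> (r # rs) \<theta> = (part (\<mu>(r := Suc (\<mu> r))) \<and> addrows (\<mu>(r := Suc (\<mu> r))) rs \<theta>)"

lemma addrows_snoc:
  "addrows \<mu> (rs @ [r]) \<theta> \<longleftrightarrow> (\<exists>\<nu>. addrows \<mu> rs \<nu> \<and> \<theta> = \<nu>(r := Suc (\<nu> r)) \<and> part \<theta>)"
  by (induction rs arbitrary: \<mu>) auto

lemma addrows_part: "addrows \<mu> rs \<theta> \<Longrightarrow> part \<mu> \<Longrightarrow> part \<theta>"
  by (induction rs arbitrary: \<mu>) auto

lemma addrows_count: "addrows \<mu> rs \<theta> \<Longrightarrow> \<theta> r = \<mu> r + count_list rs r"
  by (induction rs arbitrary: \<mu>) (auto split: if_splits)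

lemma psize_add_box:
  assumes "part \<mu>" shows "psize (\<mu>(r := Suc (\<mu> r))) = Suc (psize \<mu>)"
proof -
  obtain N0 where N0: "\<And>s. s \<ge> N0 \<Longrightarrow> \<mu> s = 0" using part_bound[OF assms] by blast
  define N where "N = max N0 (Suc r)"
  have "psize (\<mu>(r := Suc (\<mu> r))) = psum (\<mu>(r := Suc (\<mu> r))) N"
    by (rule psize_psum) (auto simp: N_def N0)
  also have "\<dots> = Suc (\<mu> r) + (\<Sum>s\<in>{..<N} - {r}. \<mu> s)"
    by (subst sum.remove[of _ r]) (auto simp: N_def intro!: sum.cong)
  also have "\<dots> = Suc (psum \<mu> N)"
    by (subst (2) sum.remove[of _ r]) (auto simp: N_def)
  also have "psum \<mu> N = psize \<mu>" by (rule psize_psum[symmetric]) (auto simp: N_def N0)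
  finally show ?thesis .
qed

lemma addrows_psize: "addrows \<mu> rs \<theta> \<Longrightarrow> part \<mu> \<Longrightarrow> psize \<theta> = psize \<mu> + length rs"
  by (induction rs arbitrary: \<mu>) (auto simp: psize_add_box)

text \<open>The canonical order of filling: a vertical strip from the top down with one box per row,
  a horizontal strip from its lowest row up, that is, from left to right.\<close>

definition rows_mono :: "bool \<Rightarrow> nat list \<Rightarrow> bool" where
  "rows_mono v rs \<longleftrightarrow> (if v then sorted_wrt (<) rs else sorted_wrt (\<ge>) rs)"

text \<open>In the horizontal case no later box falls into row \<open>Suc r\<close>, so this row
  keeps its old length and still fits under the old row \<open>r\<close>; in the vertical case row
  \<open>r\<close> receives no further box.\<close>

lemma addrows_strip:
  assumes "part \<mu>" "rows_mono v rs" "addrows \<mu> rs \<theta>" shows "strip v \<mu> \<theta>"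
  using assms
proof (induction rs arbitrary: \<mu>)
  case Nil
  then show ?case by (auto simp: strip_def hstrip_def vstrip_def intro: partD)
next
  case (Cons r rs)
  let ?\<nu> = "\<mu>(r := Suc (\<mu> r))"
  have s: "strip v ?\<nu> \<theta>" using Cons by (auto simp: rows_mono_def split: if_splits)
  have "addrows ?\<nu> rs \<theta>" using Cons.prems(3) by simp
  then have c: "\<theta> i = ?\<nu> i + count_list rs i" for i by (rule addrows_count)
  show ?case
  proof (cases v)
    case True
    then have "count_list rs r = 0" using Cons.prems(2) by (auto simp: rows_mono_def count_list_0_iff)
    then have "\<theta> r = Suc (\<mu> r)" using c[of r] by simp
    moreover have "\<mu> i \<le> \<theta> i \<and> \<theta> i \<le> Suc (\<mu> i)" if "i \<noteq> r" for i
      using s True that by (auto simp: strip_def vstrip_def dest!: spec[of _ i])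
    ultimately have "\<mu> i \<le> \<theta> i \<and> \<theta> i \<le> Suc (\<mu> i)" for i by (cases "i = r") auto
    then show ?thesis using True by (simp add: strip_def vstrip_def)
  next
    case False
    then have "count_list rs (Suc r) = 0"
      using Cons.prems(2) by (fastforce simp: rows_mono_def count_list_0_iff)
    then have "\<theta> (Suc r) \<le> \<mu> r" using c[of "Suc r"] partD[OF Cons.prems(1), of r "Suc r"] by simp
    moreover have "\<theta> (Suc i) \<le> \<mu> i" if "i \<noteq> r" for i
      using s False that by (auto simp: strip_def hstrip_def dest!: spec[of _ i])
    ultimately have "\<theta> (Suc i) \<le> \<mu> i" for i by (cases "i = r") auto
    moreover have "\<mu> i \<le> \<theta> i" for i using c[of i] by (auto split: if_splits)
    ultimately show ?thesis using False by (simp add: strip_def hstrip_def)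
  qed
qed

text \<open>The first box is taken from the topmost row of a vertical strip and from the lowest row
  of a horizontal one; in both cases the row above is already long enough to carry it.\<close>

lemma addrows_exists:
  assumes "part \<mu>" "part \<theta>" "strip v \<mu> \<theta>" shows "\<exists>rs. rows_mono v rs \<and> addrows \<mu> rs \<theta>"
  using assms
proof (induction "psize \<theta> - psize \<mu>" arbitrary: \<mu> rule: less_induct)
  case less
  note le = strip_le[OF less.prems(3)]
  let ?D = "{r. \<mu> r < \<theta> r}"
  show ?case
  proof (cases "?D = {}")
    case True
    then have "\<not> \<mu> r < \<theta> r" for r by blast
    then have "\<mu> r = \<theta> r" for r using le[of r] by (simp add: le_less)
    then have "\<mu> = \<theta>" by blast
    then show ?thesis by (intro exI[of _ "[]"]) (simp add: rows_mono_def)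
  next
    case False
    have "?D \<subseteq> {r. 0 < \<theta> r}" by auto
    then have fin: "finite ?D" using part_finite[OF less.prems(2)] finite_subset by blast
    define r where "r = (if v then Min ?D else Max ?D)"
    have r: "\<mu> r < \<theta> r" using Min_in[OF fin False] Max_in[OF fin False] by (auto simp: r_def)
    have rmin: "r \<le> s" if "v" "\<mu> s < \<theta> s" for s using Min_le[OF fin, of s] that by (simp add: r_def)
    have rmax: "s \<le> r" if "\<not> v" "\<mu> s < \<theta> s" for s using Max_ge[OF fin, of s] that by (simp add: r_def)
    let ?\<nu> = "\<mu>(r := Suc (\<mu> r))"
    have up: "Suc (\<mu> r) \<le> \<mu> i" if "r = Suc i" for i
    proof (cases v)
      case True
      have "\<not> \<mu> i < \<theta> i" using rmin[OF True, of i] that by auto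
      then have "\<theta> i \<le> \<mu> i" by simp
      moreover have "\<theta> r \<le> \<theta> i" using partD[OF less.prems(2), of i r] that by simp
      ultimately show ?thesis using r by simp
    next
      case F: False
      have "\<theta> r \<le> \<mu> i" using less.prems(3) F that by (simp add: strip_def hstrip_def)
      then show ?thesis using r by simp
    qed
    have "?\<nu> (Suc i) \<le> ?\<nu> i" for i
      using up[of i] partD[OF less.prems(1), of i "Suc i"] by auto
    moreover have "\<exists>N. \<forall>s\<ge>N. ?\<nu> s = 0"
    proof -
      obtain N where "\<And>s. s \<ge> N \<Longrightarrow> \<mu> s = 0" using part_bound[OF less.prems(1)] by blast
      then show ?thesis by (intro exI[of _ "max N (Suc r)"]) auto
    qed
    ultimately have pn: "part ?\<nu>" by (simp add: part_def antimono_iff_le_Suc)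
    have strip: "strip v ?\<nu> \<theta>"
    proof (cases v)
      case True
      then show ?thesis using less.prems(3) r by (auto simp: strip_def vstrip_def le_SucI)
    next
      case F: False
      then show ?thesis using less.prems(3) r by (auto simp: strip_def hstrip_def le_SucI)
    qed
    have "psize ?\<nu> \<le> psize \<theta>" by (rule psize_mono[OF less.prems(2) strip_le[OF strip]])
    then have "psize \<theta> - psize ?\<nu> < psize \<theta> - psize \<mu>"
      using psize_add_box[OF less.prems(1), of r] by simp
    then obtain rs where rs: "rows_mono v rs" "addrows ?\<nu> rs \<theta>"
      using less.hyps[OF _ pn less.prems(2) strip] by blast
    have mem: "\<mu> s < \<theta> s \<and> (v \<longrightarrow> s \<noteq> r)" if s: "s \<in> set rs" for s
    proof -
      have "count_list rs s \<noteq> 0" using s by (simp add: count_list_0_iff)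
      then have lt: "?\<nu> s < \<theta> s" using addrows_count[OF rs(2), of s] by simp
      then have "\<mu> s < \<theta> s" by (auto split: if_splits)
      moreover have "s \<noteq> r" if v
      proof
        assume "s = r"
        then have "Suc (\<mu> r) < \<theta> r" using lt by simp
        moreover have "\<theta> r \<le> Suc (\<mu> r)" using less.prems(3) that by (simp add: strip_def vstrip_def)
        ultimately show False by simp
      qed
      ultimately show ?thesis by blast
    qed
    have "rows_mono v (r # rs)"
    proof (cases v)
      case True
      have "r < s" if "s \<in> set rs" for s using mem[OF that] rmin[OF True, of s] True by auto
      then show ?thesis using True rs(1) by (simp add: rows_mono_def)
    next
      case F: False
      have "s \<le> r" if "s \<in> set rs" for s using mem[OF that] rmax[OF F, of s] by auto
      then show ?thesis using F rs(1) by (simp add: rows_mono_def)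
    qed
    then show ?thesis using rs(2) pn by (intro exI[of _ "r # rs"]) simp
  qed
qed

lemma sorted_wrt_count_unique:
  assumes "\<And>x y. Q x y \<Longrightarrow> Q y x \<Longrightarrow> x = y" "sorted_wrt Q xs" "sorted_wrt Q ys"
    and "\<And>x. count_list xs x = count_list ys x"
  shows "xs = ys"
  using assms(2-4)
proof (induction xs arbitrary: ys)
  case Nil
  show ?case
  proof (cases ys)
    case (Cons y ys')
    then show ?thesis using Nil.prems(3)[of y] by simp
  qed simp
next
  case (Cons x xs)
  have "count_list ys x \<noteq> 0" using Cons.prems(3)[of x] by simp
  then have "x \<in> set ys" by (simp add: count_list_0_iff)
  then obtain y ys' where ys: "ys = y # ys'" by (cases ys) auto
  have "count_list (x # xs) y \<noteq> 0" unfolding Cons.prems(3)[of y] ys by simp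
  then have "y \<in> set (x # xs)" by (metis count_list_0_iff)
  then have "x = y" using \<open>x \<in> set ys\<close> ys Cons.prems(1,2) assms(1) by auto
  then have "count_list xs z = count_list ys' z" for z
    using Cons.prems(3)[of z] ys by (simp split: if_splits)
  then have "xs = ys'" using Cons.IH Cons.prems(1,2) ys by simp
  then show ?case using ys \<open>x = y\<close> by simp
qed

lemma addrows_unique:
  assumes "rows_mono v rs" "rows_mono v rs'" "addrows \<mu> rs \<theta>" "addrows \<mu> rs' \<theta>" shows "rs = rs'"
proof -
  have "count_list rs x = count_list rs' x" for x
    using addrows_count[OF assms(3), of x] addrows_count[OF assms(4), of x] by simp
  then show ?thesis
    using assms(1,2) sorted_wrt_count_unique[of "(<)" rs rs'] sorted_wrt_count_unique[of "(\<ge>)" rs rs']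
    by (auto simp: rows_mono_def split: if_splits)
qed

section \<open>Insertion of words\<close>

fun inserts :: "int list list \<Rightarrow> int list \<Rightarrow> nat list \<Rightarrow> int list list \<Rightarrow> bool" where
  "inserts P [] rs T = (rs = [] \<and> P = T)"
| "inserts P (x # w) rs T = (\<exists>r rs' P'. rs = r # rs' \<and> eg_ins P x P' r \<and> inserts P' w rs' T)"

lemma inserts_append:
  "inserts P (w @ w') rs T \<longleftrightarrow> (\<exists>rs1 rs2 Q. rs = rs1 @ rs2 \<and> inserts P w rs1 Q \<and> inserts Q w' rs2 T)"
proof (induction w arbitrary: P rs)
  case (Cons x w)
  show ?case
  proof
    assume "inserts P ((x # w) @ w') rs T"
    then obtain r rs' P' where r: "rs = r # rs'" "eg_ins P x P' r" "inserts P' (w @ w') rs' T" by auto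
    then obtain rs1 rs2 Q where "rs' = rs1 @ rs2" "inserts P' w rs1 Q" "inserts Q w' rs2 T" using Cons.IH by blast
    then show "\<exists>rs1 rs2 Q. rs = rs1 @ rs2 \<and> inserts P (x # w) rs1 Q \<and> inserts Q w' rs2 T"
      using r by (intro exI[of _ "r # rs1"] exI[of _ rs2] exI[of _ Q]) auto
  next
    assume "\<exists>rs1 rs2 Q. rs = rs1 @ rs2 \<and> inserts P (x # w) rs1 Q \<and> inserts Q w' rs2 T"
    then show "inserts P ((x # w) @ w') rs T" using Cons.IH by fastforce
  qed
qed auto

lemma inserts_length: "inserts P w rs T \<Longrightarrow> length rs = length w"
  by (induction w arbitrary: P rs) auto

lemma inserts_snoc:
  "inserts P w (rs @ [r]) T \<longleftrightarrow> (\<exists>w' x Q. w = w' @ [x] \<and> inserts P w' rs Q \<and> eg_ins Q x T r)"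
proof
  assume a: "inserts P w (rs @ [r]) T"
  then obtain w' x where w: "w = w' @ [x]" using inserts_length[OF a] by (cases w rule: rev_cases) auto
  have "\<exists>rs1 rs2 Q. rs @ [r] = rs1 @ rs2 \<and> inserts P w' rs1 Q \<and> inserts Q [x] rs2 T"
    using a unfolding w inserts_append .
  then obtain rs1 rs2 Q where "rs @ [r] = rs1 @ rs2" "inserts P w' rs1 Q" "inserts Q [x] rs2 T" by blast
  then show "\<exists>w' x Q. w = w' @ [x] \<and> inserts P w' rs Q \<and> eg_ins Q x T r" using w by auto
next
  assume "\<exists>w' x Q. w = w' @ [x] \<and> inserts P w' rs Q \<and> eg_ins Q x T r"
  then obtain w' x Q where w: "w = w' @ [x]" "inserts P w' rs Q" "eg_ins Q x T r" by blast
  then have "inserts Q [x] [r] T" by simp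
  then show "inserts P w (rs @ [r]) T" unfolding w(1) inserts_append using w(2) by blast
qed

lemma inserts_preserves_eg_tab: "inserts P w rs T \<Longrightarrow> eg_tab P \<Longrightarrow> eg_tab T"
  by (induction w arbitrary: P rs) (auto intro: eg_ins_preserves_eg_tab)

lemma inserts_word:
  assumes "inserts P w rs T" "eg_tab P" "set (reading P @ w) \<subseteq> {1..int n}"
  shows "word_eq n (reading P @ w) (reading T) \<and> length (reading T) = length (reading P @ w) \<and> set (reading T) \<subseteq> {1..int n}"
  using assms
proof (induction w arbitrary: P rs)
  case Nil
  then show ?case by (auto simp: word_eq.refl)
next
  case (Cons x w)
  obtain r rs' P' where r: "rs = r # rs'" "eg_ins P x P' r" "inserts P' w rs' T" using Cons.prems by auto
  have l: "set (reading P @ [x]) \<subseteq> {1..int n}" using Cons.prems by auto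
  note P' = eg_ins_word[OF r(2) Cons.prems(2) l]
  have IH: "word_eq n (reading P' @ w) (reading T) \<and> length (reading T) = length (reading P' @ w) \<and> set (reading T) \<subseteq> {1..int n}"
    by (rule Cons.IH[OF r(3) eg_ins_preserves_eg_tab[OF r(2) Cons.prems(2)]]) (use P' Cons.prems in auto)
  have "word_eq n ((reading P @ [x]) @ w) (reading P' @ w)" using P' by (intro word_eq_append word_eq.refl) simp
  then have "word_eq n ((reading P @ [x]) @ w) (reading T)" using IH word_eq.trans by blast
  then show ?case using IH P' by simp
qed

lemma is_reduced_eg_ins_step:
  assumes "eg_ins P x P' r" "eg_tab P" "set (reading P @ x # w) \<subseteq> {1..int n}" "is_reduced n (reading P @ x # w)"
  shows "is_reduced n (reading P' @ w)" "set (reading P' @ w) \<subseteq> {1..int n}"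
proof -
  have l: "set (reading P @ [x]) \<subseteq> {1..int n}" using assms by auto
  note P' = eg_ins_word[OF assms(1,2) l]
  show s: "set (reading P' @ w) \<subseteq> {1..int n}" using P' assms(3) by auto
  have e: "word_eq n (reading P @ x # w) (reading P' @ w)"
    using word_eq_append[of n "reading P @ [x]" "reading P'" w w] P' word_eq.refl by simp
  show "is_reduced n (reading P' @ w)"
    by (rule is_reduced_transfer[OF assms(4) e letters_subset[OF s]]) (use P' in simp)
qed

lemma inserts_exists:
  assumes "eg_tab P" "set (reading P @ w) \<subseteq> {1..int n}" "is_reduced n (reading P @ w)"
  shows "\<exists>rs T. inserts P w rs T"
  using assms
proof (induction w arbitrary: P)
  case Nil
  show ?case by (intro exI[of _ "[]"] exI[of _ P]) simp
next
  case (Cons x w)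
  have l: "set (reading P @ [x]) \<subseteq> {1..int n}" using Cons.prems by auto
  have "is_reduced n (reading P @ [x])" using is_reduced_factor[of n "[]" "reading P @ [x]" w] Cons.prems by simp
  then obtain P' r where i: "eg_ins P x P' r" using eg_ins_exists[OF Cons.prems(1) l] by blast
  then show ?case
    using Cons.IH[OF eg_ins_preserves_eg_tab[OF i Cons.prems(1)]] is_reduced_eg_ins_step[OF i Cons.prems] by fastforce
qed

lemma inserts_det:
  assumes "inserts P w rs T" "inserts P w rs' T'" "eg_tab P" shows "rs = rs' \<and> T = T'"
  using assms
proof (induction w arbitrary: P rs rs')
  case (Cons x w)
  obtain r rs1 P1 where 1: "rs = r # rs1" "eg_ins P x P1 r" "inserts P1 w rs1 T" using Cons.prems by auto
  obtain r' rs2 P2 where 2: "rs' = r' # rs2" "eg_ins P x P2 r'" "inserts P2 w rs2 T'" using Cons.prems by auto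
  have "P1 = P2 \<and> r = r'" by (rule eg_ins_det[OF 1(2) 2(2) Cons.prems(3)])
  then show ?case using Cons.IH[of P1 rs1 rs2] 1 2 eg_ins_preserves_eg_tab[OF 1(2) Cons.prems(3)] by simp
qed auto

lemma inserts_inj:
  assumes "inserts P w rs T" "inserts P' w' rs T" "eg_tab P" "eg_tab P'" shows "P = P' \<and> w = w'"
  using assms
proof (induction rs arbitrary: w w' T rule: rev_induct)
  case Nil
  then show ?case using inserts_length[OF Nil.prems(1)] inserts_length[OF Nil.prems(2)] by simp
next
  case (snoc r rs)
  obtain v x Q where 1: "w = v @ [x]" "inserts P v rs Q" "eg_ins Q x T r" using snoc.prems inserts_snoc by blast
  obtain v' x' Q' where 2: "w' = v' @ [x']" "inserts P' v' rs Q'" "eg_ins Q' x' T r" using snoc.prems inserts_snoc by blast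
  have "Q = Q' \<and> x = x'"
    by (rule eg_ins_inj[OF 1(3) 2(3)]) (use inserts_preserves_eg_tab 1 2 snoc.prems in blast)+
  then show ?case using snoc.IH[of v Q v'] 1 2 snoc.prems by simp
qed

lemma inserts_addrows:
  assumes "inserts P w rs T" "eg_tab P" shows "addrows (shape P) rs (shape T)"
  using assms
proof (induction w arbitrary: P rs)
  case (Cons x w)
  obtain r rs' P' where r: "rs = r # rs'" "eg_ins P x P' r" "inserts P' w rs' T" using Cons.prems by auto
  have e: "eg_tab P'" by (rule eg_ins_preserves_eg_tab[OF r(2) Cons.prems(2)])
  show ?case
    unfolding r(1) addrows.simps eg_ins_shape[OF r(2), symmetric]
    using part_shape[OF eg_tab_young[OF e]] Cons.IH[OF r(3) e] by blast
qed auto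

lemma inserts_rev_exists:
  assumes "eg_tab T" "set (reading T) \<subseteq> {1..int n}" "is_reduced n (reading T)" "part \<mu>" "addrows \<mu> rs (shape T)"
  shows "\<exists>P w. inserts P w rs T \<and> eg_tab P \<and> set (reading P @ w) \<subseteq> {1..int n} \<and> shape P = \<mu>"
  using assms
proof (induction rs arbitrary: T rule: rev_induct)
  case Nil
  then show ?case by (intro exI[of _ T] exI[of _ "[]"]) auto
next
  case (snoc r rs)
  obtain \<nu> where \<nu>: "addrows \<mu> rs \<nu>" "shape T = \<nu>(r := Suc (\<nu> r))" "part \<nu>"
    using snoc.prems addrows_snoc addrows_part by metis
  have "r < length T" using fun_cong[OF \<nu>(2), of r] by (auto simp: shape_def split: if_splits)
  moreover have "shape T (Suc r) < shape T r" using partD[OF \<nu>(3), of r "Suc r"] by (simp add: \<nu>(2))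
  ultimately obtain Q x where Q: "eg_ins Q x T r" "eg_tab Q" "set (reading Q @ [x]) \<subseteq> {1..int n}"
    using eg_ins_rev_exists[OF snoc.prems(1-3)] by blast
  have "shape Q = \<nu>"
  proof
    fix i show "shape Q i = \<nu> i" using fun_cong[OF eg_ins_shape[OF Q(1)], of i] \<nu>(2) by (auto split: if_splits)
  qed
  note w = eg_ins_word[OF Q]
  have "is_reduced n (reading Q @ [x])"
    by (rule is_reduced_transfer[OF snoc.prems(3) word_eq.sym letters_subset]) (use w Q in auto)
  then have "is_reduced n (reading Q)" using is_reduced_factor[of n "[]" "reading Q" "[x]"] by simp
  then obtain P v where "inserts P v rs Q" "eg_tab P" "set (reading P @ v) \<subseteq> {1..int n}" "shape P = \<mu>"
    using snoc.IH[OF Q(2)] Q(3) snoc.prems(4) \<nu>(1) \<open>shape Q = \<nu>\<close> by auto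
  then show ?case using Q by (intro exI[of _ P] exI[of _ "v @ [x]"]) (auto simp: inserts_snoc)
qed

text \<open>\<open>v\<close> marks the blocks that stand for letters with a negative sign; without
  their signs these decrease.\<close>

definition block :: "bool \<Rightarrow> int list \<Rightarrow> bool" where
  "block v B \<longleftrightarrow> (if v then sorted_wrt (>) B else sorted_wrt (<) B)"

text \<open>Neighbouring letters differ because the word is reduced, so each neighbouring pair is an
  ascent or a descent and thereby decides how the rows of its two new cells compare. Transitivity
  extends this from neighbours to whole lists.\<close>

lemma inserts_block:
  assumes "inserts P w rs T" "eg_tab P" "set (reading P @ w) \<subseteq> {1..int n}" "is_reduced n (reading P @ w)"
  shows "block v w \<longleftrightarrow> rows_mono v rs"
  using assms
proof (induction w arbitrary: P rs)
  case Nil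
  then show ?case by (auto simp: block_def rows_mono_def)
next
  case (Cons x w)
  obtain r rs' P' where r: "rs = r # rs'" "eg_ins P x P' r" "inserts P' w rs' T" using Cons.prems by auto
  have e: "eg_tab P'" by (rule eg_ins_preserves_eg_tab[OF r(2) Cons.prems(2)])
  have IH: "block v w \<longleftrightarrow> rows_mono v rs'"
    by (rule Cons.IH[OF r(3) e]) (use is_reduced_eg_ins_step[OF r(2) Cons.prems(2-4)] in auto)
  show ?case
  proof (cases w)
    case Nil
    then show ?thesis using r by (auto simp: block_def rows_mono_def)
  next
    case (Cons x' w')
    obtain r' rs'' P'' where r': "rs' = r' # rs''" "eg_ins P' x' P'' r'" using r(3) Cons by auto
    have "x \<noteq> x'" using is_reduced_no_square[of n "reading P" x w'] Cons.prems(4) Cons by auto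
    then have 1: "x < x' \<longleftrightarrow> r' \<le> r" "x' < x \<longleftrightarrow> r < r'"
      using eg_ins_order[OF r(2) r'(2) \<open>eg_tab P\<close>] by auto
    have "transp ((<) :: int \<Rightarrow> int \<Rightarrow> bool)" "transp ((>) :: int \<Rightarrow> int \<Rightarrow> bool)"
      "transp ((<) :: nat \<Rightarrow> nat \<Rightarrow> bool)" "transp ((\<ge>) :: nat \<Rightarrow> nat \<Rightarrow> bool)"
      by (auto simp: transp_def)
    then show ?thesis
      using IH 1 unfolding r(1) r'(1) Cons block_def rows_mono_def by (auto simp: sorted_wrt2 simp del: sorted_wrt.simps)
  qed
qed

subsection \<open>Counting factorizations\<close>

lemma valid_prefix:
  assumes "inserts P B rs T" "valid n T" "eg_tab P" "set (reading P @ B) \<subseteq> {1..int n}"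
  shows "valid n P" "is_reduced n (reading P @ B)"
proof -
  note w = inserts_word[OF assms(1,3,4)]
  have T: "is_reduced n (reading T)" using assms(2) by (simp add: valid_def)
  have e: "word_eq n (reading T) (reading P @ B)" using w word_eq.sym by blast
  show r: "is_reduced n (reading P @ B)"
    by (rule is_reduced_transfer[OF T e letters_subset[OF assms(4)]]) (use w in simp)
  then show "valid n P" using is_reduced_factor[of n "[]" "reading P" B] assms by (simp add: valid_def)
qed

text \<open>A strip has only one canonical order of filling, and reverse insertion along it recovers
  the letters. So the last block and the tableau before it are determined by the shape of that
  tableau, and every shape that differs from \<open>shape T\<close> by a strip of the right kind and
  size occurs.\<close>

lemma block_bij:
  assumes T: "valid n T"
  shows "bij_betw (\<lambda>(P, B). shape P)
     {(P, B). valid n P \<and> set B \<subseteq> {1..int n} \<and> block v B \<and> length B = c \<and> (\<exists>rs. inserts P B rs T)}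
     {\<mu>. part \<mu> \<and> strip v \<mu> (shape T) \<and> psize (shape T) = psize \<mu> + c}" (is "bij_betw ?f ?N ?M")
proof -
  have T': "eg_tab T" "set (reading T) \<subseteq> {1..int n}" "is_reduced n (reading T)" using T by (auto simp: valid_def)
  have N: "\<exists>rs. inserts P B rs T \<and> rows_mono v rs \<and> addrows (shape P) rs (shape T) \<and> length rs = c \<and> eg_tab P \<and> part (shape P)"
    if PB: "(P, B) \<in> ?N" for P B
  proof -
    obtain rs where rs: "inserts P B rs T" using PB by blast
    have P: "eg_tab P" "set (reading P @ B) \<subseteq> {1..int n}" using PB by (auto simp: valid_def)
    have "rows_mono v rs"
      using inserts_block[OF rs P valid_prefix(2)[OF rs T P]] PB by blast
    then show ?thesis
      using rs inserts_addrows[OF rs P(1)] inserts_length[OF rs] PB P(1) part_shape[OF eg_tab_young[OF P(1)]] by auto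
  qed
  have inj: "inj_on ?f ?N"
  proof (rule inj_onI)
    fix z z' assume z: "z \<in> ?N" "z' \<in> ?N" "?f z = ?f z'"
    obtain P B P' B' where eq: "z = (P, B)" "z' = (P', B')" by (metis surj_pair)
    obtain rs where rs: "inserts P B rs T" "rows_mono v rs" "addrows (shape P) rs (shape T)" "eg_tab P"
      using N z eq by blast
    obtain rs' where rs': "inserts P' B' rs' T" "rows_mono v rs'" "addrows (shape P') rs' (shape T)" "eg_tab P'"
      using N z eq by blast
    have sh: "shape P = shape P'" using z eq by simp
    have "rs = rs'" by (rule addrows_unique[OF rs(2) rs'(2) rs(3)]) (use rs'(3) sh in simp)
    then show "z = z'" using inserts_inj[OF rs(1) _ rs(4) rs'(4)] rs'(1) eq by simp
  qed
  have "?f ` ?N = ?M"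
  proof (intro equalityI subsetI)
    fix \<mu> assume "\<mu> \<in> ?f ` ?N"
    then obtain P B where PB: "(P, B) \<in> ?N" "\<mu> = shape P" by auto
    then obtain rs where rs: "rows_mono v rs" "addrows (shape P) rs (shape T)" "length rs = c" "part (shape P)"
      using N[OF PB(1)] by blast
    then show "\<mu> \<in> ?M" using PB(2) addrows_strip[OF rs(4,1,2)] addrows_psize[OF rs(2,4)] by simp
  next
    fix \<mu> assume \<mu>: "\<mu> \<in> ?M"
    then obtain rs where rs: "rows_mono v rs" "addrows \<mu> rs (shape T)"
      using addrows_exists[of \<mu> "shape T" v] part_shape[OF eg_tab_young[OF T'(1)]] by blast
    obtain P B where P: "inserts P B rs T" "eg_tab P" "set (reading P @ B) \<subseteq> {1..int n}" "shape P = \<mu>"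
      using inserts_rev_exists[OF T' _ rs(2)] \<mu> by blast
    note val = valid_prefix[OF P(1) T P(2,3)]
    have "block v B" using inserts_block[OF P(1-3) val(2)] rs(1) by blast
    moreover have "length B = c"
      using inserts_length[OF P(1)] addrows_psize[OF rs(2)] \<mu> by simp
    ultimately have "(P, B) \<in> ?N" using val(1) P by auto
    then show "\<mu> \<in> ?f ` ?N" using P(4) by force
  qed
  then show ?thesis using inj by (simp add: bij_betw_def)
qed

definition factor_blocks :: "nat \<Rightarrow> (nat \<Rightarrow> bool) \<Rightarrow> (nat \<Rightarrow> nat) \<Rightarrow> nat \<Rightarrow> int list list \<Rightarrow> int list list set" where
  "factor_blocks n t c L T = {Bs. length Bs = L \<and> (\<forall>i<L. block (t i) (Bs ! i) \<and> length (Bs ! i) = c i) \<and>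
     set (concat Bs) \<subseteq> {1..int n} \<and> (\<exists>rs. inserts [] (concat Bs) rs T)}"

lemma shape_empty_iff: "eg_tab T \<Longrightarrow> shape T = empty_part \<longleftrightarrow> T = []"
proof (cases T)
  case (Cons R U)
  assume "eg_tab T"
  then have "shape T 0 \<noteq> 0" using Cons by (simp add: shape_def)
  then have "shape T \<noteq> empty_part" by auto
  then show ?thesis using Cons by simp
qed (auto simp: shape_def)

text \<open>Both sides are fibred over the stage before the last block: one by pairs of a tableau
  and a last block, the other by the last but one shape of the chain.\<close>

lemma count_blocks:
  assumes "valid n T"
  shows "finite (factor_blocks n t c L T) \<and>
    card (factor_blocks n t c L T) = card {X \<in> chain_set t L empty_part (shape T). has_weight L X c}"
  using assms
proof (induction L arbitrary: T)
  case 0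
  then have e: "eg_tab T" by (simp add: valid_def)
  have "factor_blocks n t c 0 T = (if T = [] then {[]} else {})" by (auto simp: factor_blocks_def)
  moreover have "{X \<in> chain_set t 0 empty_part (shape T). has_weight 0 X c} = (if T = [] then {\<lambda>_. empty_part} else {})"
    using shape_empty_iff[OF e] part_zero
    by (auto simp: chain_set_def chain_def has_weight_def fun_eq_iff)
  ultimately show ?case by simp
next
  case (Suc L)
  let ?v = "t L"
  let ?N = "{(P, B). valid n P \<and> set B \<subseteq> {1..int n} \<and> block ?v B \<and> length B = c L \<and> (\<exists>rs. inserts P B rs T)}"
  let ?M = "{\<mu>. part \<mu> \<and> strip ?v \<mu> (shape T) \<and> psize (shape T) = psize \<mu> + c L}"
  let ?C = "\<lambda>\<mu>. {X \<in> chain_set t L empty_part \<mu>. has_weight L X c}"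
  note bij = block_bij[OF Suc.prems, of ?v "c L"]
  have pT: "part (shape T)" using Suc.prems part_shape[OF eg_tab_young] by (simp add: valid_def)
  have finM: "finite ?M"
    by (rule finite_subset[OF _ finite_below[OF pT]]) (auto dest: strip_le)
  then have finN: "finite ?N" using bij_betw_finite[OF bij] by simp
  have bij1: "bij_betw (\<lambda>(z, Bs). Bs @ [snd z]) (SIGMA z:?N. factor_blocks n t c L (fst z)) (factor_blocks n t c (Suc L) T)"
    unfolding bij_betw_def
  proof
    show "inj_on (\<lambda>(z, Bs). Bs @ [snd z]) (SIGMA z:?N. factor_blocks n t c L (fst z))"
    proof (rule inj_onI)
      fix y y' assume a: "y \<in> (SIGMA z:?N. factor_blocks n t c L (fst z))" "y' \<in> (SIGMA z:?N. factor_blocks n t c L (fst z))"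
        "(case y of (z, Bs) \<Rightarrow> Bs @ [snd z]) = (case y' of (z, Bs) \<Rightarrow> Bs @ [snd z])"
      obtain P B Bs P' B' Bs' where eq: "y = ((P, B), Bs)" "y' = ((P', B'), Bs')" by (metis surj_pair)
      then have "Bs = Bs'" "B = B'" using a(3) by auto
      moreover have "P = P'" using a(1,2) eq \<open>Bs = Bs'\<close> inserts_det[of "[]" "concat Bs"] by (auto simp: factor_blocks_def)
      ultimately show "y = y'" using eq by simp
    qed
    show "(\<lambda>(z, Bs). Bs @ [snd z]) ` (SIGMA z:?N. factor_blocks n t c L (fst z)) = factor_blocks n t c (Suc L) T"
    proof (intro equalityI subsetI)
      fix Y assume "Y \<in> (\<lambda>(z, Bs). Bs @ [snd z]) ` (SIGMA z:?N. factor_blocks n t c L (fst z))"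
      then obtain y where y: "y \<in> (SIGMA z:?N. factor_blocks n t c L (fst z))" "Y = (\<lambda>(z, Bs). Bs @ [snd z]) y"
        by blast
      obtain P B Bs where "y = ((P, B), Bs)" by (metis surj_pair)
      then have Y: "Y = Bs @ [B]" "(P, B) \<in> ?N" "Bs \<in> factor_blocks n t c L P" using y by simp_all
      then have "\<exists>rs. inserts [] (concat Bs @ B) rs T" unfolding factor_blocks_def inserts_append by blast
      moreover have "block (t i) (Y ! i) \<and> length (Y ! i) = c i" if "i < Suc L" for i
        using Y that by (cases "i = L") (auto simp: factor_blocks_def nth_append)
      ultimately show "Y \<in> factor_blocks n t c (Suc L) T" using Y by (auto simp: factor_blocks_def)
    next
      fix Y assume Y: "Y \<in> factor_blocks n t c (Suc L) T"
      then obtain Bs B where eq: "Y = Bs @ [B]" by (cases Y rule: rev_cases) (auto simp: factor_blocks_def)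
      have len: "length Bs = L" using Y eq by (simp add: factor_blocks_def)
      have b: "block (t i) (Y ! i) \<and> length (Y ! i) = c i" if "i < Suc L" for i using Y that by (simp add: factor_blocks_def)
      have l: "set (concat Bs) \<subseteq> {1..int n}" "set B \<subseteq> {1..int n}" using Y eq by (auto simp: factor_blocks_def)
      obtain rs1 rs2 P where P: "inserts [] (concat Bs) rs1 P" "inserts P B rs2 T"
        using Y eq by (auto simp: factor_blocks_def inserts_append)
      have w: "set (reading P) \<subseteq> {1..int n}" using inserts_word[OF P(1), of n] l by simp
      have "eg_tab P" using inserts_preserves_eg_tab[OF P(1)] by simp
      then have "valid n P" by (rule valid_prefix(1)[OF P(2) Suc.prems]) (use w l in simp)
      then have "(P, B) \<in> ?N" using b[of L] eq len P(2) l by (auto simp: nth_append)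
      moreover have "block (t i) (Bs ! i) \<and> length (Bs ! i) = c i" if "i < L" for i
        using b[of i] eq len that by (simp add: nth_append)
      then have "Bs \<in> factor_blocks n t c L P" using len l P(1) by (auto simp: factor_blocks_def)
      ultimately have "((P, B), Bs) \<in> (SIGMA z:?N. factor_blocks n t c L (fst z))" by simp
      then show "Y \<in> (\<lambda>(z, Bs). Bs @ [snd z]) ` (SIGMA z:?N. factor_blocks n t c L (fst z))"
        by (rule image_eqI[rotated]) (simp add: eq)
    qed
  qed
  let ?h = "\<lambda>(\<mu> :: nat \<Rightarrow> nat, X) i. if i \<le> L then X i else shape T"
  have bij2: "bij_betw ?h (Sigma ?M ?C) {X \<in> chain_set t (Suc L) empty_part (shape T). has_weight (Suc L) X c}"
    unfolding bij_betw_def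
  proof
    show "inj_on ?h (Sigma ?M ?C)"
    proof (rule inj_onI)
      fix y y' assume a: "y \<in> Sigma ?M ?C" "y' \<in> Sigma ?M ?C" "?h y = ?h y'"
      obtain \<mu> X \<mu>' X' where eq: "y = (\<mu>, X)" "y' = (\<mu>', X')" by (metis surj_pair)
      have X: "\<And>i. i \<ge> L \<Longrightarrow> X i = \<mu>" "\<And>i. i \<ge> L \<Longrightarrow> X' i = \<mu>'" using a eq by (auto simp: chain_set_def)
      have le: "X i = X' i" if "i \<le> L" for i using fun_cong[OF a(3), of i] that eq by simp
      then have "\<mu> = \<mu>'" using X[of L] by simp
      moreover have "X i = X' i" for i using le[of i] X[of i] \<open>\<mu> = \<mu>'\<close> by (cases "i \<le> L") auto
      ultimately show "y = y'" using eq by auto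
    qed
    show "?h ` Sigma ?M ?C = {X \<in> chain_set t (Suc L) empty_part (shape T). has_weight (Suc L) X c}"
    proof (intro equalityI subsetI)
      fix Z assume "Z \<in> ?h ` Sigma ?M ?C"
      then obtain \<mu> X where Z: "Z = (\<lambda>i. if i \<le> L then X i else shape T)" "\<mu> \<in> ?M" "X \<in> ?C \<mu>" by auto
      have XL: "X L = \<mu>" using Z(3) by (simp add: chain_set_def)
      show "Z \<in> {X \<in> chain_set t (Suc L) empty_part (shape T). has_weight (Suc L) X c}"
        using Z(2,3) XL pT unfolding Z(1) by (auto simp: chain_set_def chain_def has_weight_def less_Suc_eq le_Suc_eq)
    next
      fix Z assume Z: "Z \<in> {X \<in> chain_set t (Suc L) empty_part (shape T). has_weight (Suc L) X c}"
      let ?X = "\<lambda>i. Z (min i L)"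
      have ZS: "Z i = shape T" if "i \<ge> Suc L" for i using Z that by (simp add: chain_set_def)
      have "Z L \<in> ?M" using Z ZS[of "Suc L"] by (auto simp: chain_set_def chain_def has_weight_def)
      moreover have "?X \<in> ?C (Z L)" using Z by (auto simp: chain_set_def chain_def has_weight_def min_def)
      ultimately have "(Z L, ?X) \<in> Sigma ?M ?C" by (simp only: mem_Sigma_iff)
      moreover have "Z = ?h (Z L, ?X)"
      proof
        fix i show "Z i = ?h (Z L, ?X) i" using ZS[of i] by (cases "i \<le> L") (auto simp: min_def)
      qed
      ultimately show "Z \<in> ?h ` Sigma ?M ?C" by (rule image_eqI[rotated])
    qed
  qed
  have fin1: "\<forall>z\<in>?N. finite (factor_blocks n t c L (fst z))" using Suc.IH by auto
  have finite: "finite (factor_blocks n t c (Suc L) T)"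
    using bij_betw_finite[OF bij1] finite_SigmaI[OF finN, of "\<lambda>z. factor_blocks n t c L (fst z)"] fin1 by blast
  have "card (factor_blocks n t c (Suc L) T) = (\<Sum>z\<in>?N. card (factor_blocks n t c L (fst z)))"
    using bij_betw_same_card[OF bij1] card_SigmaI[OF finN fin1] by simp
  \<comment> \<open>The number of ways to reach \<open>P\<close> depends only on its shape; this is
    what permits the passage from tableaux to shapes.\<close>
  also have "\<dots> = (\<Sum>z\<in>?N. card (?C ((\<lambda>(P, B). shape P) z)))"
    using Suc.IH by (intro sum.cong) auto
  also have "\<dots> = (\<Sum>\<mu>\<in>?M. card (?C \<mu>))" by (rule sum.reindex_bij_betw[OF bij])
  also have "\<dots> = card (Sigma ?M ?C)" using finite_chain_set by (subst card_SigmaI[OF finM]) auto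
  also have "\<dots> = card {X \<in> chain_set t (Suc L) empty_part (shape T). has_weight (Suc L) X c}"
    using bij_betw_same_card[OF bij2] .
  finally show ?case using finite by blast
qed

subsection \<open>Signed factorizations\<close>

lemma reduced_word_abs:
  assumes "set w \<subseteq> {- int n..int n}"
  shows "reduced_word n (map abs w) u \<longleftrightarrow> reduced_word n w u"
proof -
  have s: "set (map abs w) \<subseteq> {- int n..int n}" using assms by force
  have e: "word_eq n w (map abs w)" by (rule word_eq_abs[OF assms])
  then have e': "word_eq n (map abs w) u \<longleftrightarrow> word_eq n w u"
    using word_eq.trans word_eq.sym by metis
  have "is_reduced n (map abs w) \<longleftrightarrow> is_reduced n w"
    using is_reduced_transfer[OF _ e s] is_reduced_transfer[OF _ word_eq.sym[OF e] assms] by auto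
  then show ?thesis using e' by (simp add: reduced_word_is_reduced)
qed

text \<open>Deleting the letter 0 fixes \<open>u\<close>, hence the group element, and would shorten
  \<open>w\<close>.\<close>

lemma reduced_word_no_zero:
  assumes "reduced_word n w u" "set u \<subseteq> {1..int n}" shows "0 \<notin> set w"
proof
  assume z: "0 \<in> set w"
  have "filter (\<lambda>a. a \<noteq> 0) u = u" using assms(2) by (intro filter_True) auto
  then have "word_eq n (filter (\<lambda>a. a \<noteq> 0) w) u"
    using word_eq_delete_zero[of n w u] assms(1) by (simp add: reduced_word_def)
  moreover have "set (filter (\<lambda>a. a \<noteq> 0) w) \<subseteq> {- int n..int n}" using assms(1) by (auto simp: reduced_word_def)
  ultimately have "length w \<le> length (filter (\<lambda>a. a \<noteq> 0) w)" using assms(1) by (simp add: reduced_word_def)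
  moreover have "length (filter (\<lambda>a. a \<noteq> 0) w) < length w" using z by (intro length_filter_less[of 0]) auto
  ultimately show False by simp
qed

section \<open>Edelman-Greene tableaux of a group element\<close>

lemma EG_iff:
  "T \<in> EG n u \<longleftrightarrow> eg_tab T \<and> set (reading T) \<subseteq> {1..int n} \<and> reduced_word n (reading T) u"
  unfolding EG_def eg_tab_iff by auto

lemma EG_valid: "T \<in> EG n u \<Longrightarrow> valid n T"
  by (simp add: EG_iff valid_def reduced_word_is_reduced)

lemma EG_length: "T \<in> EG n u \<Longrightarrow> set u \<subseteq> {1..int n} \<Longrightarrow> length (concat T) \<le> length u"
proof -
  assume T: "T \<in> EG n u" and u: "set u \<subseteq> {1..int n}"
  have "length (reading T) \<le> length u"
    using T letters_subset[OF u] word_eq.refl[of n u] unfolding EG_iff reduced_word_def by blast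
  then show ?thesis by (simp add: length_concat rev_map[symmetric])
qed

lemma finite_EG:
  assumes "set u \<subseteq> {1..int n}" shows "finite (EG n u)"
proof (rule finite_subset)
  let ?N = "length u"
  let ?W = "{row. set row \<subseteq> {1..int n} \<and> length row \<le> ?N}"
  show "finite {T. set T \<subseteq> ?W \<and> length T \<le> ?N}"
    by (intro finite_lists_length_le) simp
  show "EG n u \<subseteq> {T. set T \<subseteq> ?W \<and> length T \<le> ?N}"
  proof
    fix T assume T: "T \<in> EG n u"
    then have y: "young T" by (simp add: EG_def)
    note len = EG_length[OF T assms]
    have "length T \<le> length (concat T)"
    proof -
      have "length xs \<le> length (concat xs)" if "\<forall>row\<in>set xs. row \<noteq> []" for xs :: "int list list"
        using that
      proof (induction xs)
        case (Cons x xs)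
        then show ?case by (cases x) auto
      qed simp
      then show ?thesis using y by (simp add: young_def)
    qed
    moreover have "length row \<le> length (concat T)" if "row \<in> set T" for row
      using that by (simp add: length_concat member_le_sum_list)
    ultimately show "T \<in> {T. set T \<subseteq> ?W \<and> length T \<le> ?N}" using T len by (fastforce simp: EG_def)
  qed
qed

text \<open>Insertion keeps the group element and the length of the word. Hence a word is reduced
  for \<open>u\<close> exactly if the reading word of its insertion tableau is.\<close>

lemma factor_blocks_Union:
  "(\<Union>T\<in>EG n u. factor_blocks n t c L T) =
   {Bs. length Bs = L \<and> (\<forall>i<L. block (t i) (Bs ! i) \<and> length (Bs ! i) = c i) \<and>
     set (concat Bs) \<subseteq> {1..int n} \<and> reduced_word n (concat Bs) u}" (is "_ = ?R")
proof (intro equalityI subsetI)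
  fix Bs assume "Bs \<in> (\<Union>T\<in>EG n u. factor_blocks n t c L T)"
  then obtain T where T: "T \<in> EG n u" "Bs \<in> factor_blocks n t c L T" by blast
  then obtain rs where rs: "inserts [] (concat Bs) rs T" and l: "set (concat Bs) \<subseteq> {1..int n}" by (auto simp: factor_blocks_def)
  have w: "word_eq n (concat Bs) (reading T) \<and> length (reading T) = length (concat Bs) \<and> set (reading T) \<subseteq> {1..int n}"
    using inserts_word[OF rs, of n] l by simp
  have T': "word_eq n (reading T) u" "is_reduced n (reading T)" using T(1) by (auto simp: EG_iff reduced_word_is_reduced)
  have "is_reduced n (concat Bs)"
    by (rule is_reduced_transfer[OF T'(2) word_eq.sym letters_subset[OF l]]) (use w in auto)
  moreover have "word_eq n (concat Bs) u" using w T'(1) word_eq.trans by blast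
  ultimately show "Bs \<in> ?R" using T(2) by (simp add: factor_blocks_def reduced_word_is_reduced)
next
  fix Bs assume B: "Bs \<in> ?R"
  then have l: "set (reading [] @ concat Bs) \<subseteq> {1..int n}" and r: "is_reduced n (reading [] @ concat Bs)"
    and u: "word_eq n (concat Bs) u" by (auto simp: reduced_word_is_reduced)
  obtain rs T where rs: "inserts [] (concat Bs) rs T" using inserts_exists[OF _ l r] by auto
  have w: "word_eq n (concat Bs) (reading T) \<and> length (reading T) = length (concat Bs) \<and> set (reading T) \<subseteq> {1..int n}"
    using inserts_word[OF rs _ l] by simp
  have r': "is_reduced n (concat Bs)" using r by simp
  have "is_reduced n (reading T)" by (rule is_reduced_transfer[OF r' _ letters_subset]) (use w in auto)
  moreover have "word_eq n (reading T) u" using w u word_eq.sym word_eq.trans by blast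
  ultimately have "T \<in> EG n u" using w inserts_preserves_eg_tab[OF rs] by (simp add: EG_iff reduced_word_is_reduced)
  moreover have "Bs \<in> factor_blocks n t c L T" using B rs by (auto simp: factor_blocks_def)
  ultimately show "Bs \<in> (\<Union>T\<in>EG n u. factor_blocks n t c L T)" by blast
qed

section \<open>Restoring the signs\<close>

lemma concat_pairs:
  "length Bs = 2 * k \<Longrightarrow> concat (map (\<lambda>i. Bs ! (2 * i) @ Bs ! (2 * i + 1)) [0..<k]) = concat Bs"
proof (induction k arbitrary: Bs)
  case (Suc k)
  obtain Cs B B' where Bs: "Bs = Cs @ [B, B']" "length Cs = 2 * k"
  proof (cases Bs rule: rev_cases)
    case (snoc Ds B')
    then show thesis using that Suc.prems by (cases Ds rule: rev_cases) auto
  qed (use Suc.prems in simp)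
  have e: "map (\<lambda>i. Bs ! (2 * i) @ Bs ! (2 * i + 1)) [0..<k] = map (\<lambda>i. Cs ! (2 * i) @ Cs ! (2 * i + 1)) [0..<k]"
    using Bs by (intro map_cong) (auto simp: nth_append)
  have "concat (map (\<lambda>i. Bs ! (2 * i) @ Bs ! (2 * i + 1)) [0..<Suc k]) =
      concat (map (\<lambda>i. Bs ! (2 * i) @ Bs ! (2 * i + 1)) [0..<k]) @ Bs ! (2 * k) @ Bs ! (2 * k + 1)" by simp
  also have "\<dots> = concat Cs @ B @ B'" unfolding e Suc.IH[OF Bs(2)] by (simp add: Bs nth_append)
  finally show ?case by (simp add: Bs(1))
qed simp

lemma filter_split_sorted:
  fixes w :: "int list"
  assumes "sorted_wrt (<) w" shows "filter (\<lambda>a. a < 0) w @ filter (\<lambda>a. 0 \<le> a) w = w"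
  using assms
proof (induction w)
  case (Cons a w)
  have "filter (\<lambda>a. a < 0) w = []" if "0 \<le> a" using Cons.prems that by (force simp: filter_empty_conv)
  then show ?case using Cons by (cases "a < 0") auto
qed simp

text \<open>The unsigned blocks \<open>2 * i\<close> and \<open>2 * i + 1\<close> become the
  negative and the positive part of the signed block \<open>i\<close>. Negation turns a decreasing
  block into an increasing one, and negative letters precede positive ones.\<close>

definition merge_signs :: "nat \<Rightarrow> int list list \<Rightarrow> int list list" where
  "merge_signs k Bs = map (\<lambda>i. map uminus (Bs ! (2 * i)) @ Bs ! (2 * i + 1)) [0..<k]"

lemma merge_signs_abs:
  assumes "length Bs = 2 * k" "set (concat Bs) \<subseteq> {1..int n}"
  shows "map abs (concat (merge_signs k Bs)) = concat Bs"
proof -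
  have pos: "1 \<le> x" if "j < 2 * k" "x \<in> set (Bs ! j)" for j x
    using assms that nth_mem[of j Bs] by fastforce
  have "map abs (concat (merge_signs k Bs)) = concat (map (\<lambda>i. Bs ! (2 * i) @ Bs ! (2 * i + 1)) [0..<k])"
    unfolding merge_signs_def map_concat map_map
  proof (rule arg_cong[where f = concat], rule map_cong[OF HOL.refl])
    fix i assume "i \<in> set [0..<k]"
    then have i: "2 * i < 2 * k" "2 * i + 1 < 2 * k" by auto
    have "map (abs \<circ> uminus) (Bs ! (2 * i)) = Bs ! (2 * i)"
    proof (rule map_idI)
      fix x assume "x \<in> set (Bs ! (2 * i))"
      then have "1 \<le> x" by (rule pos[OF i(1)])
      then show "(abs \<circ> uminus) x = x" by simp
    qed
    moreover have "map abs (Bs ! (2 * i + 1)) = Bs ! (2 * i + 1)"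
    proof (rule map_idI)
      fix x assume "x \<in> set (Bs ! (2 * i + 1))"
      then have "1 \<le> x" by (rule pos[OF i(2)])
      then show "\<bar>x\<bar> = x" by simp
    qed
    ultimately show "(map abs \<circ> (\<lambda>i. map uminus (Bs ! (2 * i)) @ Bs ! (2 * i + 1))) i = Bs ! (2 * i) @ Bs ! (2 * i + 1)"
      by simp
  qed
  then show ?thesis using concat_pairs[OF assms(1)] by simp
qed

lemma set_merge_signs:
  assumes "length Bs = 2 * k" "set (concat Bs) \<subseteq> {1..int n}"
  shows "set (concat (merge_signs k Bs)) \<subseteq> {- int n..int n}"
proof
  fix x assume "x \<in> set (concat (merge_signs k Bs))"
  then have "\<bar>x\<bar> \<in> set (map abs (concat (merge_signs k Bs)))" by force
  then have "\<bar>x\<bar> \<le> int n" using assms merge_signs_abs[OF assms] by auto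
  then show "x \<in> {- int n..int n}" by auto
qed

lemma merge_signs_filter:
  assumes "length Bs = 2 * k" "set (concat Bs) \<subseteq> {1..int n}" "i < k"
  shows "filter (\<lambda>a. a < 0) (merge_signs k Bs ! i) = map uminus (Bs ! (2 * i))"
    "filter (\<lambda>a. 0 \<le> a) (merge_signs k Bs ! i) = Bs ! (2 * i + 1)"
proof -
  have pos: "1 \<le> x" if "j < 2 * k" "x \<in> set (Bs ! j)" for j x
    using assms that nth_mem[of j Bs] by fastforce
  have "\<forall>x\<in>set (Bs ! (2 * i)). 0 < x" "\<forall>x\<in>set (Bs ! (2 * i + 1)). 0 < x"
    using pos[of "2 * i"] pos[of "2 * i + 1"] assms(3) by force+
  then show "filter (\<lambda>a. a < 0) (merge_signs k Bs ! i) = map uminus (Bs ! (2 * i))"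
    "filter (\<lambda>a. 0 \<le> a) (merge_signs k Bs ! i) = Bs ! (2 * i + 1)"
    using assms(3) by (auto simp: merge_signs_def filter_map filter_empty_conv filter_id_conv comp_def not_less not_le
        intro: less_imp_le)
qed

text \<open>A strictly increasing block is its negative part followed by its positive part, so no
  information is lost when the signs are dropped: the parity of the position remembers them.\<close>

lemma RSIF_bij:
  assumes u: "set u \<subseteq> {1..int n}"
    and a: "\<And>m. m = 0 \<or> m > k \<Longrightarrow> a m = 0" and b: "\<And>m. m = 0 \<or> m > k \<Longrightarrow> b m = 0"
    and c: "\<And>i. c (2 * i) = a (Suc i)" "\<And>i. c (2 * i + 1) = b (Suc i)"
  shows "bij_betw (merge_signs k) (\<Union>T\<in>EG n u. factor_blocks n even c (2 * k) T) {v \<in> RSIF n u k. dw1 v = a \<and> dw2 v = b}"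
    (is "bij_betw _ ?U ?V")
proof -
  have U: "Bs \<in> ?U \<longleftrightarrow> length Bs = 2 * k \<and> (\<forall>i<2 * k. block (even i) (Bs ! i) \<and> length (Bs ! i) = c i) \<and>
     set (concat Bs) \<subseteq> {1..int n} \<and> reduced_word n (concat Bs) u" for Bs
    unfolding factor_blocks_Union by blast
  have inj: "inj_on (merge_signs k) ?U"
  proof (rule inj_onI)
    fix Bs Cs assume B: "Bs \<in> ?U" and C: "Cs \<in> ?U" and eq: "merge_signs k Bs = merge_signs k Cs"
    have B': "length Bs = 2 * k" "set (concat Bs) \<subseteq> {1..int n}" using B U by blast+
    have C': "length Cs = 2 * k" "set (concat Cs) \<subseteq> {1..int n}" using C U by blast+
    show "Bs = Cs"
    proof (rule nth_equalityI)
      show "length Bs = length Cs" using B'(1) C'(1) by simp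
      fix j assume j: "j < length Bs"
      define i where "i = j div 2"
      have i: "i < k" using j B'(1) by (simp add: i_def)
      have m: "map uminus (Bs ! (2 * i)) = map uminus (Cs ! (2 * i))" "Bs ! (2 * i + 1) = Cs ! (2 * i + 1)"
        using merge_signs_filter[OF B' i] merge_signs_filter[OF C' i] eq by simp_all
      have "Bs ! (2 * i) = Cs ! (2 * i)"
        using m(1) by (metis (no_types, lifting) inj_map_eq_map neg_equal_iff_equal inj_def)
      moreover have "j = 2 * i \<or> j = 2 * i + 1" unfolding i_def by presburger
      ultimately show "Bs ! j = Cs ! j" using m(2) by auto
    qed
  qed
  have "merge_signs k ` ?U = ?V"
  proof (intro equalityI subsetI)
    fix v assume "v \<in> merge_signs k ` ?U"
    then obtain Bs where Bs: "Bs \<in> ?U" and v: "v = merge_signs k Bs" by blast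
    have B': "length Bs = 2 * k" "set (concat Bs) \<subseteq> {1..int n}" using Bs U by blast+
    have bl: "block (even i) (Bs ! i)" "length (Bs ! i) = c i" if "i < 2 * k" for i using Bs U that by blast+
    have len: "length v = k" by (simp add: v merge_signs_def)
    have "sorted_wrt (<) (v ! i)" if i: "i < k" for i
    proof -
      have "sorted_wrt (>) (Bs ! (2 * i))" "sorted_wrt (<) (Bs ! (2 * i + 1))"
        using bl(1)[of "2 * i"] bl(1)[of "2 * i + 1"] i by (auto simp: block_def)
      moreover have "- x < y" if "x \<in> set (Bs ! (2 * i))" "y \<in> set (Bs ! (2 * i + 1))" for x y
      proof -
        have pos: "1 \<le> z" if "j < 2 * k" "z \<in> set (Bs ! j)" for j z
          using B' that nth_mem[of j Bs] by fastforce
        have "1 \<le> x" "1 \<le> y" using pos[of "2 * i" x] pos[of "2 * i + 1" y] that i by simp_all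
        then show ?thesis by simp
      qed
      ultimately show ?thesis
        using i by (auto simp: v merge_signs_def sorted_wrt_append sorted_wrt_map)
    qed
    then have "\<forall>block\<in>set v. sorted_wrt (<) block" using len by (auto simp: in_set_conv_nth)
    moreover have "reduced_word n (concat v) u"
      using reduced_word_abs[OF set_merge_signs[OF B']] merge_signs_abs[OF B'] Bs U v by simp
    moreover have "dw1 v = a"
    proof
      fix m show "dw1 v m = a m"
      proof (cases "1 \<le> m \<and> m \<le> k")
        case True
        then obtain i where i: "m = Suc i" "i < k" by (cases m) auto
        then show ?thesis using merge_signs_filter(1)[OF B' i(2)] bl(2)[of "2 * i"] c(1)[of i] len by (simp add: dw1_def v)
      next
        case False
        then show ?thesis using a[of m] len by (auto simp: dw1_def)
      qed
    qed
    moreover have "dw2 v = b"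
    proof
      fix m show "dw2 v m = b m"
      proof (cases "1 \<le> m \<and> m \<le> k")
        case True
        then obtain i where i: "m = Suc i" "i < k" by (cases m) auto
        then show ?thesis using merge_signs_filter(2)[OF B' i(2)] bl(2)[of "2 * i + 1"] c(2)[of i] len by (simp add: dw2_def v)
      next
        case False
        then show ?thesis using b[of m] len by (auto simp: dw2_def)
      qed
    qed
    ultimately show "v \<in> ?V" using len by (simp add: RSIF_def)
  next
    fix v assume v: "v \<in> ?V"
    then have len: "length v = k" and srt: "\<And>i. i < k \<Longrightarrow> sorted_wrt (<) (v ! i)"
      and red: "reduced_word n (concat v) u" and dw: "dw1 v = a" "dw2 v = b"
      by (auto simp: RSIF_def)
    \<comment> \<open>This makes the nonnegative letters of each block positive, so that the
      unsigned blocks are words in \<open>{1..int n}\<close>.\<close>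
    have nz: "0 \<notin> set (concat v)" by (rule reduced_word_no_zero[OF red u])
    have l: "set (concat v) \<subseteq> {- int n..int n}" using red by (simp add: reduced_word_def)
    define Bs where "Bs = map (\<lambda>j. if even j then map uminus (filter (\<lambda>a. a < 0) (v ! (j div 2)))
       else filter (\<lambda>a. 0 \<le> a) (v ! (j div 2))) [0..<2 * k]"
    have lenB: "length Bs = 2 * k" by (simp add: Bs_def)
    have B: "Bs ! (2 * i) = map uminus (filter (\<lambda>a. a < 0) (v ! i))" "Bs ! (2 * i + 1) = filter (\<lambda>a. 0 \<le> a) (v ! i)"
      if "i < k" for i using that by (auto simp: Bs_def)
    have m: "merge_signs k Bs = v"
    proof (rule nth_equalityI)
      fix i assume "i < length (merge_signs k Bs)"
      then have i: "i < k" by (simp add: merge_signs_def)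
      then show "merge_signs k Bs ! i = v ! i"
        using filter_split_sorted[OF srt[OF i]] B[OF i] by (simp add: merge_signs_def comp_def)
    qed (simp add: merge_signs_def len)
    have j2: "\<exists>i<k. j = 2 * i \<or> j = 2 * i + 1" if "j < 2 * k" for j
      using that by (intro exI[of _ "j div 2"]) auto
    have letters: "set (concat Bs) \<subseteq> {1..int n}"
    proof
      fix x assume "x \<in> set (concat Bs)"
      then obtain C where C: "C \<in> set Bs" "x \<in> set C" by auto
      then obtain j where j: "j < 2 * k" "x \<in> set (Bs ! j)" using lenB in_set_conv_nth[of C Bs] by auto
      then obtain i where i: "i < k" "j = 2 * i \<or> j = 2 * i + 1" using j2 by blast
      have "y \<in> set (concat v)" if "y \<in> set (v ! i)" for y using that i(1) len nth_mem[of i v] by auto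
      then have "y \<noteq> 0 \<and> - int n \<le> y \<and> y \<le> int n" if "y \<in> set (v ! i)" for y using that nz l by fastforce
      then show "x \<in> {1..int n}" using i(2) j(2) B[OF i(1)] by force
    qed
    have "concat Bs = map abs (concat v)" using merge_signs_abs[OF lenB letters] m by simp
    then have "reduced_word n (concat Bs) u" using red reduced_word_abs[OF l] by simp
    moreover have "block (even j) (Bs ! j) \<and> length (Bs ! j) = c j" if jk: "j < 2 * k" for j
    proof -
      obtain i where i: "i < k" "j = 2 * i \<or> j = 2 * i + 1" using j2[OF jk] by blast
      have s: "sorted_wrt (<) (filter P (v ! i))" for P using srt[OF i(1)] by (rule sorted_wrt_filter)
      have "length (filter (\<lambda>a. a < 0) (v ! i)) = a (Suc i)" "length (filter (\<lambda>a. 0 \<le> a) (v ! i)) = b (Suc i)"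
        using fun_cong[OF dw(1), of "Suc i"] fun_cong[OF dw(2), of "Suc i"] i(1) len by (auto simp: dw1_def dw2_def)
      then show ?thesis
        using i(2) s B[OF i(1)] c[of i] by (auto simp: block_def sorted_wrt_map)
    qed
    ultimately have "Bs \<in> ?U" using U lenB letters by blast
    then show "v \<in> merge_signs k ` ?U" using m by blast
  qed
  then show ?thesis using inj by (simp add: bij_betw_def)
qed

section \<open>Comparison of coefficients\<close>

text \<open>Exponent functions have a value at 0 as well, where there is no variable; a nonzero
  value there makes both sides of the identity vanish.\<close>

lemma schur_coeff_zero: "a 0 \<noteq> 0 \<Longrightarrow> schur_coeff lam a = 0"
proof -
  assume a: "a 0 \<noteq> 0"
  have "\<not> (ssyt R \<and> has_shape R lam \<and> (\<forall>m. count_list (concat R) m = a m))" for R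
  proof
    assume R: "ssyt R \<and> has_shape R lam \<and> (\<forall>m. count_list (concat R) m = a m)"
    then have "0 \<notin> set (concat R)" unfolding ssyt_def by force
    then have "count_list (concat R) 0 = 0" by (simp add: count_list_0_iff)
    then show False using R a by metis
  qed
  then have "{R. ssyt R \<and> has_shape R lam \<and> (\<forall>m. count_list (concat R) m = a m)} = {}" by blast
  then show ?thesis unfolding schur_coeff_def by (simp only: card.empty)
qed

lemma RSIF_count:
  assumes u: "set u \<subseteq> {1..int n}" and k: "length u \<le> k"
    and a: "\<And>m. m > k \<Longrightarrow> a m = 0" and b: "\<And>m. m > k \<Longrightarrow> b m = 0"
  shows "card {v \<in> RSIF n u k. dw1 v = a \<and> dw2 v = b} =
    (\<Sum>T\<in>EG n u. \<Sum>S\<in>HT (map length T). schur_coeff (pdw1 S) a * schur_coeff (pdw2 S) b)"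
proof (cases "a 0 = 0 \<and> b 0 = 0")
  case False
  have "dw1 v 0 = 0" "dw2 v 0 = 0" for v by (auto simp: dw1_def dw2_def)
  then have e: "{v \<in> RSIF n u k. dw1 v = a \<and> dw2 v = b} = {}" using False by auto
  have z: "schur_coeff (pdw1 S) a * schur_coeff (pdw2 S) b = 0" for S
    using False schur_coeff_zero[of a] schur_coeff_zero[of b] by auto
  show ?thesis unfolding e z by simp
next
  case True
  have a': "\<And>m. m = 0 \<or> m > k \<Longrightarrow> a m = 0" and b': "\<And>m. m = 0 \<or> m > k \<Longrightarrow> b m = 0" using True a b by auto
  define c where "c i = (if even i then a (Suc (i div 2)) else b (Suc (i div 2)))" for i
  have c: "c (2 * i) = a (Suc i)" "c (2 * i + 1) = b (Suc i)" for i by (auto simp: c_def)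
  have wt: "has_weight (2 * k) X c \<longleftrightarrow> stair_weight k X (\<lambda>i. a (Suc i)) (\<lambda>i. b (Suc i))" for X
  proof
    assume h: "has_weight (2 * k) X c"
    show "stair_weight k X (\<lambda>i. a (Suc i)) (\<lambda>i. b (Suc i))"
      unfolding stair_weight_def
    proof (intro allI impI)
      fix i assume "i < k"
      then have "2 * i < 2 * k" "2 * i + 1 < 2 * k" by auto
      then show "psize (X (2 * i + 1)) = psize (X (2 * i)) + a (Suc i) \<and>
          psize (X (2 * i + 2)) = psize (X (2 * i + 1)) + b (Suc i)"
        using h c[of i] unfolding has_weight_def by (metis Suc_eq_plus1 add_2_eq_Suc')
    qed
  next
    assume h: "stair_weight k X (\<lambda>i. a (Suc i)) (\<lambda>i. b (Suc i))"
    show "has_weight (2 * k) X c"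
      unfolding has_weight_def
    proof (intro allI impI)
      fix j assume j: "j < 2 * k"
      define i where "i = j div 2"
      have i: "i < k" "j = 2 * i \<or> j = 2 * i + 1" using j unfolding i_def by auto
      then show "psize (X (Suc j)) = psize (X j) + c j"
        using h c[of i] unfolding stair_weight_def by auto
    qed
  qed
  have "card {v \<in> RSIF n u k. dw1 v = a \<and> dw2 v = b} = card (\<Union>T\<in>EG n u. factor_blocks n even c (2 * k) T)"
    using bij_betw_same_card[OF RSIF_bij[OF u a' b' c]] by simp
  also have "\<dots> = (\<Sum>T\<in>EG n u. card (factor_blocks n even c (2 * k) T))"
  proof (rule card_UN_disjoint[OF finite_EG[OF u]])
    show "\<forall>T\<in>EG n u. finite (factor_blocks n even c (2 * k) T)" using count_blocks[OF EG_valid] by blast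
    show "\<forall>T\<in>EG n u. \<forall>T'\<in>EG n u. T \<noteq> T' \<longrightarrow> factor_blocks n even c (2 * k) T \<inter> factor_blocks n even c (2 * k) T' = {}"
      using inserts_det[of "[]"] by (auto simp: factor_blocks_def)
  qed
  also have "\<dots> = (\<Sum>T\<in>EG n u. \<Sum>S\<in>HT (map length T). schur_coeff (pdw1 S) a * schur_coeff (pdw2 S) b)"
  proof (rule sum.cong[OF HOL.refl])
    fix T assume T: "T \<in> EG n u"
    then have y: "young T" by (simp add: EG_def)
    \<comment> \<open>A tableau for \<open>u\<close> has as many cells as a reduced word for
      \<open>u\<close> has letters, hence at most \<open>length u\<close>; this is where the number
      of blocks has to be large.\<close>
    have "psize (shape T) \<le> k" using EG_length[OF T u] k by (simp add: psize_shape)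
    from HT_sum[OF y this a' b'] show "card (factor_blocks n even c (2 * k) T) =
        (\<Sum>S\<in>HT (map length T). schur_coeff (pdw1 S) a * schur_coeff (pdw2 S) b)"
      using count_blocks[OF EG_valid[OF T], of even c "2 * k"] by (simp add: wt)
  qed
  finally show ?thesis .
qed

text \<open>The limit is taken coefficientwise: \<open>a\<close> and \<open>b\<close> are the
  exponents of one monomial, and its coefficient is constant as soon as \<open>k\<close> bounds the
  length of \<open>u\<close> and the supports of \<open>a\<close> and \<open>b\<close>.\<close>

theorem theorem3p6:
  fixes n :: nat and u :: "int list" and a b :: "nat \<Rightarrow> nat"
  assumes "set u \<subseteq> {1..int n}"
    and "finite {i. a i \<noteq> 0}" and "finite {i. b i \<noteq> 0}"
  shows "\<forall>\<^sub>F k in sequentially.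
           card {v \<in> RSIF n u k. dw1 v = a \<and> dw2 v = b} =
           (\<Sum>T\<in>EG n u. \<Sum>S\<in>HT (map length T). schur_coeff (pdw1 S) a * schur_coeff (pdw2 S) b)"
proof -
  obtain A where "\<forall>m\<in>{i. a i \<noteq> 0}. m \<le> A"
    using assms(2) unfolding finite_nat_set_iff_bounded_le by blast
  then have A: "a m = 0" if "m > A" for m using that leD by blast
  obtain B where "\<forall>m\<in>{i. b i \<noteq> 0}. m \<le> B"
    using assms(3) unfolding finite_nat_set_iff_bounded_le by blast
  then have B: "b m = 0" if "m > B" for m using that leD by blast
  show ?thesis
    unfolding eventually_sequentially
  proof (intro exI allI impI)
    fix k assume k: "max (length u) (max A B) \<le> k"
    show "card {v \<in> RSIF n u k. dw1 v = a \<and> dw2 v = b} =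
           (\<Sum>T\<in>EG n u. \<Sum>S\<in>HT (map length T). schur_coeff (pdw1 S) a * schur_coeff (pdw2 S) b)"
      by (rule RSIF_count[OF assms(1)]) (use k A B in auto)
  qed
qed

end
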